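(* Let $L$ be the empirical loss functional of the mean-field one-hidden-layer network on $\mathcal P_2(\Theta)$. If a gradient flow $(\mu_T)_{T\ge0}$ of $L$ with initial distribution $\mu\in\mathcal P_2(\Theta)$ converges to $\mu_\infty$ in $\mathcal W_2$ as $T\to\infty$, and $\mu_\infty\in\arg\min_{\nu\in\mathcal P_2(\Theta)}L(\nu)$, then $$\mu_\infty\in\arg\min\big\{d_G(\mu,\nu):\ \nu\in\arg\min L\big\}.$$
   Context: Parameter space $\Theta=\mathbb R\times\mathbb R^d\times\mathbb R$ with $\theta=(w,a,b)$; $\mathcal P_2(\Theta)$ is the set of probability measures on $\Theta$ with finite second moment, with the Wasserstein-2 metric $\mathcal W_2$. Given an activation $\sigma:\mathbb R\to\mathbb R$, a loss $\tilde L:\mathbb R\to\mathbb R_{\ge0}$ and data $(x_k,y_k)_{k=1}^M\subset\mathbb R^d\times\mathbb R$, set $$f_\mu(x)=\int_\Theta w\,\sigma(a\cdot x+b)\,\mu(\mathrm dw,\mathrm da,\mathrm db),\qquad L(\mu)=\frac1M\sum_{k=1}^M\tilde L(f_\mu(x_k)-y_k).$$ Standing assumptions: $\min_{\mathcal P_2(\Theta)}L=0$; and (i) there is $S_0\ge0$ with $|\sigma(z)-\sigma(z')|\le S_0|z-z'|$, $|\sigma(z)|\le S_0$, $|\sigma'(z)|\le S_0$ for all $z,z'\in\mathbb R$; (ii) $R:=\max_k\|x_k\|<\infty$; (iii) $\tilde L\in\mathcal C^1(\mathbb R)$ is convex and $|\tilde L'(r)-\tilde L'(s)|\le\beta|r-s|$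 for all $r,s$, for some $\beta>0$; (iv) $\min_{\mathbb R}\tilde L=0$. Upper gradient: $G(\mu)=\big(\int_\Theta\|\nabla_\theta\partial_\mu L(\mu)(\theta)\|^2\mu(\mathrm d\theta)\big)^{1/2}$, where $\partial_\mu L(\mu)(\theta)=\frac1M\sum_k\tilde L'(f_\mu(x_k)-y_k)\,w\,\sigma(a\cdot x_k+b)$ is the linear derivative. (Equivalently $G=\sqrt{2(\ell_0-L)}$ with $\ell_0=L+\frac12\int\|\nabla_\theta\partial_\mu L\|^2\mathrm d\mu$, the running cost of the control problem whose value function is $L$.) $G$ is a strong upper gradient of $L$: $|L(\mu_t)-L(\mu_s)|\le\int_s^tG(\mu_r)|\mu'|(r)\mathrm dr$ along absolutely continuous curves. Metric derivative: $|\mu'|(t)=\lim_{s\to t}\mathcal W_2(\mu_s,\mu_t)/|s-t|$. $AC^2(I)$: curves with $\mathcal W_2(\mu_s,\mu_t)\le\int_s^tm_u\mathrm du$ for some $m\in L^2(I)$; $AC^2_{loc}$: this holds on compact subintervals. A gradient flow of $L$ started at $\mu$ is a curve of maximal slope: $\boldsymbol\mu\in AC^2_{loc}([0,\infty);\mathcal P_2(\Theta))$, $\mu_0=\mu$, with $-\frac{\mathrm d}{\mathrm dt}L(\mu_t)=|\mu'|^2(t)=G^2(\mu_t)$ for a.e. $t>0$. Finsler pseudo-distance: $d_G(\mu,\nu)=\inf\big\{\int_0^1|\mu'|(t)\,G(\mu_t)\,\mathrm dt:\ \boldsymbol\mu\in AC^2([0,1];\mathcal P_2(\Theta)),\ \mu_0=\mu,\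 \mu_1=\nu\big\}$. *)

theory Defs
  imports "HOL-Probability.Probability"
begin

definition P2 :: "'a::euclidean_space measure set" where
  "P2 = {\<mu>. prob_space \<mu> \<and> sets \<mu> = sets borel \<and> integrable \<mu> (\<lambda>\<theta>. (norm \<theta>)\<^sup>2)}"

definition couplings ::
  "'a::euclidean_space measure \<Rightarrow> 'a measure \<Rightarrow> ('a \<times> 'a) measure set" where
  "couplings \<mu> \<nu> =
     {\<pi>. sets \<pi> = sets borel \<and> distr \<pi> borel fst = \<mu> \<and> distr \<pi> borel snd = \<nu>}"

text \<open>
  Only used on \<^const>\<open>P2\<close>: there the product coupling exists and the quadratic cost is integrable
  for every coupling, so neither the Bochner integral nor the real infimum is degenerate.
\<close>

definition W2 :: "'a::euclidean_space measure \<Rightarrow> 'a measure \<Rightarrow> real" where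
  "W2 \<mu> \<nu> = sqrt (INF \<pi>\<in>couplings \<mu> \<nu>. LINT p|\<pi>. (dist (fst p) (snd p))\<^sup>2)"

definition AC2 :: "real set \<Rightarrow> (real \<Rightarrow> 'a::euclidean_space measure) \<Rightarrow> bool" where
  "AC2 I c \<longleftrightarrow>
     (\<forall>t\<in>I. c t \<in> P2) \<and>
     (\<exists>m. set_borel_measurable lborel I m \<and> set_integrable lborel I (\<lambda>u. (m u)\<^sup>2) \<and>
          (\<forall>s\<in>I. \<forall>t\<in>I. s \<le> t \<longrightarrow> W2 (c s) (c t) \<le> (LINT u:{s..t}|lborel. m u)))"

definition AC2_loc :: "real set \<Rightarrow> (real \<Rightarrow> 'a::euclidean_space measure) \<Rightarrow> bool" where
  "AC2_loc I c \<longleftrightarrow> (\<forall>a b. a \<le> b \<and> {a..b} \<subseteq> I \<longrightarrow> AC2 {a..b} c)"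

text \<open>
  The limit is two-sided. It is only used for almost every \<open>t\<close>, hence at interior points of the
  interval on which the curve is considered, where it depends on nothing outside that interval.
\<close>

definition has_metric_derivative ::
  "(real \<Rightarrow> 'a::euclidean_space measure) \<Rightarrow> real \<Rightarrow> real \<Rightarrow> bool" where
  "has_metric_derivative c v t \<longleftrightarrow> ((\<lambda>s. W2 (c s) (c t) / \<bar>s - t\<bar>) \<longlongrightarrow> v) (at t)"

definition metric_derivative :: "(real \<Rightarrow> 'a::euclidean_space measure) \<Rightarrow> real \<Rightarrow> real" where
  "metric_derivative c t = (THE v. has_metric_derivative c v t)"

definition gradient_flow ::
  "('a::euclidean_space measure \<Rightarrow> real) \<Rightarrow> ('a measure \<Rightarrow> real) \<Rightarrow>
   'a measure \<Rightarrow> (real \<Rightarrow> 'a measure) \<Rightarrow> bool" where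
  "gradient_flow L G \<mu> c \<longleftrightarrow>
     AC2_loc {0..} c \<and> c 0 = \<mu> \<and>
     (AE t in lborel. t > 0 \<longrightarrow>
        (\<exists>v. has_metric_derivative c v t \<and>
             ((\<lambda>r. L (c r)) has_real_derivative - (v\<^sup>2)) (at t) \<and>
             v\<^sup>2 = (G (c t))\<^sup>2))"

definition finsler_dist ::
  "('a::euclidean_space measure \<Rightarrow> real) \<Rightarrow> 'a measure \<Rightarrow> 'a measure \<Rightarrow> ennreal" where
  "finsler_dist G \<mu> \<nu> =
     (INF c\<in>{c. AC2 {0..1} c \<and> c 0 = \<mu> \<and> c 1 = \<nu>}.
        \<integral>\<^sup>+t\<in>{0..1}. ennreal (metric_derivative c t * G (c t)) \<partial>lborel)"

type_synonym 'd param = "real \<times> (real ^ 'd) \<times> real"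

definition network ::
  "(real \<Rightarrow> real) \<Rightarrow> 'd::finite param measure \<Rightarrow> real ^ 'd \<Rightarrow> real" where
  "network \<sigma> \<mu> x = (LINT (w, a, b)|\<mu>. w * \<sigma> (a \<bullet> x + b))"

text \<open>The data are the pairs \<open>(x k, y k)\<close> with \<open>k \<in> {1..M}\<close>.\<close>

definition emp_loss ::
  "(real \<Rightarrow> real) \<Rightarrow> (real \<Rightarrow> real) \<Rightarrow> nat \<Rightarrow> (nat \<Rightarrow> real ^ 'd::finite) \<Rightarrow> (nat \<Rightarrow> real) \<Rightarrow>
   'd param measure \<Rightarrow> real" where
  "emp_loss \<sigma> loss M x y \<mu> = (1 / real M) * (\<Sum>k=1..M. loss (network \<sigma> \<mu> (x k) - y k))"

definition linear_derivative ::
  "(real \<Rightarrow> real) \<Rightarrow> (real \<Rightarrow> real) \<Rightarrow> nat \<Rightarrow> (nat \<Rightarrow> real ^ 'd::finite) \<Rightarrow> (nat \<Rightarrow> real) \<Rightarrow>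
   'd param measure \<Rightarrow> 'd param \<Rightarrow> real" where
  "linear_derivative \<sigma> loss M x y \<mu> = (\<lambda>(w, a, b).
     (1 / real M) *
     (\<Sum>k=1..M. deriv loss (network \<sigma> \<mu> (x k) - y k) * (w * \<sigma> (a \<bullet> x k + b))))"

definition gradient :: "('a::euclidean_space \<Rightarrow> real) \<Rightarrow> 'a \<Rightarrow> 'a" where
  "gradient f \<theta> = (THE D. GDERIV f \<theta> :> D)"

definition upper_gradient ::
  "(real \<Rightarrow> real) \<Rightarrow> (real \<Rightarrow> real) \<Rightarrow> nat \<Rightarrow> (nat \<Rightarrow> real ^ 'd::finite) \<Rightarrow> (nat \<Rightarrow> real) \<Rightarrow>
   'd param measure \<Rightarrow> real" where
  "upper_gradient \<sigma> loss M x y \<mu> =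
     sqrt (LINT \<theta>|\<mu>. (norm (gradient (linear_derivative \<sigma> loss M x y \<mu>) \<theta>))\<^sup>2)"

end

theory Submission
  imports Defs
begin

text \<open>
  The energy identity makes the flow a shortest path. Write \<open>L\<close> for the loss and \<open>G\<close> for its upper
  gradient. Along any curve from \<open>\<mu>\<close> to \<open>\<nu>\<close> the loss drops by at most the \<open>G\<close>-weighted length, because
  \<open>\<bar>(L \<circ> c)'\<bar> \<le> G \<sqdot> |c'|\<close> almost everywhere; so every minimiser \<open>\<nu>\<close> satisfies
  \<open>d_G(\<mu>, \<nu>) \<ge> L(\<mu>) - L(\<nu>) = L(\<mu>)\<close> (lemma \<open>loss_drop_le_finsler_dist\<close>). Along the gradient flow this
  inequality is an equality, since there \<open>G \<sqdot> |c'| = |c'|\<^sup>2 = -(L \<circ> c)'\<close>. Hence \<open>d_G(\<mu>, \<mu>_lim)\<close> is at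
  most \<open>L(\<mu>)\<close>, and the limit \<open>\<mu>_lim\<close> attains the lower bound.

  The flow needs infinite time and possibly infinite Wasserstein length to reach its limit, so it need not
  have an admissible reparametrisation on \<open>[0, 1]\<close>. Instead one follows it up to a large time \<open>T\<close> and
  then joins \<open>c T\<close> to \<open>\<mu>_lim\<close> by displacement interpolation along an almost optimal coupling. The
  added piece has Wasserstein length close to \<open>W2 (c T) \<mu>_lim\<close>, which tends to \<open>0\<close>, while \<open>G\<close> stays
  bounded on it because second moments do (lemmas \<open>finsler_dist_flow_le\<close> and
  \<open>finsler_dist_flow_limit_le\<close>).

  Three ingredients support this. First, \<open>W2\<close> satisfies the triangle inequality. The usual gluing of two couplings
  disintegrates them over the common marginal; here they are glued only along a countable partition of
  the space into cells of small diameter, which gives the inequality up to an arbitrarily small error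
  (\<open>approximate_gluing\<close>). Second, a curve whose increments are dominated by \<open>\<integral> m\<close> has a metric derivative
  almost everywhere (\<open>metric_derivative_exists\<close>). This rests on the real-valued statement
  \<open>dominated_increments_derivative\<close>: an absolutely continuous function is differentiable almost everywhere
  and is the integral of its derivative. Third, for a differentiable \<open>\<phi>\<close> of linear growth, the slope
  of \<open>\<mu> \<mapsto> \<integral>\<phi> d\<mu>\<close> in \<open>W2\<close> is at most the norm of \<open>\<nabla>\<phi>\<close> in \<open>L\<^sup>2(\<mu>)\<close> (\<open>slope_estimate\<close>). At a fixed time, the chain
  rule turns the derivative of the loss into the derivative of the integral of one such function, the
  linear derivative of \<open>L\<close> at the current measure (\<open>loss_derivative_bound\<close>).
\<close>

section \<open>Square-integrable functions\<close>

text \<open>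
  Optimising over \<open>l\<close> gives \<open>(sqrt A + sqrt B)\<^sup>2\<close> at \<open>l = sqrt B / sqrt A\<close>. This choice degenerates when a root
  vanishes, hence the proof enlarges both roots slightly.
\<close>

lemma sqrt_le_add_sqrtI:
  fixes A B C :: real
  assumes A: "0 \<le> A" and B: "0 \<le> B"
    and C: "\<And>l. l > 0 \<Longrightarrow> C \<le> (1 + l) * A + (1 + 1 / l) * B"
  shows "sqrt C \<le> sqrt A + sqrt B"
proof (rule field_le_epsilon)
  fix e :: real assume e: "e > 0"
  define a where "a = sqrt A + e / 2"
  define b where "b = sqrt B + e / 2"
  have ab: "a > 0" "b > 0" and le: "A \<le> a\<^sup>2" "B \<le> b\<^sup>2"
    using e A B unfolding a_def b_def
    by (auto intro: sqrt_le_D add_nonneg_pos)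
  have "C \<le> (1 + b / a) * A + (1 + 1 / (b / a)) * B"
    using ab by (intro C) simp
  also have "\<dots> \<le> (1 + b / a) * a\<^sup>2 + (1 + 1 / (b / a)) * b\<^sup>2"
    using ab le by (intro add_mono mult_left_mono) auto
  also have "\<dots> = (a + b)\<^sup>2"
    using ab by (simp add: field_simps power2_eq_square)
  finally have "sqrt C \<le> a + b"
    using ab by (intro real_le_lsqrt) auto
  then show "sqrt C \<le> sqrt A + sqrt B + e"
    by (simp add: a_def b_def)
qed

text \<open>
  Young's inequality \<open>(p + q)\<^sup>2 \<le> (1 + l) p\<^sup>2 + (1 + 1/l) q\<^sup>2\<close>, integrated for each \<open>l\<close>, is exactly the
  hypothesis of \<open>sqrt_le_add_sqrtI\<close>. Dominating \<open>h\<close> by \<open>f + g\<close>, rather than equating it to a sum, lets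
  distances be inserted directly.
\<close>

lemma L2_norm_triangle:
  fixes f g h :: "'a \<Rightarrow> real"
  assumes [measurable]: "h \<in> borel_measurable M"
    and f: "integrable M (\<lambda>x. (f x)\<^sup>2)" and g: "integrable M (\<lambda>x. (g x)\<^sup>2)"
    and le: "AE x in M. \<bar>h x\<bar> \<le> f x + g x"
  shows "integrable M (\<lambda>x. (h x)\<^sup>2)"
    and "sqrt (LINT x|M. (h x)\<^sup>2) \<le> sqrt (LINT x|M. (f x)\<^sup>2) + sqrt (LINT x|M. (g x)\<^sup>2)"
proof -
  have young: "(h x)\<^sup>2 \<le> (1 + l) * (f x)\<^sup>2 + (1 + 1 / l) * (g x)\<^sup>2"
    if "l > 0" "\<bar>h x\<bar> \<le> f x + g x" for l x
  proof -
    have "(h x)\<^sup>2 \<le> (f x + g x)\<^sup>2"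
      using that(2) abs_le_square_iff[of "h x" "f x + g x"] by linarith
    also have "\<dots> = (1 + l) * (f x)\<^sup>2 + (1 + 1 / l) * (g x)\<^sup>2 - (l * f x - g x)\<^sup>2 / l"
      using that(1) by (simp add: field_simps power2_eq_square)
    also have "\<dots> \<le> (1 + l) * (f x)\<^sup>2 + (1 + 1 / l) * (g x)\<^sup>2"
      using that(1) by simp
    finally show ?thesis .
  qed
  have int: "integrable M (\<lambda>x. (1 + l) * (f x)\<^sup>2 + (1 + 1 / l) * (g x)\<^sup>2)" for l :: real
    using f g by auto
  show h: "integrable M (\<lambda>x. (h x)\<^sup>2)"
    by (rule Bochner_Integration.integrable_bound[OF int[of 1]])
      (use le young[of 1] in \<open>auto elim!: eventually_mono intro: order_trans[OF _ abs_ge_self]\<close>)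
  show "sqrt (LINT x|M. (h x)\<^sup>2) \<le> sqrt (LINT x|M. (f x)\<^sup>2) + sqrt (LINT x|M. (g x)\<^sup>2)"
  proof (rule sqrt_le_add_sqrtI)
    fix l :: real assume "l > 0"
    then have "(LINT x|M. (h x)\<^sup>2) \<le> (LINT x|M. (1 + l) * (f x)\<^sup>2 + (1 + 1 / l) * (g x)\<^sup>2)"
      using le by (intro integral_mono_AE h int) (auto elim!: eventually_mono intro: young)
    also have "\<dots> = (1 + l) * (LINT x|M. (f x)\<^sup>2) + (1 + 1 / l) * (LINT x|M. (g x)\<^sup>2)"
      using f g by simp
    finally show "(LINT x|M. (h x)\<^sup>2) \<le> \<dots>" .
  qed (auto intro: integral_nonneg_AE)
qed

lemma L2_Cauchy_Schwarz:
  fixes f g :: "'a \<Rightarrow> real"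
  assumes [measurable]: "f \<in> borel_measurable M" "g \<in> borel_measurable M"
    and f: "integrable M (\<lambda>x. (f x)\<^sup>2)" and g: "integrable M (\<lambda>x. (g x)\<^sup>2)"
  shows "integrable M (\<lambda>x. f x * g x)"
    and "(LINT x|M. \<bar>f x * g x\<bar>) \<le> sqrt (LINT x|M. (f x)\<^sup>2) * sqrt (LINT x|M. (g x)\<^sup>2)"
proof -
  define A where "A = (LINT x|M. (f x)\<^sup>2)"
  define B where "B = (LINT x|M. (g x)\<^sup>2)"
  have AB: "A \<ge> 0" "B \<ge> 0" by (auto simp: A_def B_def intro: integral_nonneg_AE)
  have young: "\<bar>f x * g x\<bar> \<le> l * (f x)\<^sup>2 + (g x)\<^sup>2 / (4 * l)" if "l > 0" for l x
  proof -
    have "\<bar>f x\<bar> * \<bar>g x\<bar> = l * (f x)\<^sup>2 + (g x)\<^sup>2 / (4 * l) - (2 * l * \<bar>f x\<bar> - \<bar>g x\<bar>)\<^sup>2 / (4 * l)"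
      using that by (simp add: field_simps power2_eq_square)
    also have "\<dots> \<le> l * (f x)\<^sup>2 + (g x)\<^sup>2 / (4 * l)"
      using that by simp
    finally show ?thesis by (simp add: abs_mult)
  qed
  have int: "integrable M (\<lambda>x. l * (f x)\<^sup>2 + (g x)\<^sup>2 / (4 * l))" for l :: real
    using f g by auto
  show fg: "integrable M (\<lambda>x. f x * g x)"
    by (rule Bochner_Integration.integrable_bound[OF int[of 1]])
      (use young[of 1] in \<open>auto intro: order_trans[OF _ abs_ge_self]\<close>)
  have bound: "(LINT x|M. \<bar>f x * g x\<bar>) \<le> l * A + B / (4 * l)" if "l > 0" for l
  proof -
    have "(LINT x|M. \<bar>f x * g x\<bar>) \<le> (LINT x|M. l * (f x)\<^sup>2 + (g x)\<^sup>2 / (4 * l))"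
      using that by (intro integral_mono int young) (use fg in auto)
    also have "\<dots> = l * A + B / (4 * l)"
      using f g by (simp add: A_def B_def)
    finally show ?thesis .
  qed
  show "(LINT x|M. \<bar>f x * g x\<bar>) \<le> sqrt (LINT x|M. (f x)\<^sup>2) * sqrt (LINT x|M. (g x)\<^sup>2)"
    unfolding A_def[symmetric] B_def[symmetric]
  proof (rule tendsto_lowerbound)
    show "((\<lambda>e. (sqrt A + e) * (sqrt B + e)) \<longlongrightarrow> sqrt A * sqrt B) (at_right 0)"
      by (auto intro!: tendsto_eq_intros)
    have "(LINT x|M. \<bar>f x * g x\<bar>) \<le> (sqrt A + e) * (sqrt B + e)" if "e > 0" for e
    proof -
      define a where "a = sqrt A + e"
      define b where "b = sqrt B + e"
      have ab: "a > 0" "b > 0" and le: "A \<le> a\<^sup>2" "B \<le> b\<^sup>2"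
        using that AB unfolding a_def b_def by (auto intro: sqrt_le_D add_nonneg_pos)
      have "(LINT x|M. \<bar>f x * g x\<bar>) \<le> b / (2 * a) * A + B / (4 * (b / (2 * a)))"
        using ab by (intro bound) simp
      also have "\<dots> \<le> b / (2 * a) * a\<^sup>2 + b\<^sup>2 / (4 * (b / (2 * a)))"
        using ab le by (intro add_mono mult_left_mono divide_right_mono) auto
      also have "\<dots> = a * b"
        using ab by (simp add: field_simps power2_eq_square)
      finally show ?thesis by (simp add: a_def b_def)
    qed
    then show "\<forall>\<^sub>F e in at_right 0. (LINT x|M. \<bar>f x * g x\<bar>) \<le> (sqrt A + e) * (sqrt B + e)"
      by (intro eventually_at_right_less[THEN eventually_mono]) auto
  qed simp
qed

section \<open>Couplings and the Wasserstein metric\<close>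

definition transport_cost :: "('a::euclidean_space \<times> 'a) measure \<Rightarrow> real" where
  "transport_cost \<pi> = (LINT p|\<pi>. (dist (fst p) (snd p))\<^sup>2)"

lemma transport_cost_nonneg: "transport_cost \<pi> \<ge> 0"
  unfolding transport_cost_def by (auto intro: integral_nonneg_AE)

lemma P2D:
  assumes "\<mu> \<in> P2"
  shows "prob_space \<mu>" "sets \<mu> = sets borel" "integrable \<mu> (\<lambda>\<theta>. (norm \<theta>)\<^sup>2)"
  using assms by (auto simp: P2_def)

lemma couplingsD:
  assumes "\<pi> \<in> couplings \<mu> \<nu>"
  shows "sets \<pi> = sets borel" "distr \<pi> borel fst = \<mu>" "distr \<pi> borel snd = \<nu>"
  using assms by (auto simp: couplings_def)

lemma fst_snd_borel [measurable]:
  "fst \<in> borel_measurable (borel :: ('a::euclidean_space \<times> 'b::euclidean_space) measure)"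
  "snd \<in> borel_measurable (borel :: ('a::euclidean_space \<times> 'b::euclidean_space) measure)"
  by (auto intro!: borel_measurable_continuous_onI continuous_intros)

lemma coupling_measurable:
  assumes "\<pi> \<in> couplings \<mu> \<nu>"
  shows "fst \<in> \<pi> \<rightarrow>\<^sub>M borel" "snd \<in> \<pi> \<rightarrow>\<^sub>M borel"
  unfolding measurable_cong_sets[OF couplingsD(1)[OF assms] refl] by measurable

lemma coupling_prob_space:
  assumes "\<pi> \<in> couplings \<mu> \<nu>" "prob_space \<mu>"
  shows "prob_space \<pi>"
  using assms couplingsD(2)[OF assms(1)] coupling_measurable[OF assms(1)]
  by (metis prob_space_distrD)

lemma coupling_integral:
  fixes f :: "'a::euclidean_space \<Rightarrow> real"
  assumes "\<pi> \<in> couplings \<mu> \<nu>" and [measurable]: "f \<in> borel_measurable borel"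
  shows "(LINT p|\<pi>. f (fst p)) = (LINT x|\<mu>. f x)"
    and "(LINT p|\<pi>. f (snd p)) = (LINT x|\<nu>. f x)"
    and "integrable \<pi> (\<lambda>p. f (fst p)) \<longleftrightarrow> integrable \<mu> f"
    and "integrable \<pi> (\<lambda>p. f (snd p)) \<longleftrightarrow> integrable \<nu> f"
  using integral_distr[OF coupling_measurable(1)[OF assms(1)] assms(2)]
    integral_distr[OF coupling_measurable(2)[OF assms(1)] assms(2)]
    integrable_distr_eq[OF coupling_measurable(1)[OF assms(1)] assms(2)]
    integrable_distr_eq[OF coupling_measurable(2)[OF assms(1)] assms(2)]
  unfolding couplingsD(2,3)[OF assms(1)] by simp_all

lemma coupling_cost_integrable:
  assumes "\<pi> \<in> couplings \<mu> \<nu>" "\<mu> \<in> P2" "\<nu> \<in> P2"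
  shows "integrable \<pi> (\<lambda>p. (dist (fst p) (snd p))\<^sup>2)"
proof (rule L2_norm_triangle(1))
  note [measurable] = coupling_measurable[OF assms(1)]
  show "(\<lambda>p. dist (fst p) (snd p)) \<in> borel_measurable \<pi>" by measurable
  show "integrable \<pi> (\<lambda>p. (norm (fst p))\<^sup>2)" "integrable \<pi> (\<lambda>p. (norm (snd p))\<^sup>2)"
    using coupling_integral(3,4)[OF assms(1), of "\<lambda>x. (norm x)\<^sup>2"] P2D(3) assms(2,3) by auto
  show "AE p in \<pi>. \<bar>dist (fst p) (snd p)\<bar> \<le> norm (fst p) + norm (snd p)"
    by (auto simp: dist_norm norm_triangle_ineq4)
qed

text \<open>
  The product measure is a coupling, so the infimum defining \<open>W2\<close> is over a nonempty set.
\<close>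

lemma couplings_nonempty:
  assumes "\<mu> \<in> P2" "\<nu> \<in> P2"
  shows "couplings \<mu> \<nu> \<noteq> {}"
proof -
  interpret \<mu>: prob_space \<mu> by (rule P2D(1)[OF assms(1)])
  interpret \<nu>: prob_space \<nu> by (rule P2D(1)[OF assms(2)])
  interpret P: pair_prob_space \<mu> \<nu> ..
  note [measurable_cong] = P2D(2)[OF assms(1)] P2D(2)[OF assms(2)]
  have "distr (\<mu> \<Otimes>\<^sub>M \<nu>) borel fst = distr (\<mu> \<Otimes>\<^sub>M \<nu>) \<mu> fst"
    "distr (\<mu> \<Otimes>\<^sub>M \<nu>) borel snd = distr (\<mu> \<Otimes>\<^sub>M \<nu>) \<nu> snd"
    using P2D(2)[OF assms(1)] P2D(2)[OF assms(2)] by (auto intro: distr_cong)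
  moreover have "distr (\<mu> \<Otimes>\<^sub>M \<nu>) \<mu> fst = \<mu>"
    by (simp add: \<nu>.distr_pair_fst \<nu>.emeasure_space_1)
  moreover have "distr (\<mu> \<Otimes>\<^sub>M \<nu>) \<nu> snd = \<nu>"
    by (intro measure_eqI)
      (auto simp: emeasure_distr vimage_snd sets.sets_into_space space_pair_measure
        \<nu>.emeasure_pair_measure_Times Times_Int_Times \<mu>.emeasure_space_1 Int_absorb1)
  moreover have "sets (\<mu> \<Otimes>\<^sub>M \<nu>) = sets borel"
    unfolding borel_prod[symmetric] using P2D(2) assms by (intro sets_pair_measure_cong) auto
  ultimately have "\<mu> \<Otimes>\<^sub>M \<nu> \<in> couplings \<mu> \<nu>"
    by (auto simp: couplings_def)
  then show ?thesis by auto
qed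

lemma W2_eq: "W2 \<mu> \<nu> = sqrt (INF \<pi>\<in>couplings \<mu> \<nu>. transport_cost \<pi>)"
  by (simp add: W2_def transport_cost_def)

lemma bdd_below_transport_cost: "bdd_below (transport_cost ` A)"
  using transport_cost_nonneg by (auto intro!: bdd_belowI)

lemma W2_nonneg:
  assumes "\<mu> \<in> P2" "\<nu> \<in> P2"
  shows "W2 \<mu> \<nu> \<ge> 0"
  unfolding W2_eq using couplings_nonempty[OF assms] transport_cost_nonneg
  by (auto intro!: cINF_greatest)

lemma W2_le_cost:
  assumes "\<pi> \<in> couplings \<mu> \<nu>"
  shows "W2 \<mu> \<nu> \<le> sqrt (transport_cost \<pi>)"
  unfolding W2_eq using assms bdd_below_transport_cost by (auto intro!: cINF_lower)

lemma near_optimal_coupling: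
  assumes "\<mu> \<in> P2" "\<nu> \<in> P2" "W2 \<mu> \<nu> < d"
  obtains \<pi> where "\<pi> \<in> couplings \<mu> \<nu>" "sqrt (transport_cost \<pi>) < d"
proof -
  have d: "d > 0" using W2_nonneg[OF assms(1,2)] assms(3) by simp
  have "(INF \<pi>\<in>couplings \<mu> \<nu>. transport_cost \<pi>) < d\<^sup>2"
    using assms(3) d unfolding W2_eq by (metis not_le real_le_rsqrt)
  then obtain \<pi> where "\<pi> \<in> couplings \<mu> \<nu>" "transport_cost \<pi> < d\<^sup>2"
    using cINF_less_iff[OF couplings_nonempty[OF assms(1,2)] bdd_below_transport_cost] by auto
  then have "sqrt (transport_cost \<pi>) < sqrt (d\<^sup>2)" by (simp del: real_sqrt_abs)
  with \<open>\<pi> \<in> couplings \<mu> \<nu>\<close> d that show ?thesis by simp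
qed

lemma W2_commute: "W2 \<mu> \<nu> = W2 \<nu> \<mu>"
proof -
  have swap: "\<exists>\<pi>'\<in>couplings \<nu> \<mu>. transport_cost \<pi>' = transport_cost \<pi>"
    if \<pi>: "\<pi> \<in> couplings \<mu> \<nu>" for \<mu> \<nu> :: "'a measure" and \<pi>
  proof
    note [measurable_cong] = couplingsD(1)[OF \<pi>]
    have [measurable]: "prod.swap \<in> \<pi> \<rightarrow>\<^sub>M borel"
      unfolding measurable_cong_sets[OF couplingsD(1)[OF \<pi>] refl] 
      by (intro borel_measurable_continuous_onI) (auto simp: prod.swap_def intro!: continuous_intros)
    show "distr \<pi> borel prod.swap \<in> couplings \<nu> \<mu>"
      using couplingsD(2,3)[OF \<pi>] by (auto simp: couplings_def distr_distr comp_def)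
    show "transport_cost (distr \<pi> borel prod.swap) = transport_cost \<pi>"
      unfolding transport_cost_def by (subst integral_distr) (auto simp: dist_commute)
  qed
  have "transport_cost ` couplings \<mu> \<nu> \<subseteq> transport_cost ` couplings \<nu> \<mu>" for \<mu> \<nu> :: "'a measure"
    by (rule image_subsetI) (metis swap imageI)
  then have "transport_cost ` couplings \<mu> \<nu> = transport_cost ` couplings \<nu> \<mu>"
    by (intro equalityI)
  then show ?thesis by (simp add: W2_eq)
qed


text \<open>
  Given \<open>p\<close>, the weight is supported on the event \<open>v = u p\<close>, whose probability is the reciprocal of the
  weight; it can only fail to integrate to \<open>1\<close> on cells of probability \<open>0\<close>, which \<open>p\<close> almost surely avoids.
\<close>

lemma marginal_of_weighted_product:
  fixes u :: "'a \<Rightarrow> nat" and v :: "'b \<Rightarrow> nat"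
  assumes "prob_space A" "prob_space B"
    and [measurable]: "u \<in> A \<rightarrow>\<^sub>M count_space UNIV" "v \<in> B \<rightarrow>\<^sub>M count_space UNIV"
    and same: "distr A (count_space UNIV) u = distr B (count_space UNIV) v"
  shows "AE p in A. (\<integral>\<^sup>+r. (if u p = v r then 1 / emeasure (distr A (count_space UNIV) u) {u p} else 0) \<partial>B) = 1"
proof -
  interpret A: prob_space A by fact
  interpret B: prob_space B by fact
  define m where "m n = emeasure (distr A (count_space UNIV) u) {n}" for n
  have mA: "m n = emeasure A {p\<in>space A. u p = n}" for n
    unfolding m_def by (subst emeasure_distr) (auto intro!: arg_cong[where f="emeasure A"])
  have mB: "m n = emeasure B {r\<in>space B. v r = n}" for n
    unfolding m_def same by (subst emeasure_distr) (auto intro!: arg_cong[where f="emeasure B"])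
  have "AE p in A. m n = 0 \<longrightarrow> u p \<noteq> n" for n
  proof (cases "m n = 0")
    case True
    then show ?thesis by (intro AE_I[of _ _ "{p\<in>space A. u p = n}"]) (auto simp: mA)
  qed simp
  then have "AE p in A. \<forall>n. m n = 0 \<longrightarrow> u p \<noteq> n"
    by (simp add: AE_all_countable)
  then show ?thesis
  proof (rule AE_mp, intro AE_I2 impI)
    fix p assume p: "p \<in> space A" "\<forall>n. m n = 0 \<longrightarrow> u p \<noteq> n"
    have "(\<integral>\<^sup>+r. (if u p = v r then 1 / m (u p) else 0) \<partial>B)
      = (\<integral>\<^sup>+r. 1 / m (u p) * indicator {r\<in>space B. v r = u p} r \<partial>B)"
      by (intro nn_integral_cong) (auto split: split_indicator)
    also have "\<dots> = 1 / m (u p) * m (u p)"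
      by (subst nn_integral_cmult_indicator) (auto simp: mB)
    also have "\<dots> = m (u p) / m (u p)"
      by (simp add: ennreal_divide_times)
    also have "\<dots> = 1"
      using p(2) B.emeasure_finite by (intro ennreal_divide_self) (auto simp: mB less_top[symmetric])
    finally show "(\<integral>\<^sup>+r. (if u p = v r then 1 / emeasure (distr A (count_space UNIV) u) {u p} else 0) \<partial>B) = 1"
      unfolding m_def .
  qed
qed

text \<open>
  Conditionally on the common value of \<open>u\<close> and \<open>v\<close>, the two variables are taken independent. As the value
  ranges over a countable set, this conditional product is an explicit density with respect to \<open>A \<Otimes>\<^sub>M B\<close>
  and no regular conditional distributions enter.
\<close>

lemma glue_along_countable_map:
  fixes u :: "'a \<Rightarrow> nat" and v :: "'b \<Rightarrow> nat"
  assumes "prob_space A" "prob_space B"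
    and [measurable]: "u \<in> A \<rightarrow>\<^sub>M count_space UNIV" "v \<in> B \<rightarrow>\<^sub>M count_space UNIV"
    and same: "distr A (count_space UNIV) u = distr B (count_space UNIV) v"
  obtains C where "sets C = sets (A \<Otimes>\<^sub>M B)" "distr C A fst = A" "distr C B snd = B"
    "AE z in C. u (fst z) = v (snd z)"
proof -
  interpret A: prob_space A by fact
  interpret B: prob_space B by fact
  interpret P: pair_prob_space A B ..
  define m where "m n = emeasure (distr A (count_space UNIV) u) {n}" for n
  \<comment> \<open>Null cells get the weight \<open>1 / 0 = \<infinity>\<close>; both marginals ignore them.\<close>
  define k where "k p r = (if u p = v r then 1 / m (u p) else 0)" for p r
  have weight: "(\<lambda>p. 1 / m (u p)) \<in> borel_measurable A"
    by (rule measurable_compose[OF assms(3)]) simp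
  have [measurable]: "(\<lambda>(p, r). k p r) \<in> borel_measurable (A \<Otimes>\<^sub>M B)"
    unfolding k_def case_prod_beta
  proof (intro measurable_If measurable_compose[OF measurable_fst weight])
    have "{z \<in> space (A \<Otimes>\<^sub>M B). u (fst z) = v (snd z)}
      = {z \<in> space (A \<Otimes>\<^sub>M B). \<exists>n. u (fst z) = n \<and> v (snd z) = n}" by auto
    also have "\<dots> \<in> sets (A \<Otimes>\<^sub>M B)" by measurable
    finally show "{z \<in> space (A \<Otimes>\<^sub>M B). u (fst z) = v (snd z)} \<in> sets (A \<Otimes>\<^sub>M B)" .
  qed simp
  define C where "C = density (A \<Otimes>\<^sub>M B) (\<lambda>(p, r). k p r)"
  have [measurable_cong]: "sets C = sets (A \<Otimes>\<^sub>M B)" by (simp add: C_def)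
  have m1: "AE p in A. (\<integral>\<^sup>+r. k p r \<partial>B) = 1"
    unfolding k_def m_def using marginal_of_weighted_product[OF assms] .
  have m2: "AE r in B. (\<integral>\<^sup>+p. k p r \<partial>A) = 1"
    using marginal_of_weighted_product[OF assms(2,1,4,3) same[symmetric]]
    unfolding same[symmetric] m_def[symmetric]
    by eventually_elim (auto simp: k_def cong: if_cong elim!: trans[rotated] intro!: nn_integral_cong)
  show thesis
  proof (rule that)
    show "distr C A fst = A"
    proof (rule measure_eqI)
      fix S assume "S \<in> sets (distr C A fst)"
      then have S [measurable]: "S \<in> sets A" by simp
      have "emeasure (distr C A fst) S = (\<integral>\<^sup>+z. (case z of (p, r) \<Rightarrow> k p r) * indicator S (fst z) \<partial>(A \<Otimes>\<^sub>M B))"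
        by (subst emeasure_distr, simp, simp, unfold C_def, subst emeasure_density)
          (auto intro!: nn_integral_cong split: split_indicator simp: space_pair_measure)
      also have "\<dots> = (\<integral>\<^sup>+p. \<integral>\<^sup>+r. k p r * indicator S p \<partial>B \<partial>A)"
        by (subst B.nn_integral_fst[symmetric]) auto
      also have "\<dots> = (\<integral>\<^sup>+p. (\<integral>\<^sup>+r. k p r \<partial>B) * indicator S p \<partial>A)"
        by (intro nn_integral_cong nn_integral_multc) measurable
      also have "\<dots> = (\<integral>\<^sup>+p. indicator S p \<partial>A)"
        using m1 by (intro nn_integral_cong_AE) auto
      finally show "emeasure (distr C A fst) S = emeasure A S" by simp
    qed simp
    show "distr C B snd = B"
    proof (rule measure_eqI)
      fix S assume "S \<in> sets (distr C B snd)"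
      then have S [measurable]: "S \<in> sets B" by simp
      have "emeasure (distr C B snd) S = (\<integral>\<^sup>+z. (case z of (p, r) \<Rightarrow> k p r) * indicator S (snd z) \<partial>(A \<Otimes>\<^sub>M B))"
        by (subst emeasure_distr, simp, simp, unfold C_def, subst emeasure_density)
          (auto intro!: nn_integral_cong split: split_indicator simp: space_pair_measure)
      also have "\<dots> = (\<integral>\<^sup>+r. \<integral>\<^sup>+p. k p r * indicator S r \<partial>A \<partial>B)"
        by (subst P.nn_integral_snd[symmetric]) auto
      also have "\<dots> = (\<integral>\<^sup>+r. (\<integral>\<^sup>+p. k p r \<partial>A) * indicator S r \<partial>B)"
        by (intro nn_integral_cong nn_integral_multc) measurable
      also have "\<dots> = (\<integral>\<^sup>+r. indicator S r \<partial>B)"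
        using m2 by (intro nn_integral_cong_AE) auto
      finally show "emeasure (distr C B snd) S = emeasure B S" by simp
    qed simp
    show "AE z in C. u (fst z) = v (snd z)"
      unfolding C_def by (subst AE_density) (auto simp: k_def split: if_splits)
  qed (simp add: C_def)
qed

text \<open>
  Send each point to the first member of a countable dense sequence within distance \<open>e / 2\<close>.
\<close>

lemma countable_quantization:
  assumes e: "e > 0"
  obtains q :: "'a::euclidean_space \<Rightarrow> nat"
  where "q \<in> borel \<rightarrow>\<^sub>M count_space UNIV" "\<And>y y'. q y = q y' \<Longrightarrow> dist y y' < e"
proof -
  obtain D :: "'a set" where D: "countable D" "\<And>X. open X \<Longrightarrow> X \<noteq> {} \<Longrightarrow> \<exists>d\<in>D. d \<in> X"
    using countable_dense_setE by blast
  define d where "d = from_nat_into D"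
  define q where "q y = (LEAST n. dist (d n) y < e / 2)" for y
  have q: "dist (d (q y)) y < e / 2" for y
  proof -
    have "ball y (e / 2) \<noteq> {}" using e by simp
    then obtain z where "z \<in> D" "z \<in> ball y (e / 2)"
      using D(2)[of "ball y (e / 2)"] by auto
    then have "\<exists>n. dist (d n) y < e / 2"
      unfolding d_def using from_nat_into_surj[OF D(1) \<open>z \<in> D\<close>] by (metis dist_commute mem_ball)
    then show ?thesis unfolding q_def by (rule LeastI_ex)
  qed
  show thesis
  proof
    show "q \<in> borel \<rightarrow>\<^sub>M count_space UNIV"
      unfolding q_def by measurable
    fix y y' assume "q y = q y'"
    then show "dist y y' < e"
      using q[of y] q[of y'] dist_triangle_half_r[of "d (q y)" y e y'] by simp
  qed
qed

text \<open>
  Glue the two couplings along the cell of their middle points. The glued middle points \<open>y\<close> and \<open>y'\<close> need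
  not agree, but they are within \<open>e\<close> of each other, so \<open>dist x z \<le> dist x y + (dist y' z + e)\<close> and the triangle
  inequality in \<open>L\<^sup>2\<close> applies.
\<close>

lemma approximate_gluing:
  assumes \<pi>1: "\<pi>1 \<in> couplings \<mu> \<nu>" and \<pi>2: "\<pi>2 \<in> couplings \<nu> \<rho>"
    and P2: "\<mu> \<in> P2" "\<nu> \<in> P2" "\<rho> \<in> P2" and e: "e > 0"
  obtains \<pi> where "\<pi> \<in> couplings \<mu> \<rho>"
    "sqrt (transport_cost \<pi>) \<le> sqrt (transport_cost \<pi>1) + sqrt (transport_cost \<pi>2) + e"
proof -
  obtain q :: "'a \<Rightarrow> nat" where [measurable]: "q \<in> borel \<rightarrow>\<^sub>M count_space UNIV"
    and q: "\<And>y y'. q y = q y' \<Longrightarrow> dist y y' < e"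
    using countable_quantization[OF e] by blast
  note [measurable] = coupling_measurable[OF \<pi>1] coupling_measurable[OF \<pi>2]
  note [measurable_cong] = couplingsD(1)[OF \<pi>1] couplingsD(1)[OF \<pi>2]
  have prob: "prob_space \<pi>1" "prob_space \<pi>2"
    using \<pi>1 \<pi>2 P2 by (auto intro: coupling_prob_space P2D)
  have "distr \<pi>1 (count_space UNIV) (\<lambda>p. q (snd p)) = distr (distr \<pi>1 borel snd) (count_space UNIV) q"
    "distr \<pi>2 (count_space UNIV) (\<lambda>p. q (fst p)) = distr (distr \<pi>2 borel fst) (count_space UNIV) q"
    by (simp_all add: distr_distr comp_def)
  then obtain C where C [measurable_cong]: "sets C = sets (\<pi>1 \<Otimes>\<^sub>M \<pi>2)"
    and marg: "distr C \<pi>1 fst = \<pi>1" "distr C \<pi>2 snd = \<pi>2"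
    and close: "AE z in C. q (snd (fst z)) = q (fst (snd z))"
    using glue_along_countable_map[OF prob, of "\<lambda>p. q (snd p)" "\<lambda>p. q (fst p)"] couplingsD(3)[OF \<pi>1] couplingsD(2)[OF \<pi>2]
    by auto
  interpret C: prob_space C
  proof (rule prob_space_distrD)
    show "fst \<in> C \<rightarrow>\<^sub>M \<pi>1" by measurable
    show "prob_space (distr C \<pi>1 fst)" unfolding marg by (rule prob)
  qed
  define \<pi> where "\<pi> = distr C borel (\<lambda>z. (fst (fst z), snd (snd z)))"
  have pair [measurable]: "(\<lambda>z. (fst (fst z), snd (snd z))) \<in> C \<rightarrow>\<^sub>M borel"
    unfolding borel_prod[symmetric] by measurable
  have "distr \<pi> borel fst = distr (distr C \<pi>1 fst) borel fst"
    "distr \<pi> borel snd = distr (distr C \<pi>2 snd) borel snd"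
    unfolding \<pi>_def by (simp_all add: distr_distr comp_def)
  then have \<pi>: "\<pi> \<in> couplings \<mu> \<rho>"
    using couplingsD(2)[OF \<pi>1] couplingsD(3)[OF \<pi>2] marg by (simp add: couplings_def \<pi>_def)
  have f1: "integrable C (\<lambda>z. (dist (fst (fst z)) (snd (fst z)))\<^sup>2)"
    "(LINT z|C. (dist (fst (fst z)) (snd (fst z)))\<^sup>2) = transport_cost \<pi>1"
    using coupling_cost_integrable[OF \<pi>1 P2(1,2)]
      integrable_distr_eq[of fst C \<pi>1 "\<lambda>p. (dist (fst p) (snd p))\<^sup>2"]
      integral_distr[of fst C \<pi>1 "\<lambda>p. (dist (fst p) (snd p))\<^sup>2"]
    unfolding marg transport_cost_def by auto
  have f2: "integrable C (\<lambda>z. (dist (fst (snd z)) (snd (snd z)))\<^sup>2)"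
    "(LINT z|C. (dist (fst (snd z)) (snd (snd z)))\<^sup>2) = transport_cost \<pi>2"
    using coupling_cost_integrable[OF \<pi>2 P2(2,3)]
      integrable_distr_eq[of snd C \<pi>2 "\<lambda>p. (dist (fst p) (snd p))\<^sup>2"]
      integral_distr[of snd C \<pi>2 "\<lambda>p. (dist (fst p) (snd p))\<^sup>2"]
    unfolding marg transport_cost_def by auto
  have g: "integrable C (\<lambda>z. (dist (fst (snd z)) (snd (snd z)) + e)\<^sup>2)"
    "sqrt (LINT z|C. (dist (fst (snd z)) (snd (snd z)) + e)\<^sup>2) \<le> sqrt (transport_cost \<pi>2) + sqrt (LINT z|C. e\<^sup>2)"
    using L2_norm_triangle[OF _ f2(1), of "\<lambda>z. dist (fst (snd z)) (snd (snd z)) + e" "\<lambda>_. e"] e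
    by (auto simp: f2(2) C.prob_space)
  have "sqrt (transport_cost \<pi>) = sqrt (LINT z|C. (dist (fst (fst z)) (snd (snd z)))\<^sup>2)"
    unfolding transport_cost_def \<pi>_def by (subst integral_distr) auto
  also have "\<dots> \<le> sqrt (transport_cost \<pi>1) + sqrt (LINT z|C. (dist (fst (snd z)) (snd (snd z)) + e)\<^sup>2)"
    unfolding f1(2)[symmetric]
  proof (rule L2_norm_triangle(2)[OF _ f1(1) g(1)])
    show "AE z in C. \<bar>dist (fst (fst z)) (snd (snd z))\<bar>
      \<le> dist (fst (fst z)) (snd (fst z)) + (dist (fst (snd z)) (snd (snd z)) + e)"
      using close
    proof eventually_elim
      case (elim z)
      then show ?case
        using dist_triangle[of "fst (fst z)" "snd (snd z)" "snd (fst z)"]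
          dist_triangle[of "snd (fst z)" "snd (snd z)" "fst (snd z)"] q[OF elim] by simp
    qed
  qed measurable
  also have "\<dots> \<le> sqrt (transport_cost \<pi>1) + sqrt (transport_cost \<pi>2) + e"
    using g(2) e by (simp add: C.prob_space)
  finally show thesis using that \<pi> by blast
qed

lemma W2_triangle:
  assumes P2: "\<mu> \<in> P2" "\<nu> \<in> P2" "\<rho> \<in> P2"
  shows "W2 \<mu> \<rho> \<le> W2 \<mu> \<nu> + W2 \<nu> \<rho>"
proof (rule field_le_epsilon)
  fix e :: real assume e: "e > 0"
  obtain \<pi>1 where 1: "\<pi>1 \<in> couplings \<mu> \<nu>" "sqrt (transport_cost \<pi>1) < W2 \<mu> \<nu> + e / 3"
    using near_optimal_coupling[OF P2(1,2), of "W2 \<mu> \<nu> + e / 3"] e by auto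
  obtain \<pi>2 where 2: "\<pi>2 \<in> couplings \<nu> \<rho>" "sqrt (transport_cost \<pi>2) < W2 \<nu> \<rho> + e / 3"
    using near_optimal_coupling[OF P2(2,3), of "W2 \<nu> \<rho> + e / 3"] e by auto
  obtain \<pi> where "\<pi> \<in> couplings \<mu> \<rho>"
    "sqrt (transport_cost \<pi>) \<le> sqrt (transport_cost \<pi>1) + sqrt (transport_cost \<pi>2) + e / 3"
    using approximate_gluing[OF 1(1) 2(1) P2, of "e / 3"] e by auto
  with 1(2) 2(2) W2_le_cost[of \<pi> \<mu> \<rho>] show "W2 \<mu> \<rho> \<le> W2 \<mu> \<nu> + W2 \<nu> \<rho> + e"
    by simp
qed

section \<open>Absolutely continuous functions on the line\<close>

text \<open>
  Integrating from \<open>-\<infinity>\<close> gives one function on the whole line whose increments are the integrals over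
  intervals, without a case distinction on the order of the end points.
\<close>

definition primitive :: "(real \<Rightarrow> real) \<Rightarrow> real \<Rightarrow> real" where
  "primitive h t = (LINT u:{..t}|lborel. h u)"

lemma integrable_set_borel:
  fixes h :: "real \<Rightarrow> real"
  assumes "integrable lborel h" "S \<in> sets borel"
  shows "set_integrable lborel S h"
  using assms unfolding set_integrable_def by (intro integrable_mult_indicator) auto

lemma primitive_diff:
  assumes h: "integrable lborel h" and "s \<le> t"
  shows "primitive h t - primitive h s = (LINT u:{s..t}|lborel. h u)"
proof -
  have "primitive h t = (LINT u:{..s} \<union> {s<..t}|lborel. h u)"
    using assms(2) by (simp add: primitive_def ivl_disj_un_one)
  also have "\<dots> = primitive h s + (LINT u:{s<..t}|lborel. h u)"
    unfolding primitive_def by (intro set_integral_Un integrable_set_borel h) auto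
  also have "(LINT u:{s<..t}|lborel. h u) = (LINT u:{s..t}|lborel. h u)"
    by (intro set_integral_cong_set)
      (use h borel_measurable_integrable[OF h] in \<open>auto simp: set_borel_measurable_def intro!: AE_I'[of "{s}"]\<close>)
  finally show ?thesis by simp
qed

lemma set_integral_reflect:
  fixes h :: "real \<Rightarrow> real"
  shows "(LINT u:{a..b}|lborel. h (- u)) = (LINT u:{-b..-a}|lborel. h u)"
proof -
  have "(LINT u:{a..b}|lborel. h (- u)) = (LINT u|lborel. indicator {-b..-a} (0 + (-1) * u) * h (0 + (-1) * u))"
    unfolding set_lebesgue_integral_def
    by (intro Bochner_Integration.integral_cong) (auto split: split_indicator)
  also have "\<dots> = (LINT u:{-b..-a}|lborel. h u)"
    using lborel_integral_real_affine[of "-1" "\<lambda>u. indicator {-b..-a} u * h u" 0]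
    by (simp add: set_lebesgue_integral_def)
  finally show ?thesis .
qed

lemma AE_right_difference_quotient:
  fixes h :: "real \<Rightarrow> real"
  assumes h: "integrable lborel h"
  shows "AE t in lborel. ((\<lambda>d. (LINT u:{t..t+d}|lborel. h u) / d) \<longlongrightarrow> h t) (at_right 0)"
proof -
  have "h integrable_on cbox a b" for a b
    using set_borel_integral_eq_integral(1)[OF integrable_set_borel[OF h]] by auto
  then obtain N where N: "negligible N"
    and lim: "\<And>x e. x \<notin> N \<Longrightarrow> 0 < e \<Longrightarrow> \<exists>d>0. \<forall>k. 0 < k \<and> k < d \<longrightarrow>
      norm (integral (cbox x (x + k *\<^sub>R One)) h /\<^sub>R k ^ DIM(real) - h x) < e"
    using integrable_ccontinuous_explicit[of h] by blast
  have "AE t in lebesgue. t \<notin> N"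
    using N by (simp add: negligible_iff_null_sets AE_not_in)
  then have "AE t in lborel. t \<notin> N"
    by (simp add: AE_completion_iff)
  then show ?thesis
  proof eventually_elim
    case (elim t)
    show ?case
    proof (rule tendstoI)
      fix e :: real assume "e > 0"
      then obtain d where d: "d > 0"
        and *: "\<And>k. 0 < k \<and> k < d \<longrightarrow> norm (integral {t..t + k} h / k - h t) < e"
        using lim[OF elim] by (auto simp: divide_inverse ac_simps)
      have "dist ((LINT u:{t..t+k}|lborel. h u) / k) (h t) < e" if "0 < k" "k < d" for k
        using *[of k] that set_borel_integral_eq_integral(2)[OF integrable_set_borel[OF h], of "{t..t+k}"]
        by (simp add: dist_real_def)
      with d show "\<forall>\<^sub>F k in at_right 0. dist ((LINT u:{t..t+k}|lborel. h u) / k) (h t) < e"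
        by (auto simp: eventually_at_right_field)
    qed
  qed
qed

lemma AE_lborel_affine:
  fixes a k :: real
  assumes "AE t in lborel. P t" "k \<noteq> 0"
  shows "AE t in lborel. P (a + k * t)"
proof (rule AE_distrD[where M'=borel and f="\<lambda>t. a + k * t"])
  have "AE t in density (distr lborel borel (\<lambda>t. a + k * t)) (\<lambda>_. ennreal \<bar>k\<bar>). P t"
    using assms(1) lborel_real_affine[OF assms(2), of a] by metis
  then show "AE t in distr lborel borel (\<lambda>t. a + k * t). P t"
    using assms(2) by (subst (asm) AE_density) auto
qed simp

text \<open>
  Lebesgue's differentiation theorem on the line: the limit from the left is the limit from the right for the
  reflected integrand \<open>h \<circ> uminus\<close>.
\<close>

lemma AE_primitive_has_derivative:
  assumes h: "integrable lborel h"
  shows "AE t in lborel. (primitive h has_real_derivative h t) (at t)"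
proof -
  have h': "integrable lborel (\<lambda>u. h (- u))"
    using lborel_integrable_real_affine[OF h, of "-1" 0] by simp
  have "AE t in lborel. ((\<lambda>d. (LINT u:{t..t+d}|lborel. h (- u)) / d) \<longlongrightarrow> h (- t)) (at_right 0)"
    by (rule AE_right_difference_quotient[OF h'])
  from AE_lborel_affine[OF this, of "-1" 0]
  have "AE t in lborel. ((\<lambda>d. (LINT u:{- t..- t+d}|lborel. h (- u)) / d) \<longlongrightarrow> h t) (at_right 0)"
    by simp
  with AE_right_difference_quotient[OF h] show ?thesis
  proof eventually_elim
    case (elim t)
    have "((\<lambda>s. (primitive h s - primitive h t) / (s - t)) \<longlongrightarrow> h t) (at_right t)"
      unfolding filterlim_at_right_to_0[of _ _ t]
      by (rule Lim_transform_eventually[OF elim(1)])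
        (auto simp: eventually_at_right_field primitive_diff[OF h, symmetric] add.commute intro!: exI[of _ 1])
    moreover have "((\<lambda>s. (primitive h s - primitive h t) / (s - t)) \<longlongrightarrow> h t) (at_left t)"
      unfolding at_left_minus[of t] filterlim_filtermap filterlim_at_right_to_0[of _ _ "- t"]
    proof (rule Lim_transform_eventually)
      show "((\<lambda>d. (LINT u:{- t..- t+d}|lborel. h (- u)) / d) \<longlongrightarrow> h t) (at_right 0)"
        by (rule elim(2))
      have "(LINT u:{- t..- t+d}|lborel. h (- u)) / d
          = (primitive h (- (d + - t)) - primitive h t) / (- (d + - t) - t)" if "d > 0" for d
      proof -
        have "(LINT u:{- t..- t+d}|lborel. h (- u)) = primitive h t - primitive h (t - d)"
          using primitive_diff[OF h, of "t - d" t] that by (simp add: set_integral_reflect)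
        moreover have "- (d + - t) = t - d" "t - d - t = - d" by simp_all
        ultimately show ?thesis
          by (metis minus_diff_eq minus_divide_divide)
      qed
      then show "\<forall>\<^sub>F d in at_right 0. (LINT u:{- t..- t+d}|lborel. h (- u)) / d
          = (primitive h (- (d + - t)) - primitive h t) / (- (d + - t) - t)"
        by (auto simp: eventually_at_right_field intro!: exI[of _ 1])
    qed
    ultimately show ?case
      unfolding has_field_derivative_iff by (simp add: filterlim_split_at)
  qed
qed

lemma continuous_primitive:
  assumes h: "integrable lborel h"
  shows "continuous_on UNIV (primitive h)"
proof (rule continuous_at_imp_continuous_on, safe)
  fix t :: real
  have h': "h integrable_on {t - 1..t + 1}"
    using set_borel_integral_eq_integral(1)[OF integrable_set_borel[OF h]] by auto
  have "continuous_on {t - 1..t + 1} (\<lambda>s. primitive h (t - 1) + integral {t - 1..s} h)"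
    by (intro continuous_intros indefinite_integral_continuous_1 h')
  moreover have "primitive h (t - 1) + integral {t - 1..s} h = primitive h s" if "s \<in> {t - 1..t + 1}" for s
    using primitive_diff[OF h, of "t - 1" s] that
      set_borel_integral_eq_integral(2)[OF integrable_set_borel[OF h], of "{t - 1..s}"] by simp
  ultimately have "continuous_on {t - 1..t + 1} (primitive h)"
    by (rule continuous_on_eq)
  then have "continuous_on {t - 1<..<t + 1} (primitive h)"
    by (rule continuous_on_subset) auto
  then show "isCont (primitive h) t"
    by (subst (asm) continuous_on_eq_continuous_at) auto
qed

text \<open>
  The functions \<open>F = \<integral>m + f\<close> and \<open>H = \<integral>m - f\<close> are both nondecreasing and continuous, so they induce
  Lebesgue-Stieltjes measures, and these add up to the measure with density \<open>2 m\<close>. Hence the measure of \<open>F\<close> is absolutely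
  continuous, and by Radon-Nikodym it has a density \<open>r\<close>; the function sought is \<open>r - m\<close>.
\<close>

lemma dominated_increments_density:
  fixes f m :: "real \<Rightarrow> real"
  assumes m: "integrable lborel m" "\<And>t. m t \<ge> 0"
    and f: "\<And>s t. s \<le> t \<Longrightarrow> \<bar>f t - f s\<bar> \<le> (LINT u:{s..t}|lborel. m u)"
  obtains h where "integrable lborel h" "\<And>s t. s \<le> t \<Longrightarrow> f t - f s = (LINT u:{s..t}|lborel. h u)"
proof -
  have [measurable]: "m \<in> borel_measurable borel" using m(1) by auto
  define F where "F t = primitive m t + f t" for t
  define H where "H t = primitive m t - f t" for t
  define D where "D = density lborel (\<lambda>t. ennreal (2 * m t))"
  have incr: "\<bar>f t - f s\<bar> \<le> primitive m t - primitive m s" if "s \<le> t" for s t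
    using f[OF that] primitive_diff[OF m(1) that] by simp
  have mono: "F s \<le> F t" "H s \<le> H t" if "s \<le> t" for s t
    using incr[OF that] by (auto simp: F_def H_def)
  have cont_m: "isCont (primitive m) t" for t
    using continuous_primitive[OF m(1)] by (simp add: continuous_on_eq_continuous_at)
  have "isCont f t" for t
    unfolding isCont_def
  proof (rule LIM_zero_cancel, rule Lim_null_comparison)
    show "((\<lambda>s. \<bar>primitive m s - primitive m t\<bar>) \<longlongrightarrow> 0) (at t)"
      using cont_m[of t] by (intro tendsto_rabs_zero LIM_zero) (simp add: isCont_def)
    have "norm (f s - f t) \<le> \<bar>primitive m s - primitive m t\<bar>" for s
      using incr[of s t] incr[of t s] by (cases "s \<le> t") auto
    then show "\<forall>\<^sub>F s in at t. norm (f s - f t) \<le> \<bar>primitive m s - primitive m t\<bar>"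
      by (intro always_eventually allI)
  qed
  then have cont: "continuous (at_right t) F" "continuous (at_right t) H" for t
    using isCont_add[OF cont_m] isCont_diff[OF cont_m]
    unfolding F_def H_def by (auto intro: continuous_at_imp_continuous_at_within)
  define N where "N = interval_measure F"
  define N' where "N' = interval_measure H"
  have N: "emeasure N {a<..b} = ennreal (F b - F a)" "emeasure N' {a<..b} = ennreal (H b - H a)"
    if "a \<le> b" for a b
    unfolding N_def N'_def using that mono cont by (auto intro!: emeasure_interval_measure_Ioc)
  have sets [measurable_cong]: "sets N = sets borel" "sets N' = sets borel"
    by (auto simp: N_def N'_def)
  \<comment> \<open>The sum of the two Stieltjes measures, to be identified with \<open>D\<close> on half-open intervals.\<close>
  define S where "S = measure_of UNIV (sets borel) (\<lambda>A. emeasure N A + emeasure N' A)"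
  have sets_S: "sets S = sets borel"
    unfolding S_def by (metis sets.sigma_sets_eq sets_measure_of space_borel subset_UNIV sets.space_closed Pow_UNIV)
  have S: "emeasure S A = emeasure N A + emeasure N' A" if "A \<in> sets borel" for A
  proof (rule emeasure_measure_of[OF S_def])
    show "countably_additive (sets S) (\<lambda>A. emeasure N A + emeasure N' A)"
    proof (rule countably_additiveI)
      fix A :: "nat \<Rightarrow> real set"
      assume "range A \<subseteq> sets S" "disjoint_family A"
      then show "(\<Sum>i. emeasure N (A i) + emeasure N' (A i)) = emeasure N (\<Union>i. A i) + emeasure N' (\<Union>i. A i)"
        by (subst suminf_add[symmetric]) (auto simp: suminf_emeasure sets_S sets)
    qed
  qed (use that in \<open>auto simp: positive_def sets_S\<close>)
  have D: "emeasure D {a<..b} = ennreal (2 * (primitive m b - primitive m a))" if "a \<le> b" for a b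
  proof -
    have "set_integrable lborel {a<..b} m" by (rule integrable_set_borel[OF m(1)]) simp
    then have "integrable lborel (\<lambda>u. 2 * (indicator {a<..b} u * m u))"
      by (simp add: set_integrable_def)
    then have "(\<integral>\<^sup>+u. ennreal (2 * (indicator {a<..b} u * m u)) \<partial>lborel)
       = ennreal (LINT u|lborel. 2 * (indicator {a<..b} u * m u))"
      using m(2) by (intro nn_integral_eq_integral) auto
    moreover have "(LINT u|lborel. indicator {a<..b} u * m u) = (LINT u:{a..b}|lborel. m u)"
      unfolding set_lebesgue_integral_def
      by (intro integral_cong_AE) (auto intro!: AE_I'[of "{a}"] split: split_indicator)
    moreover have "emeasure D {a<..b} = (\<integral>\<^sup>+u. ennreal (2 * (indicator {a<..b} u * m u)) \<partial>lborel)"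
      unfolding D_def by (subst emeasure_density) (auto intro!: nn_integral_cong split: split_indicator)
    ultimately show ?thesis using primitive_diff[OF m(1) that] by simp
  qed
  have SD: "S = D"
  proof (rule measure_eqI_generator_eq[where \<Omega>=UNIV])
    fix X assume "X \<in> range (\<lambda>(a, b). {a<..b::real})"
    then obtain a b where X: "X = {a<..b}" by auto
    show "emeasure S X = emeasure D X"
    proof (cases "a \<le> b")
      case True
      then show ?thesis
        using mono[OF True] by (simp add: X S N D ennreal_plus[symmetric] F_def H_def del: ennreal_plus)
          
    qed (simp add: X)
  next
    show "(\<Union>i. {- real (i::nat)<..real i}) = UNIV"
      by (rule UN_Ioc_eq_UNIV)
  next
    fix i :: nat
    show "emeasure S {- real i<..real i} \<noteq> \<infinity>"
      by (simp add: S N)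
  qed (auto simp: sets_S D_def borel_sigma_sets_Ioc Int_stable_def)
  have le: "emeasure N A \<le> emeasure D A" if "A \<in> sets borel" for A
    using S[OF that] unfolding SD by simp
  have "absolutely_continuous lborel N"
    unfolding absolutely_continuous_def
  proof safe
    fix A :: "real set" assume A: "A \<in> null_sets lborel"
    then have "A \<in> null_sets D"
      using absolutely_continuousI_density[of "\<lambda>t. ennreal (2 * m t)" lborel]
      by (auto simp: absolutely_continuous_def D_def)
    then show "A \<in> null_sets N"
      using le[of A] A by (auto simp: null_sets_def sets)
  qed
  then obtain g where g [measurable]: "g \<in> borel_measurable lborel" and dens: "density lborel g = N"
    using sigma_finite_measure.Radon_Nikodym[OF sigma_finite_lborel, of N] sets by auto
  have "(\<integral>\<^sup>+u. g u \<partial>lborel) = emeasure N UNIV"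
    unfolding dens[symmetric] by (subst emeasure_density) auto
  also have "\<dots> \<le> emeasure D UNIV" by (rule le) simp
  also have "\<dots> = (\<integral>\<^sup>+u. ennreal (2 * m u) \<partial>lborel)"
    unfolding D_def by (subst emeasure_density) auto
  also have "\<dots> = ennreal (LINT u|lborel. 2 * m u)"
    using m by (intro nn_integral_eq_integral) auto
  finally have fin: "(\<integral>\<^sup>+u. g u \<partial>lborel) < \<infinity>"
    by (metis ennreal_less_top le_less_trans infinity_ennreal_def)
  then have g_fin: "AE u in lborel. g u < \<infinity>"
    using nn_integral_PInf_AE[OF g] by (auto simp: less_top elim!: eventually_mono)
  define r where "r u = enn2real (g u)" for u
  have [measurable]: "r \<in> borel_measurable lborel" unfolding r_def by measurable
  have r: "AE u in lborel. ennreal (r u) = g u"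
    using g_fin by eventually_elim (simp add: r_def ennreal_enn2real)
  have r_int: "integrable lborel r"
  proof (rule integrableI_nonneg)
    show "(\<integral>\<^sup>+u. ennreal (r u) \<partial>lborel) < \<infinity>"
      using fin nn_integral_cong_AE[OF r] by simp
  qed (auto simp: r_def)
  have r_F: "F t - F s = primitive r t - primitive r s" if "s \<le> t" for s t
  proof -
    have ri: "integrable lborel (\<lambda>u. indicator {s<..t} u * r u)"
      using integrable_set_borel[OF r_int, of "{s<..t}"] by (simp add: set_integrable_def)
    have "ennreal (F t - F s) = emeasure N {s<..t}" using N that by simp
    also have "\<dots> = (\<integral>\<^sup>+u. g u * indicator {s<..t} u \<partial>lborel)"
      unfolding dens[symmetric] by (subst emeasure_density) auto
    also have "\<dots> = (\<integral>\<^sup>+u. ennreal (indicator {s<..t} u * r u) \<partial>lborel)"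
      using r by (intro nn_integral_cong_AE) (auto split: split_indicator)
    also have "\<dots> = ennreal (LINT u|lborel. indicator {s<..t} u * r u)"
      using ri by (intro nn_integral_eq_integral) (auto simp: r_def)
    also have "(LINT u|lborel. indicator {s<..t} u * r u) = (LINT u:{s..t}|lborel. r u)"
      unfolding set_lebesgue_integral_def
      by (intro integral_cong_AE) (auto intro!: AE_I'[of "{s}"] split: split_indicator)
    finally show ?thesis
      unfolding primitive_diff[OF r_int that] using mono[OF that]
      by (subst (asm) ennreal_inj) (auto simp: r_def set_lebesgue_integral_def intro!: integral_nonneg_AE)
  qed
  show thesis
  proof (rule that)
    show rm: "integrable lborel (\<lambda>u. r u - m u)" using r_int m(1) by auto
    fix s t :: real assume "s \<le> t"
    then have "f t - f s = (LINT u:{s..t}|lborel. r u) - (LINT u:{s..t}|lborel. m u)"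
      using r_F[of s t] primitive_diff[OF r_int, of s t] primitive_diff[OF m(1), of s t] by (simp add: F_def)
    also have "\<dots> = (LINT u:{s..t}|lborel. r u - m u)"
      by (intro set_integral_diff(2)[symmetric] integrable_set_borel r_int m) auto
    finally show "f t - f s = (LINT u:{s..t}|lborel. r u - m u)" .
  qed
qed

text \<open>
  Combine the density with Lebesgue differentiation. The bound \<open>\<bar>h\<bar> \<le> m\<close> follows by
  differentiating the hypothesis on increments.
\<close>

lemma dominated_increments_derivative:
  fixes f m :: "real \<Rightarrow> real"
  assumes m: "integrable lborel m" "\<And>t. m t \<ge> 0"
    and f: "\<And>s t. s \<le> t \<Longrightarrow> \<bar>f t - f s\<bar> \<le> (LINT u:{s..t}|lborel. m u)"
  obtains h where "integrable lborel h" "\<And>s t. s \<le> t \<Longrightarrow> f t - f s = (LINT u:{s..t}|lborel. h u)"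
    "AE t in lborel. (f has_real_derivative h t) (at t)" "AE t in lborel. \<bar>h t\<bar> \<le> m t"
proof -
  obtain h where h: "integrable lborel h" "\<And>s t. s \<le> t \<Longrightarrow> f t - f s = (LINT u:{s..t}|lborel. h u)"
    using dominated_increments_density[OF assms] by blast
  have f_eq: "f = (\<lambda>t. f 0 - primitive h 0 + primitive h t)"
  proof
    fix t show "f t = f 0 - primitive h 0 + primitive h t"
      using h(2)[of 0 t] h(2)[of t 0] primitive_diff[OF h(1), of 0 t] primitive_diff[OF h(1), of t 0]
      by (cases "0 \<le> t") auto
  qed
  have der: "AE t in lborel. (f has_real_derivative h t) (at t)"
    using AE_primitive_has_derivative[OF h(1)]
    by eventually_elim (subst f_eq, auto intro!: derivative_eq_intros)
  moreover have "AE t in lborel. \<bar>h t\<bar> \<le> m t"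
    using der AE_primitive_has_derivative[OF m(1)]
  proof eventually_elim
    case (elim t)
    have "((\<lambda>s. \<bar>(f s - f t) / (s - t)\<bar>) \<longlongrightarrow> \<bar>h t\<bar>) (at t)"
      using elim(1) by (intro tendsto_rabs) (simp add: has_field_derivative_iff)
    moreover have "((\<lambda>s. (primitive m s - primitive m t) / (s - t)) \<longlongrightarrow> m t) (at t)"
      using elim(2) by (simp add: has_field_derivative_iff)
    moreover have "\<bar>(f s - f t) / (s - t)\<bar> \<le> (primitive m s - primitive m t) / (s - t)" if "s \<noteq> t" for s
    proof (cases "t < s")
      case True
      then show ?thesis using f[of t s] primitive_diff[OF m(1), of t s]
        by (simp add: abs_divide divide_right_mono)
    next
      case False
      then have "\<bar>f t - f s\<bar> / (t - s) \<le> (primitive m t - primitive m s) / (t - s)"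
        using f[of s t] primitive_diff[OF m(1), of s t] by (intro divide_right_mono) auto
      then show ?thesis using False that
        by (metis abs_divide abs_minus_commute abs_of_pos diff_gt_0_iff_gt linorder_neqE_linordered_idom minus_diff_eq minus_divide_divide)
    qed
    ultimately show ?case
      by (intro tendsto_le[of "at t"]) (auto simp: eventually_at_filter)
  qed
  ultimately show thesis using that h by blast
qed

section \<open>Metric derivatives\<close>

lemma has_metric_derivative_unique:
  "has_metric_derivative c v t \<Longrightarrow> metric_derivative c t = v"
  unfolding metric_derivative_def has_metric_derivative_def
  by (rule the_equality) (auto dest: tendsto_unique[OF trivial_limit_at])

lemma has_metric_derivative_cong:
  assumes "open S" "t \<in> S" "\<And>s. s \<in> S \<Longrightarrow> c s = c' s"
  shows "has_metric_derivative c v t \<longleftrightarrow> has_metric_derivative c' v t"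
  unfolding has_metric_derivative_def
  by (rule filterlim_cong[OF refl refl])
    (use assms in \<open>auto simp: eventually_at_topological intro!: exI[of _ S]\<close>)

text \<open>
  Curves are considered on the whole line, where a globally integrable \<open>m\<close> dominates the increments, so that the
  results on real functions apply as they stand. A curve on an interval is brought into this form by
  freezing it beyond its end points.
\<close>

locale dominated_curve =
  fixes c :: "real \<Rightarrow> 'a::euclidean_space measure" and m :: "real \<Rightarrow> real"
  assumes m: "integrable lborel m" "\<And>t. m t \<ge> 0"
    and P2: "\<And>t. c t \<in> P2"
    and W2_le: "\<And>s t. s \<le> t \<Longrightarrow> W2 (c s) (c t) \<le> (LINT u:{s..t}|lborel. m u)"
begin

lemma W2_le_primitive: "W2 (c s) (c t) \<le> \<bar>primitive m t - primitive m s\<bar>"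
proof (cases "s \<le> t")
  case True
  then show ?thesis using W2_le[of s t] primitive_diff[OF m(1), of s t] by simp
next
  case False
  then show ?thesis using W2_le[of t s] primitive_diff[OF m(1), of t s] W2_commute[of "c s" "c t"] by simp
qed

lemma W2_le_total: "W2 (c s) (c t) \<le> (LINT u|lborel. m u)"
proof -
  have *: "(LINT u:{a..b}|lborel. m u) \<le> (LINT u|lborel. m u)" for a b
    unfolding set_lebesgue_integral_def
    using m integrable_set_borel[OF m(1), of "{a..b}"]
    by (intro integral_mono) (auto simp: set_integrable_def split: split_indicator)
  show ?thesis
    using W2_le[of s t] W2_le[of t s] W2_commute[of "c s" "c t"] *[of s t] *[of t s]
    by (cases "s \<le> t") auto
qed

lemma W2_reverse_triangle: "\<bar>W2 (c r) (c t) - W2 (c r) (c s)\<bar> \<le> W2 (c s) (c t)"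
  using W2_triangle[OF P2 P2 P2, of r t s] W2_triangle[OF P2 P2 P2, of r s t] W2_commute[of "c s" "c t"]
  by simp

text \<open>
  The functions \<open>t \<mapsto> W2 (c r) (c t)\<close> with rational \<open>r\<close> have increments at most \<open>W2 (c s) (c t)\<close>, hence have
  almost-everywhere derivatives \<open>h r\<close>; put \<open>H = sup \<bar>h r\<bar>\<close>. Each difference quotient of the curve
  dominates those of these functions, so its lower limit is at least \<open>H\<close>. Letting \<open>r\<close> tend to \<open>s\<close> recovers the
  distance, whence \<open>W2 (c s) (c t) \<le> \<integral> H\<close>, and Lebesgue differentiation bounds the upper limit by \<open>H\<close>.
\<close>

lemma metric_derivative_exists:
  "AE t in lborel. has_metric_derivative c (metric_derivative c t) t \<and>
     0 \<le> metric_derivative c t \<and> metric_derivative c t \<le> m t"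
proof -
  define d where "d r t = W2 (c (of_rat r)) (c t)" for r t
  define Q where "Q r h \<longleftrightarrow> integrable lborel h \<and>
    (\<forall>s t. s \<le> t \<longrightarrow> d r t - d r s = (LINT u:{s..t}|lborel. h u)) \<and>
    (AE t in lborel. (d r has_real_derivative h t) (at t)) \<and> (AE t in lborel. \<bar>h t\<bar> \<le> m t)" for r h
  have "\<exists>h. Q r h" for r
  proof -
    show ?thesis
      unfolding Q_def
    proof (rule dominated_increments_derivative[of m "d r"])
      show "\<bar>d r t - d r s\<bar> \<le> (LINT u:{s..t}|lborel. m u)" if "s \<le> t" for s t
        unfolding d_def using W2_reverse_triangle[of "of_rat r" t s] W2_le[OF that] by simp
    qed (use m in auto)
  qed
  then obtain h where hQ: "\<And>r. Q r (h r)" by metis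
  then have h: "\<And>r. integrable lborel (h r)"
    and h_diff: "\<And>r s t. s \<le> t \<Longrightarrow> d r t - d r s = (LINT u:{s..t}|lborel. h r u)"
    and h_der: "\<And>r. AE t in lborel. (d r has_real_derivative h r t) (at t)"
    and h_m: "\<And>r. AE t in lborel. \<bar>h r t\<bar> \<le> m t"
    unfolding Q_def by simp_all
  have [measurable]: "h r \<in> borel_measurable borel" for r using h[of r] by auto
  have h_m: "AE t in lborel. \<forall>r. \<bar>h r t\<bar> \<le> m t"
    using h_m by (simp add: AE_all_countable)
  \<comment> \<open>The supremum is taken in \<open>ennreal\<close>, where it is measurable even at the points where it is infinite.\<close>
  define H' where "H' t = (SUP r. ennreal \<bar>h r t\<bar>)" for t
  define H where "H t = enn2real (H' t)" for t
  have [measurable]: "H \<in> borel_measurable borel"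
    unfolding H_def H'_def by measurable
  have H_nonneg: "H t \<ge> 0" for t by (simp add: H_def)
  have H': "AE t in lborel. H' t = ennreal (H t) \<and> H t \<le> m t"
    using h_m
  proof eventually_elim
    case (elim t)
    then have le: "H' t \<le> ennreal (m t)"
      unfolding H'_def by (auto intro!: SUP_least ennreal_leI)
    then have "H' t < top" by (rule le_less_trans) simp
    then have "H' t = ennreal (H t)" by (simp add: H_def ennreal_enn2real)
    with le m(2)[of t] show ?case by simp
  qed
  have h_H: "AE t in lborel. \<forall>r. \<bar>h r t\<bar> \<le> H t"
    using H'
  proof eventually_elim
    case (elim t)
    have "ennreal \<bar>h r t\<bar> \<le> ennreal (H t)" for r
      using elim unfolding H'_def by (metis SUP_upper UNIV_I)
    then show ?case using H_nonneg by simp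
  qed
  have H_int: "integrable lborel H"
    by (rule Bochner_Integration.integrable_bound[OF m(1)])
      (use H' H_nonneg m(2) in \<open>auto elim!: eventually_mono\<close>)
  have W2_H: "W2 (c s) (c t) \<le> (LINT u:{s..t}|lborel. H u)" if st: "s \<le> t" for s t
  proof (rule field_le_epsilon)
    fix e :: real assume e: "e > 0"
    have "isCont (primitive m) s"
      using continuous_primitive[OF m(1)] by (simp add: continuous_on_eq_continuous_at)
    then obtain b where b: "b > 0" "\<And>r. dist r s < b \<Longrightarrow> dist (primitive m r) (primitive m s) < e / 2"
      using e unfolding continuous_at_eps_delta by (metis half_gt_zero_iff)
    obtain r where r: "s < of_rat r" "of_rat r < s + b"
      using of_rat_dense[of s "s + b"] b(1) by auto
    have near: "W2 (c s) (c (of_rat r)) < e / 2"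
      using W2_le_primitive[of s "of_rat r"] b(2)[of "of_rat r"] r by (simp add: dist_real_def)
    have "(LINT u:{s..t}|lborel. h r u) \<le> (LINT u:{s..t}|lborel. H u)"
      by (intro set_integral_mono_AE integrable_set_borel h H_int)
        (use h_H in \<open>auto elim!: eventually_mono intro: order_trans[OF abs_ge_self]\<close>)
    then have "d r t - d r s \<le> (LINT u:{s..t}|lborel. H u)" using h_diff[OF st] by simp
    then show "W2 (c s) (c t) \<le> (LINT u:{s..t}|lborel. H u) + e"
      using W2_triangle[OF P2 P2 P2, of s t "of_rat r"] near W2_commute[of "c s" "c (of_rat r)"]
      unfolding d_def by simp
  qed
  have "AE t in lborel. \<forall>r. (d r has_real_derivative h r t) (at t)"
    using h_der by (simp add: AE_all_countable)
  with AE_primitive_has_derivative[OF H_int] H' show ?thesis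
  proof eventually_elim
    case (elim t)
    have "has_metric_derivative c (H t) t"
      unfolding has_metric_derivative_def
    proof (rule order_tendstoI)
      fix a assume a: "a < H t"
      show "\<forall>\<^sub>F s in at t. a < W2 (c s) (c t) / \<bar>s - t\<bar>"
      proof (cases "a < 0")
        case True
        have "a < W2 (c s) (c t) / \<bar>s - t\<bar>" for s
          using W2_nonneg[OF P2 P2, of s t] True by (meson abs_ge_zero divide_nonneg_nonneg less_le_trans)
        then show ?thesis by simp
      next
        case False
        then have "ennreal a < (SUP r. ennreal \<bar>h r t\<bar>)"
          using a elim(2) by (simp add: H'_def ennreal_less_iff)
        then obtain r where r: "a < \<bar>h r t\<bar>"
          using False by (auto simp: less_SUP_iff ennreal_less_iff)
        have "((\<lambda>s. \<bar>(d r s - d r t) / (s - t)\<bar>) \<longlongrightarrow> \<bar>h r t\<bar>) (at t)"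
          using elim(3) by (intro tendsto_rabs) (simp add: has_field_derivative_iff)
        from order_tendstoD(1)[OF this r] show ?thesis
        proof eventually_elim
          case (elim s)
          also have "\<bar>(d r s - d r t) / (s - t)\<bar> \<le> W2 (c s) (c t) / \<bar>s - t\<bar>"
            unfolding abs_divide d_def using W2_reverse_triangle[of "of_rat r" s t] W2_commute[of "c s" "c t"]
            by (intro divide_right_mono) auto
          finally show ?case .
        qed
      qed
    next
      fix a assume a: "H t < a"
      have "((\<lambda>s. (primitive H s - primitive H t) / (s - t)) \<longlongrightarrow> H t) (at t)"
        using elim(1) by (simp add: has_field_derivative_iff)
      from order_tendstoD(2)[OF this a]
      show "\<forall>\<^sub>F s in at t. W2 (c s) (c t) / \<bar>s - t\<bar> < a"
      proof eventually_elim
        case (elim s)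
        have "W2 (c s) (c t) / \<bar>s - t\<bar> \<le> (primitive H s - primitive H t) / (s - t)"
        proof (cases "s \<le> t")
          case True
          then have "W2 (c s) (c t) / \<bar>s - t\<bar> \<le> (primitive H t - primitive H s) / (t - s)"
            using W2_H[OF True] primitive_diff[OF H_int True]
            by (simp add: divide_right_mono)
          then show ?thesis by (metis minus_diff_eq minus_divide_divide)
        next
          case False
          then show ?thesis
            using W2_H[of t s] primitive_diff[OF H_int, of t s] W2_commute[of "c s" "c t"]
            by (simp add: divide_right_mono)
        qed
        with elim show ?case by simp
      qed
    qed
    with elim(2) H_nonneg[of t] show ?case
      using has_metric_derivative_unique by metis
  qed
qed

end

abbreviation clamp_real :: "real \<Rightarrow> real \<Rightarrow> real \<Rightarrow> real" where
  "clamp_real a b t \<equiv> max a (min b t)"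

text \<open>
  Freezing the curve outside \<open>[a, b]\<close> adds no length, so \<open>\<bar>k\<bar>\<close> cut off outside \<open>[a, b]\<close> still dominates
  the increments. It is integrable because \<open>\<bar>k\<bar> \<le> 1 + k\<^sup>2\<close> on a bounded interval.
\<close>

lemma AC2_extend:
  assumes c: "AC2 {a..b} c" and ab: "a \<le> b"
  obtains m where "dominated_curve (\<lambda>t. c (clamp_real a b t)) m" "integrable lborel (\<lambda>u. (m u)\<^sup>2)"
proof -
  obtain k where k: "set_borel_measurable lborel {a..b} k" "set_integrable lborel {a..b} (\<lambda>u. (k u)\<^sup>2)"
    and le: "\<And>s t. s \<in> {a..b} \<Longrightarrow> t \<in> {a..b} \<Longrightarrow> s \<le> t \<Longrightarrow> W2 (c s) (c t) \<le> (LINT u:{s..t}|lborel. k u)"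
    and P2: "\<And>t. t \<in> {a..b} \<Longrightarrow> c t \<in> P2"
    using c unfolding AC2_def by blast
  define m where "m u = indicator {a..b} u * \<bar>k u\<bar>" for u
  have [measurable]: "(\<lambda>u. indicator {a..b} u * k u) \<in> borel_measurable borel"
    using k(1) by (simp add: set_borel_measurable_def)
  have m_eq: "m u = \<bar>indicator {a..b} u * k u\<bar>" for u by (simp add: m_def split: split_indicator)
  have [measurable]: "m \<in> borel_measurable borel" unfolding m_eq[abs_def] by measurable
  have m_int: "integrable lborel m"
  proof (rule Bochner_Integration.integrable_bound)
    have "integrable lborel (indicator {a..b} :: real \<Rightarrow> real)"
      by (rule integrable_real_indicator) (auto simp: emeasure_lborel_Icc_eq)
    then show "integrable lborel (\<lambda>u. indicator {a..b} u + indicator {a..b} u * (k u)\<^sup>2)"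
      using k(2) by (intro Bochner_Integration.integrable_add) (auto simp: set_integrable_def)
    have "\<bar>z\<bar> \<le> 1 + z\<^sup>2" for z :: real
      using sum_squares_bound[of "\<bar>z\<bar>" 1] by simp
    then show "AE u in lborel. norm (m u) \<le> norm (indicator {a..b} u + indicator {a..b} u * (k u)\<^sup>2 :: real)"
      by (auto simp: m_def split: split_indicator)
  qed simp
  have "dominated_curve (\<lambda>t. c (clamp_real a b t)) m"
  proof
    show "0 \<le> m t" for t by (simp add: m_def)
    show "c (clamp_real a b t) \<in> P2" for t using ab by (intro P2) auto
    fix s t :: real assume st: "s \<le> t"
    define s' where "s' = clamp_real a b s"
    define t' where "t' = clamp_real a b t"
    have *: "s' \<in> {a..b}" "t' \<in> {a..b}" "s' \<le> t'" using st ab by (auto simp: s'_def t'_def)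
    have "W2 (c s') (c t') \<le> (LINT u:{s'..t'}|lborel. k u)" by (rule le[OF *])
    also have "\<dots> \<le> (LINT u:{s..t}|lborel. m u)"
    proof (cases "s' < t'")
      case True
      then have sub: "s \<le> s'" "t' \<le> t" by (auto simp: s'_def t'_def max_def min_def split: if_splits)
      have "(LINT u:{s'..t'}|lborel. k u) \<le> \<bar>LINT u:{s'..t'}|lborel. k u\<bar>" by simp
      also have "\<dots> \<le> (LINT u|lborel. \<bar>indicator {s'..t'} u * k u\<bar>)"
        unfolding set_lebesgue_integral_def by simp
      also have "\<dots> \<le> (LINT u|lborel. indicator {s..t} u * m u)"
        using integrable_set_borel[OF m_int, of "{s..t}"] *(1,2) sub
        by (intro integral_mono') (auto simp: set_integrable_def m_def split: split_indicator)
      finally show ?thesis by (simp add: set_lebesgue_integral_def)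
    next
      case False
      with *(3) have "s' = t'" by simp
      have "AE u in lborel. indicator {s'..t'} u *\<^sub>R k u = 0"
        using AE_lborel_singleton[of t'] by eventually_elim (simp add: \<open>s' = t'\<close>)
      then have "(LINT u:{s'..t'}|lborel. k u) = 0"
        unfolding set_lebesgue_integral_def by (rule integral_eq_zero_AE)
      also have "0 \<le> (LINT u:{s..t}|lborel. m u)"
        unfolding set_lebesgue_integral_def by (intro integral_nonneg_AE) (auto simp: m_def)
      finally show ?thesis .
    qed
    finally show "W2 (c (clamp_real a b s)) (c (clamp_real a b t)) \<le> (LINT u:{s..t}|lborel. m u)"
      by (simp add: s'_def t'_def)
  qed (rule m_int)
  moreover have "(\<lambda>u. (m u)\<^sup>2) = (\<lambda>u. indicator {a..b} u *\<^sub>R (k u)\<^sup>2)"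
    by (auto simp: m_def split: split_indicator)
  then have "integrable lborel (\<lambda>u. (m u)\<^sup>2)"
    using k(2) by (simp add: set_integrable_def)
  ultimately show thesis by (rule that)
qed

lemma has_metric_derivative_clamp:
  assumes "a < t" "t < b"
  shows "has_metric_derivative (\<lambda>t. c (clamp_real a b t)) v t \<longleftrightarrow> has_metric_derivative c v t"
  using assms by (intro has_metric_derivative_cong[of "{a<..<b}"]) auto

section \<open>Test functions along curves of measures\<close>

lemma W2_greatest:
  assumes "\<mu> \<in> P2" "\<nu> \<in> P2" "\<And>\<pi>. \<pi> \<in> couplings \<mu> \<nu> \<Longrightarrow> x \<le> sqrt (transport_cost \<pi>)"
  shows "x \<le> W2 \<mu> \<nu>"
proof (rule ccontr)
  assume "\<not> x \<le> W2 \<mu> \<nu>"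
  then obtain \<pi> where "\<pi> \<in> couplings \<mu> \<nu>" "sqrt (transport_cost \<pi>) < x"
    using near_optimal_coupling[OF assms(1,2), of x] by auto
  then show False using assms(3)[of \<pi>] by simp
qed

definition rms :: "'a::euclidean_space measure \<Rightarrow> real" where
  "rms \<mu> = sqrt (LINT \<theta>|\<mu>. (norm \<theta>)\<^sup>2)"

lemma rms_nonneg: "rms \<mu> \<ge> 0"
  unfolding rms_def by (auto intro!: integral_nonneg_AE)

text \<open>
  The root mean square is the \<open>L\<^sup>2\<close> norm of either coordinate under a coupling.
\<close>

lemma rms_le:
  assumes "\<mu> \<in> P2" "\<nu> \<in> P2"
  shows "rms \<nu> \<le> rms \<mu> + W2 \<mu> \<nu>"
proof -
  have "rms \<nu> - rms \<mu> \<le> W2 \<mu> \<nu>"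
  proof (rule W2_greatest[OF assms])
    fix \<pi> assume \<pi>: "\<pi> \<in> couplings \<mu> \<nu>"
    note [measurable] = coupling_measurable[OF \<pi>]
    have "sqrt (LINT p|\<pi>. (norm (snd p))\<^sup>2)
      \<le> sqrt (LINT p|\<pi>. (norm (fst p))\<^sup>2) + sqrt (LINT p|\<pi>. (dist (fst p) (snd p))\<^sup>2)"
    proof (rule L2_norm_triangle(2))
      show "integrable \<pi> (\<lambda>p. (norm (fst p))\<^sup>2)"
        using coupling_integral(3)[OF \<pi>, of "\<lambda>x. (norm x)\<^sup>2"] P2D(3)[OF assms(1)] by simp
      show "integrable \<pi> (\<lambda>p. (dist (fst p) (snd p))\<^sup>2)"
        by (rule coupling_cost_integrable[OF \<pi> assms])
      show "AE p in \<pi>. \<bar>norm (snd p)\<bar> \<le> norm (fst p) + dist (fst p) (snd p)"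
      proof (rule AE_I2)
        fix p
        show "\<bar>norm (snd p)\<bar> \<le> norm (fst p) + dist (fst p) (snd p)"
          using norm_triangle_sub[of "snd p" "fst p"] by (simp add: dist_norm norm_minus_commute)
      qed
    qed measurable
    then show "rms \<nu> - rms \<mu> \<le> sqrt (transport_cost \<pi>)"
      using coupling_integral(1,2)[OF \<pi>, of "\<lambda>x. (norm x)\<^sup>2"]
      unfolding rms_def transport_cost_def by simp
  qed
  then show ?thesis by simp
qed

lemma L2_linear_growth:
  assumes \<mu>: "\<mu> \<in> P2" and [measurable]: "f \<in> borel_measurable borel"
    and f: "\<And>\<theta>. \<bar>f \<theta>\<bar> \<le> k * (1 + norm \<theta>)" and k: "k \<ge> 0"
  shows "integrable \<mu> (\<lambda>\<theta>. (f \<theta>)\<^sup>2)" "sqrt (LINT \<theta>|\<mu>. (f \<theta>)\<^sup>2) \<le> k * (1 + rms \<mu>)" "integrable \<mu> f"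
proof -
  interpret prob_space \<mu> by (rule P2D(1)[OF \<mu>])
  note [measurable_cong] = P2D(2)[OF \<mu>]
  have int: "integrable \<mu> (\<lambda>\<theta>. (k * norm \<theta>)\<^sup>2)"
    using P2D(3)[OF \<mu>] by (simp add: power_mult_distrib)
  have le: "AE \<theta> in \<mu>. \<bar>f \<theta>\<bar> \<le> k + k * norm \<theta>" using f by (simp add: distrib_left)
  show f2: "integrable \<mu> (\<lambda>\<theta>. (f \<theta>)\<^sup>2)"
    by (rule L2_norm_triangle(1)[OF _ _ int le]) auto
  have "sqrt (LINT \<theta>|\<mu>. (f \<theta>)\<^sup>2) \<le> sqrt (LINT \<theta>|\<mu>. k\<^sup>2) + sqrt (LINT \<theta>|\<mu>. (k * norm \<theta>)\<^sup>2)"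
    by (rule L2_norm_triangle(2)[OF _ _ int le]) auto
  also have "\<dots> = k * (1 + rms \<mu>)"
    using k by (simp add: prob_space power_mult_distrib real_sqrt_mult rms_def distrib_left)
  finally show "sqrt (LINT \<theta>|\<mu>. (f \<theta>)\<^sup>2) \<le> k * (1 + rms \<mu>)" .
  show "integrable \<mu> f"
    using L2_Cauchy_Schwarz(1)[of f \<mu> "\<lambda>_. 1"] f2 by simp
qed

text \<open>
  The Lipschitz modulus at \<open>\<theta>\<close> involves the size of the base point \<open>\<theta>\<close> only, not that of \<open>\<theta>'\<close>. Thus under a
  coupling it depends on the first marginal alone and is square integrable. A neuron \<open>w \<sigma>(a \<bullet> v + b)\<close> has this
  property because \<open>\<sigma>\<close> is bounded, although its gradient grows with \<open>w\<close>.
\<close>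

locale test_function =
  fixes \<phi> :: "'a::euclidean_space \<Rightarrow> real" and g :: "'a \<Rightarrow> 'a" and k :: real
  assumes deriv: "\<And>\<theta>. GDERIV \<phi> \<theta> :> g \<theta>"
    and g_measurable [measurable]: "g \<in> borel_measurable borel"
    and lipschitz: "\<And>\<theta> \<theta>'. \<bar>\<phi> \<theta>' - \<phi> \<theta>\<bar> \<le> k * (1 + norm \<theta>) * dist \<theta> \<theta>'"
    and k_nonneg: "k \<ge> 0"
begin

lemma gradient_eq: "gradient \<phi> \<theta> = g \<theta>"
  unfolding gradient_def
proof (rule the_equality[where P="\<lambda>D. GDERIV \<phi> \<theta> :> D", OF deriv])
  fix D assume "GDERIV \<phi> \<theta> :> D"
  then have "(\<lambda>h. h \<bullet> D) = (\<lambda>h. h \<bullet> g \<theta>)"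
    using deriv[of \<theta>] has_derivative_unique unfolding gderiv_def by blast
  then show "D = g \<theta>" by (metis inner_commute vector_eq_rdot)
qed

lemma continuous: "continuous_on UNIV \<phi>"
proof (rule continuous_at_imp_continuous_on, safe)
  fix x
  show "isCont \<phi> x"
    using has_derivative_continuous[of \<phi> "\<lambda>h. h \<bullet> g x" x UNIV] deriv[of x] by (simp add: gderiv_def)
qed

lemma measurable [measurable]: "\<phi> \<in> borel_measurable borel"
  by (rule borel_measurable_continuous_onI[OF continuous])

lemma growth: "\<bar>\<phi> \<theta>\<bar> \<le> (\<bar>\<phi> 0\<bar> + k) * (1 + norm \<theta>)"
proof -
  have "\<bar>\<phi> \<theta>\<bar> \<le> \<bar>\<phi> 0\<bar> + k * norm \<theta>"
    using lipschitz[of \<theta> 0] by simp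
  also have "\<dots> \<le> (\<bar>\<phi> 0\<bar> + k) * (1 + norm \<theta>)"
    using k_nonneg by (simp add: algebra_simps)
  finally show ?thesis .
qed

lemma integrable: "\<mu> \<in> P2 \<Longrightarrow> integrable \<mu> \<phi>"
  using L2_linear_growth(3)[OF _ measurable growth] k_nonneg by auto

lemma norm_g_le: "norm (g \<theta>) \<le> k * (1 + norm \<theta>)"
proof (cases "g \<theta> = 0")
  case False
  have "((\<lambda>s. \<phi> (\<theta> + s *\<^sub>R g \<theta>)) has_derivative (\<lambda>s. (s *\<^sub>R g \<theta>) \<bullet> g \<theta>)) (at 0)"
    using deriv[of \<theta>] unfolding gderiv_def
    by (intro has_derivative_compose[where f="\<lambda>s. \<theta> + s *\<^sub>R g \<theta>" and g=\<phi> and g'="\<lambda>h. h \<bullet> g \<theta>"])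
      (auto intro!: derivative_eq_intros)
  then have "((\<lambda>s. \<phi> (\<theta> + s *\<^sub>R g \<theta>)) has_real_derivative (g \<theta> \<bullet> g \<theta>)) (at 0)"
    by (rule has_derivative_imp_has_field_derivative) simp
  then have "((\<lambda>s. \<bar>(\<phi> (\<theta> + s *\<^sub>R g \<theta>) - \<phi> \<theta>) / s\<bar>) \<longlongrightarrow> \<bar>g \<theta> \<bullet> g \<theta>\<bar>) (at 0)"
    by (intro tendsto_rabs) (simp add: has_field_derivative_iff)
  moreover have "\<bar>(\<phi> (\<theta> + s *\<^sub>R g \<theta>) - \<phi> \<theta>) / s\<bar> \<le> k * (1 + norm \<theta>) * norm (g \<theta>)" if "s \<noteq> 0" for s
    using lipschitz[of "\<theta> + s *\<^sub>R g \<theta>" \<theta>] that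
    by (simp add: abs_divide dist_norm divide_le_eq ac_simps)
  ultimately have "\<bar>g \<theta> \<bullet> g \<theta>\<bar> \<le> k * (1 + norm \<theta>) * norm (g \<theta>)"
    by (intro tendsto_upperbound[where F="at 0"]) (auto simp: eventually_at_filter)
  then show ?thesis
    using False by (simp add: dot_square_norm power2_eq_square)
qed (use k_nonneg in simp)

lemma norm_g_L2:
  assumes "\<mu> \<in> P2"
  shows "integrable \<mu> (\<lambda>\<theta>. (norm (g \<theta>))\<^sup>2)"
    and "sqrt (LINT \<theta>|\<mu>. (norm (g \<theta>))\<^sup>2) \<le> k * (1 + rms \<mu>)"
  by (rule L2_linear_growth[OF assms _ _ k_nonneg]; simp add: norm_g_le)+

lemma coupling_difference:
  assumes \<pi>: "\<pi> \<in> couplings \<mu> \<nu>" and P2: "\<mu> \<in> P2" "\<nu> \<in> P2"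
  shows "\<bar>(LINT \<theta>|\<nu>. \<phi> \<theta>) - (LINT \<theta>|\<mu>. \<phi> \<theta>)\<bar> \<le> (LINT p|\<pi>. \<bar>\<phi> (snd p) - \<phi> (fst p)\<bar>)"
    and "integrable \<pi> (\<lambda>p. \<bar>\<phi> (snd p) - \<phi> (fst p)\<bar>)"
proof -
  have int: "integrable \<pi> (\<lambda>p. \<phi> (fst p))" "integrable \<pi> (\<lambda>p. \<phi> (snd p))"
    using coupling_integral(3,4)[OF \<pi> measurable] integrable P2 by auto
  have "(LINT \<theta>|\<nu>. \<phi> \<theta>) - (LINT \<theta>|\<mu>. \<phi> \<theta>) = (LINT p|\<pi>. \<phi> (snd p) - \<phi> (fst p))"
    using int by (simp add: coupling_integral(1,2)[OF \<pi> measurable])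
  then show "\<bar>(LINT \<theta>|\<nu>. \<phi> \<theta>) - (LINT \<theta>|\<mu>. \<phi> \<theta>)\<bar> \<le> (LINT p|\<pi>. \<bar>\<phi> (snd p) - \<phi> (fst p)\<bar>)"
    by simp
  show "integrable \<pi> (\<lambda>p. \<bar>\<phi> (snd p) - \<phi> (fst p)\<bar>)" using int by auto
qed

lemma coupling_Cauchy_Schwarz:
  assumes \<pi>: "\<pi> \<in> couplings \<mu> \<nu>" and P2: "\<mu> \<in> P2" "\<nu> \<in> P2"
    and f [measurable]: "f \<in> borel_measurable borel" and f0: "\<And>\<theta>. f \<theta> \<ge> 0" and f2: "integrable \<mu> (\<lambda>\<theta>. (f \<theta>)\<^sup>2)"
  shows "integrable \<pi> (\<lambda>p. f (fst p) * dist (fst p) (snd p))"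
    "(LINT p|\<pi>. f (fst p) * dist (fst p) (snd p)) \<le> sqrt (LINT \<theta>|\<mu>. (f \<theta>)\<^sup>2) * sqrt (transport_cost \<pi>)"
proof -
  note [measurable] = coupling_measurable[OF \<pi>]
  have int: "integrable \<pi> (\<lambda>p. (f (fst p))\<^sup>2)"
    using coupling_integral(3)[OF \<pi>, of "\<lambda>\<theta>. (f \<theta>)\<^sup>2"] f2 by simp
  note cs = L2_Cauchy_Schwarz[OF _ _ int coupling_cost_integrable[OF \<pi> P2]]
  show "integrable \<pi> (\<lambda>p. f (fst p) * dist (fst p) (snd p))"
    by (rule cs) measurable
  have "(LINT p|\<pi>. \<bar>f (fst p) * dist (fst p) (snd p)\<bar>)
     \<le> sqrt (LINT p|\<pi>. (f (fst p))\<^sup>2) * sqrt (LINT p|\<pi>. (dist (fst p) (snd p))\<^sup>2)"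
    by (rule cs) measurable
  then show "(LINT p|\<pi>. f (fst p) * dist (fst p) (snd p)) \<le> sqrt (LINT \<theta>|\<mu>. (f \<theta>)\<^sup>2) * sqrt (transport_cost \<pi>)"
    using f0 coupling_integral(1)[OF \<pi>, of "\<lambda>\<theta>. (f \<theta>)\<^sup>2"] by (simp add: transport_cost_def)
qed

lemma integral_lipschitz:
  assumes P2: "\<mu> \<in> P2" "\<nu> \<in> P2"
  shows "\<bar>(LINT \<theta>|\<nu>. \<phi> \<theta>) - (LINT \<theta>|\<mu>. \<phi> \<theta>)\<bar> \<le> k * (1 + rms \<mu>) * W2 \<mu> \<nu>"
proof (cases "k = 0")
  case True
  have "\<phi> \<theta> = \<phi> 0" for \<theta> using lipschitz[of \<theta> 0] True by simp
  then have "\<phi> = (\<lambda>_. \<phi> 0)" by blast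
  moreover have "(LINT \<theta>|\<mu>. \<phi> 0) = \<phi> 0" "(LINT \<theta>|\<nu>. \<phi> 0) = \<phi> 0"
    using P2 by (simp_all add: P2D(1) prob_space.prob_space)
  ultimately have "(LINT \<theta>|\<mu>. \<phi> \<theta>) = (LINT \<theta>|\<nu>. \<phi> \<theta>)" by metis
  then show ?thesis using True by simp
next
  case False
  let ?A = "\<bar>(LINT \<theta>|\<nu>. \<phi> \<theta>) - (LINT \<theta>|\<mu>. \<phi> \<theta>)\<bar>"
  have pos: "k * (1 + rms \<mu>) > 0"
    using False k_nonneg rms_nonneg[of \<mu>] by (simp add: add_pos_nonneg)
  have K: "integrable \<mu> (\<lambda>\<theta>. (k * (1 + norm \<theta>))\<^sup>2)" "sqrt (LINT \<theta>|\<mu>. (k * (1 + norm \<theta>))\<^sup>2) \<le> k * (1 + rms \<mu>)"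
    by (rule L2_linear_growth[OF P2(1) _ _ k_nonneg]; simp add: k_nonneg)+
  have "?A / (k * (1 + rms \<mu>)) \<le> W2 \<mu> \<nu>"
  proof (rule W2_greatest[OF P2])
    fix \<pi> assume \<pi>: "\<pi> \<in> couplings \<mu> \<nu>"
    note cs = coupling_Cauchy_Schwarz[OF \<pi> P2 _ _ K(1)]
    have "?A \<le> (LINT p|\<pi>. \<bar>\<phi> (snd p) - \<phi> (fst p)\<bar>)"
      by (rule coupling_difference(1)[OF \<pi> P2])
    also have "\<dots> \<le> (LINT p|\<pi>. k * (1 + norm (fst p)) * dist (fst p) (snd p))"
      by (intro integral_mono coupling_difference(2)[OF \<pi> P2] cs(1) lipschitz)
        (use k_nonneg in auto)
    also have "\<dots> \<le> sqrt (LINT \<theta>|\<mu>. (k * (1 + norm \<theta>))\<^sup>2) * sqrt (transport_cost \<pi>)"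
      by (rule cs(2)) (use k_nonneg in auto)
    also have "\<dots> \<le> k * (1 + rms \<mu>) * sqrt (transport_cost \<pi>)"
      using K(2) transport_cost_nonneg by (intro mult_right_mono) auto
    finally show "?A / (k * (1 + rms \<mu>)) \<le> sqrt (transport_cost \<pi>)"
      using pos by (simp add: pos_divide_le_eq ac_simps)
  qed
  then show ?thesis using pos by (simp add: pos_divide_le_eq ac_simps)
qed

text \<open>
  The first-order Taylor estimate at \<open>\<theta>\<close> holds with error \<open>e\<close> only within a radius depending on \<open>\<theta>\<close>. The set
  \<open>B n\<close> collects the points where the radius \<open>1/n\<close> is too large, or where the Lipschitz modulus exceeds \<open>n\<close>. Every point
  eventually leaves these sets, so their contribution tends to \<open>0\<close> by dominated convergence.
\<close>

lemma remainder_exceptional_sets: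
  assumes \<mu>: "\<mu> \<in> P2" and e: "e > 0"
  obtains B :: "nat \<Rightarrow> 'a set" where "\<And>n. B n \<in> sets borel"
    "(\<lambda>n. LINT \<theta>|\<mu>. (indicator (B n) \<theta> * (k * (1 + norm \<theta>)))\<^sup>2) \<longlonglongrightarrow> 0"
    "\<And>n \<theta>. \<theta> \<notin> B n \<Longrightarrow> k * (1 + norm \<theta>) \<le> real n"
    "\<And>n \<theta> \<theta>'. \<theta> \<notin> B n \<Longrightarrow> real n * dist \<theta> \<theta>' < 1 \<Longrightarrow> \<bar>\<phi> \<theta>' - \<phi> \<theta> - (\<theta>' - \<theta>) \<bullet> g \<theta>\<bar> \<le> e * dist \<theta> \<theta>'"
proof -
  interpret prob_space \<mu> by (rule P2D(1)[OF \<mu>])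
  note [measurable_cong] = P2D(2)[OF \<mu>]
  obtain D :: "'a set" where D: "countable D" "\<And>X. open X \<Longrightarrow> X \<noteq> {} \<Longrightarrow> \<exists>d\<in>D. d \<in> X"
    using countable_dense_setE by blast
  define R where "R \<theta> h = \<bar>\<phi> (\<theta> + h) - \<phi> \<theta> - h \<bullet> g \<theta>\<bar>" for \<theta> h
  \<comment> \<open>Only countably many directions, to keep the set measurable; continuity of \<open>R\<close> in \<open>h\<close> recovers the others.\<close>
  define C where "C n = (\<Union>h\<in>{h\<in>D. real n * norm h < 1}. {\<theta>. e * norm h < R \<theta> h})" for n
  define B where "B n = {\<theta>. real n < k * (1 + norm \<theta>)} \<union> C n" for n
  have [measurable]: "{\<theta>. e * norm h < R \<theta> h} \<in> sets borel" for h
    unfolding R_def by measurable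
  have [measurable]: "B n \<in> sets borel" for n
    unfolding B_def C_def by (intro sets.Un sets.countable_UN' countable_subset[OF _ D(1)]) auto
  have cont_R: "continuous_on UNIV (\<lambda>h. R \<theta> h)" for \<theta>
    unfolding R_def
    by (intro continuous_intros continuous_on_compose2[OF continuous]) auto
  have ev: "\<forall>\<^sub>F n in sequentially. \<theta> \<notin> B n" for \<theta>
  proof -
    have "\<forall>\<^sub>F h in at 0. norm (\<phi> (\<theta> + h) - \<phi> \<theta> - h \<bullet> g \<theta>) / norm h < e"
      using deriv[of \<theta>] e unfolding gderiv_def has_derivative_at
      by (auto dest: order_tendstoD(2))
    then obtain r where r: "r > 0" "\<And>h. h \<noteq> 0 \<Longrightarrow> norm h < r \<Longrightarrow> R \<theta> h / norm h < e"
      unfolding eventually_at R_def by auto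
    have small: "R \<theta> h \<le> e * norm h" if "norm h < r" for h
      using r(2)[of h] that by (cases "h = 0") (auto simp: R_def divide_less_eq)
    obtain N where N: "real N > max (k * (1 + norm \<theta>)) (1 / r)" using reals_Archimedean2 by blast
    have "\<theta> \<notin> B n" if n: "n \<ge> N" for n
    proof -
      have n1: "real n > k * (1 + norm \<theta>)" "real n > 1 / r" using N n by auto
      then have "norm h < r" if "real n * norm h < 1" for h :: 'a
      proof -
        have "norm h < 1 / real n" using that n1(2) r(1)
          by (metis divide_pos_pos less_trans mult.commute pos_less_divide_eq zero_less_one)
        also have "\<dots> < r" using n1(2) r(1)
          by (metis divide_less_eq less_trans mult.commute divide_pos_pos zero_less_one)
        finally show ?thesis .
      qed
      then show ?thesis using n1(1) small unfolding B_def C_def by fastforce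
    qed
    then show ?thesis unfolding eventually_sequentially by blast
  qed
  show thesis
  proof (rule that)
    show "B n \<in> sets borel" for n by measurable
    have "(\<lambda>n. LINT \<theta>|\<mu>. (indicator (B n) \<theta> * (k * (1 + norm \<theta>)))\<^sup>2) \<longlonglongrightarrow> (LINT \<theta>|\<mu>. 0)"
    proof (rule integral_dominated_convergence)
      show "integrable \<mu> (\<lambda>\<theta>. (k * (1 + norm \<theta>))\<^sup>2)"
        by (rule L2_linear_growth[OF \<mu> _ _ k_nonneg]; simp add: k_nonneg)
      show "AE \<theta> in \<mu>. (\<lambda>n. (indicator (B n) \<theta> * (k * (1 + norm \<theta>)))\<^sup>2) \<longlonglongrightarrow> 0"
      proof (rule AE_I2)
        fix \<theta>
        show "(\<lambda>n. (indicator (B n) \<theta> * (k * (1 + norm \<theta>)))\<^sup>2) \<longlonglongrightarrow> 0"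
          by (rule tendsto_eventually) (use ev[of \<theta>] in \<open>auto elim!: eventually_mono\<close>)
      qed
    qed (auto split: split_indicator)
    then show "(\<lambda>n. LINT \<theta>|\<mu>. (indicator (B n) \<theta> * (k * (1 + norm \<theta>)))\<^sup>2) \<longlonglongrightarrow> 0"
      by simp
    show "k * (1 + norm \<theta>) \<le> real n" if "\<theta> \<notin> B n" for n \<theta>
      using that by (auto simp: B_def)
    fix n \<theta> \<theta>' assume *: "\<theta> \<notin> B n" "real n * dist \<theta> \<theta>' < 1"
    define h where "h = \<theta>' - \<theta>"
    define U where "U = {h::'a. real n * norm h < 1}"
    have "open U" unfolding U_def by (intro open_Collect_less continuous_intros)
    have "h \<in> U" using *(2) by (simp add: h_def U_def dist_norm norm_minus_commute)
    have "\<not> (e * norm h < R \<theta> h)"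
    proof
      assume "e * norm h < R \<theta> h"
      then have "h \<in> U \<inter> {h. e * norm h < R \<theta> h}" using \<open>h \<in> U\<close> by simp
      moreover have "open (U \<inter> {h. e * norm h < R \<theta> h})"
        by (intro open_Int \<open>open U\<close> open_Collect_less continuous_intros cont_R)
      ultimately obtain d where "d \<in> D" "d \<in> U" "e * norm d < R \<theta> d" using D(2) by blast
      then have "\<theta> \<in> B n" unfolding B_def C_def U_def by blast
      with *(1) show False by contradiction
    qed
    then show "\<bar>\<phi> \<theta>' - \<phi> \<theta> - (\<theta>' - \<theta>) \<bullet> g \<theta>\<bar> \<le> e * dist \<theta> \<theta>'"
      by (simp add: R_def h_def dist_norm norm_minus_commute)
  qed
qed

text \<open>
  Under a coupling, \<open>\<bar>\<phi> \<theta>' - \<phi> \<theta>\<bar>\<close> is bounded by \<open>norm (g \<theta>) d\<close> plus three errors, where \<open>d = dist \<theta> \<theta>'\<close>: the Taylor error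
  \<open>e/3 d\<close> at good points and short distances, the Lipschitz bound \<open>K \<theta> d\<close> on the exceptional set, and
  \<open>n d \<le> n\<^sup>2 d\<^sup>2\<close> at good points and distances beyond \<open>1/n\<close>. By Cauchy-Schwarz each error contributes at most
  \<open>e/3\<close> times the root of the transport cost, once \<open>n\<close> is large and the cost small.
\<close>

lemma slope_estimate:
  assumes \<mu>: "\<mu> \<in> P2" and e: "e > 0"
  obtains \<delta> where "\<delta> > 0" "\<And>\<nu>. \<nu> \<in> P2 \<Longrightarrow> W2 \<mu> \<nu> < \<delta> \<Longrightarrow>
    \<bar>(LINT \<theta>|\<nu>. \<phi> \<theta>) - (LINT \<theta>|\<mu>. \<phi> \<theta>)\<bar> \<le> (sqrt (LINT \<theta>|\<mu>. (norm (g \<theta>))\<^sup>2) + e) * W2 \<mu> \<nu>"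
proof -
  interpret prob_space \<mu> by (rule P2D(1)[OF \<mu>])
  note [measurable_cong] = P2D(2)[OF \<mu>]
  define K where "K \<theta> = k * (1 + norm \<theta>)" for \<theta> :: 'a
  have K_nonneg: "K \<theta> \<ge> 0" for \<theta> using k_nonneg by (simp add: K_def)
  have [measurable]: "K \<in> borel_measurable borel" unfolding K_def by measurable
  obtain B where B [measurable]: "\<And>n. B n \<in> sets borel"
    and lim: "(\<lambda>n. LINT \<theta>|\<mu>. (indicator (B n) \<theta> * K \<theta>)\<^sup>2) \<longlonglongrightarrow> 0"
    and K_le: "\<And>n \<theta>. \<theta> \<notin> B n \<Longrightarrow> K \<theta> \<le> real n"
    and rem: "\<And>n \<theta> \<theta>'. \<theta> \<notin> B n \<Longrightarrow> real n * dist \<theta> \<theta>' < 1 \<Longrightarrow>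
      \<bar>\<phi> \<theta>' - \<phi> \<theta> - (\<theta>' - \<theta>) \<bullet> g \<theta>\<bar> \<le> e / 3 * dist \<theta> \<theta>'"
    using remainder_exceptional_sets[OF \<mu>, of "e / 3"] e unfolding K_def by auto
  have "\<forall>\<^sub>F n in sequentially. (LINT \<theta>|\<mu>. (indicator (B n) \<theta> * K \<theta>)\<^sup>2) < (e / 3)\<^sup>2"
    using e by (intro order_tendstoD(2)[OF lim]) simp
  then obtain n where "(LINT \<theta>|\<mu>. (indicator (B n) \<theta> * K \<theta>)\<^sup>2) < (e / 3)\<^sup>2"
    by (meson eventually_happens trivial_limit_sequentially)
  then have n: "sqrt (LINT \<theta>|\<mu>. (indicator (B n) \<theta> * K \<theta>)\<^sup>2) \<le> e / 3"
    using e by (intro real_le_lsqrt) (auto intro: integral_nonneg_AE)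
  have K2: "integrable \<mu> (\<lambda>\<theta>. (indicator (B n) \<theta> * K \<theta>)\<^sup>2)"
  proof (rule L2_linear_growth(1)[OF \<mu> _ _ k_nonneg])
    show "\<bar>indicator (B n) \<theta> * K \<theta>\<bar> \<le> k * (1 + norm \<theta>)" for \<theta>
      using K_nonneg[of \<theta>] unfolding K_def by (auto split: split_indicator)
  qed measurable
  define a where "a = sqrt (LINT \<theta>|\<mu>. (norm (g \<theta>))\<^sup>2)"
  have a: "a \<ge> 0" unfolding a_def by (auto intro!: integral_nonneg_AE)
  \<comment> \<open>Makes \<open>n\<^sup>2\<close> times the root of the cost at most \<open>e/3\<close>; the summand \<open>1\<close> covers \<open>n = 0\<close>.\<close>
  define \<delta> where "\<delta> = e / (3 * ((real n)\<^sup>2 + 1))"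
  show thesis
  proof (rule that)
    show \<delta>: "\<delta> > 0" unfolding \<delta>_def using e by (simp add: add_nonneg_pos)
    fix \<nu> assume \<nu>: "\<nu> \<in> P2" and near: "W2 \<mu> \<nu> < \<delta>"
    define X where "X = \<bar>(LINT \<theta>|\<nu>. \<phi> \<theta>) - (LINT \<theta>|\<mu>. \<phi> \<theta>)\<bar>"
    have X: "X \<le> (a + e) * sqrt (transport_cost \<pi>)"
      if \<pi>: "\<pi> \<in> couplings \<mu> \<nu>" and small: "sqrt (transport_cost \<pi>) < \<delta>" for \<pi>
    proof -
      define sc where "sc = sqrt (transport_cost \<pi>)"
      have sc: "0 \<le> sc" "sc * sc = transport_cost \<pi>" using transport_cost_nonneg[of \<pi>] by (auto simp: sc_def)
      note cs = coupling_Cauchy_Schwarz[OF \<pi> \<mu> \<nu>]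
      let ?d = "\<lambda>p::'a \<times> 'a. dist (fst p) (snd p)"
      have 1: "integrable \<pi> (\<lambda>p. norm (g (fst p)) * ?d p)" "(LINT p|\<pi>. norm (g (fst p)) * ?d p) \<le> a * sc"
        unfolding a_def sc_def by (intro cs norm_g_L2(1)[OF \<mu>]; simp)+
      have 2: "integrable \<pi> (\<lambda>p. e / 3 * ?d p)" "(LINT p|\<pi>. e / 3 * ?d p) \<le> e / 3 * sc"
        using cs[of "\<lambda>_. e / 3"] e unfolding sc_def by (auto simp: prob_space)
      have 3: "integrable \<pi> (\<lambda>p. indicator (B n) (fst p) * K (fst p) * ?d p)"
        using K_nonneg K2 by (intro cs) auto
      have "(LINT p|\<pi>. indicator (B n) (fst p) * K (fst p) * ?d p)
          \<le> sqrt (LINT \<theta>|\<mu>. (indicator (B n) \<theta> * K \<theta>)\<^sup>2) * sc"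
        unfolding sc_def using K_nonneg K2 by (intro cs) auto
      also have "\<dots> \<le> e / 3 * sc" using n sc(1) by (rule mult_right_mono)
      finally have le3: "(LINT p|\<pi>. indicator (B n) (fst p) * K (fst p) * ?d p) \<le> e / 3 * sc" .
      have 4: "integrable \<pi> (\<lambda>p. (real n)\<^sup>2 * (?d p)\<^sup>2)"
        using coupling_cost_integrable[OF \<pi> \<mu> \<nu>] by simp
      have "(LINT p|\<pi>. (real n)\<^sup>2 * (?d p)\<^sup>2) = (real n)\<^sup>2 * sc * sc"
        using sc(2) by (simp add: transport_cost_def)
      also have "(real n)\<^sup>2 * sc \<le> ((real n)\<^sup>2 + 1) * \<delta>"
        using small sc(1) unfolding sc_def[symmetric] by (intro mult_mono) auto
      also have "\<dots> = e / 3"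
      proof -
        have "z * (e / (3 * z)) = e / 3" if "z \<noteq> 0" for z :: real using that by simp
        moreover have "(real n)\<^sup>2 + 1 \<noteq> 0" by (smt (verit) zero_le_power2)
        ultimately show ?thesis unfolding \<delta>_def by blast
      qed
      finally have le4: "(LINT p|\<pi>. (real n)\<^sup>2 * (?d p)\<^sup>2) \<le> e / 3 * sc"
        using sc(1) by (auto intro: mult_right_mono)
      have pointwise: "\<bar>\<phi> \<theta>' - \<phi> \<theta>\<bar> \<le> norm (g \<theta>) * dist \<theta> \<theta>' + e / 3 * dist \<theta> \<theta>'
          + indicator (B n) \<theta> * K \<theta> * dist \<theta> \<theta>' + (real n)\<^sup>2 * (dist \<theta> \<theta>')\<^sup>2" for \<theta> \<theta>'
      proof -
        have nonneg: "0 \<le> norm (g \<theta>) * dist \<theta> \<theta>'" "0 \<le> e / 3 * dist \<theta> \<theta>'" "0 \<le> (real n)\<^sup>2 * (dist \<theta> \<theta>')\<^sup>2"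
          using e by auto
        have lip: "\<bar>\<phi> \<theta>' - \<phi> \<theta>\<bar> \<le> K \<theta> * dist \<theta> \<theta>'" using lipschitz[of \<theta>' \<theta>] by (simp add: K_def)
        consider "\<theta> \<in> B n" | "\<theta> \<notin> B n" "real n * dist \<theta> \<theta>' < 1" | "\<theta> \<notin> B n" "1 \<le> real n * dist \<theta> \<theta>'"
          by fastforce
        then show ?thesis
        proof cases
          case 1
          then have "indicator (B n) \<theta> * K \<theta> * dist \<theta> \<theta>' = K \<theta> * dist \<theta> \<theta>'" by simp
          then show ?thesis using lip nonneg by linarith
        next
          case 2
          have "\<bar>(\<theta>' - \<theta>) \<bullet> g \<theta>\<bar> \<le> norm (g \<theta>) * dist \<theta> \<theta>'"
            using Cauchy_Schwarz_ineq2[of "\<theta>' - \<theta>" "g \<theta>"] by (simp add: dist_norm norm_minus_commute mult.commute)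
          moreover have "indicator (B n) \<theta> * K \<theta> * dist \<theta> \<theta>' = 0" using 2(1) by simp
          ultimately show ?thesis using rem[OF 2] nonneg(3) by linarith
        next
          case 3
          have "K \<theta> * dist \<theta> \<theta>' \<le> real n * dist \<theta> \<theta>'"
            using K_le[OF 3(1)] by (intro mult_right_mono) auto
          also have "\<dots> \<le> (real n * dist \<theta> \<theta>') * (real n * dist \<theta> \<theta>')"
            using mult_left_mono[OF 3(2), of "real n * dist \<theta> \<theta>'"] by simp
          also have "\<dots> = (real n)\<^sup>2 * (dist \<theta> \<theta>')\<^sup>2" by (simp add: power2_eq_square ac_simps)
          finally have "\<bar>\<phi> \<theta>' - \<phi> \<theta>\<bar> \<le> (real n)\<^sup>2 * (dist \<theta> \<theta>')\<^sup>2" using lip by simp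
          moreover have "indicator (B n) \<theta> * K \<theta> * dist \<theta> \<theta>' = 0" using 3(1) by simp
          ultimately show ?thesis using nonneg by linarith
        qed
      qed
      have "X \<le> (LINT p|\<pi>. \<bar>\<phi> (snd p) - \<phi> (fst p)\<bar>)"
        unfolding X_def by (rule coupling_difference(1)[OF \<pi> \<mu> \<nu>])
      also have "\<dots> \<le> (LINT p|\<pi>. norm (g (fst p)) * ?d p + e / 3 * ?d p
          + indicator (B n) (fst p) * K (fst p) * ?d p + (real n)\<^sup>2 * (?d p)\<^sup>2)"
        by (intro integral_mono coupling_difference(2)[OF \<pi> \<mu> \<nu>] Bochner_Integration.integrable_add 1 2 3 4 pointwise)
      also have "\<dots> = (LINT p|\<pi>. norm (g (fst p)) * ?d p) + (LINT p|\<pi>. e / 3 * ?d p)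
          + (LINT p|\<pi>. indicator (B n) (fst p) * K (fst p) * ?d p) + (LINT p|\<pi>. (real n)\<^sup>2 * (?d p)\<^sup>2)"
        by (simp only: Bochner_Integration.integral_add Bochner_Integration.integrable_add 1 2 3 4)
      also have "\<dots> \<le> a * sc + e / 3 * sc + e / 3 * sc + e / 3 * sc"
        by (intro add_mono 1 2 le3 le4)
      also have "\<dots> = (a + e) * sc" by (simp add: algebra_simps)
      finally show ?thesis by (simp add: sc_def)
    qed
    have pos: "a + e > 0" using a e by simp
    have "X / (a + e) \<le> W2 \<mu> \<nu>"
    proof (rule ccontr)
      assume "\<not> X / (a + e) \<le> W2 \<mu> \<nu>"
      then have "W2 \<mu> \<nu> < min \<delta> (X / (a + e))" using near by simp
      then obtain \<pi> where \<pi>: "\<pi> \<in> couplings \<mu> \<nu>" "sqrt (transport_cost \<pi>) < min \<delta> (X / (a + e))"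
        using near_optimal_coupling[OF \<mu> \<nu>] by blast
      then have "X \<le> (a + e) * sqrt (transport_cost \<pi>)" by (intro X) auto
      then show False using \<pi>(2) pos by (simp add: pos_less_divide_eq mult.commute)
    qed
    then show "\<bar>(LINT \<theta>|\<nu>. \<phi> \<theta>) - (LINT \<theta>|\<mu>. \<phi> \<theta>)\<bar> \<le> (sqrt (LINT \<theta>|\<mu>. (norm (g \<theta>))\<^sup>2) + e) * W2 \<mu> \<nu>"
      using pos unfolding X_def a_def by (simp add: pos_divide_le_eq mult.commute)
  qed
qed

text \<open>
  Divide the slope estimate by \<open>\<bar>s - t\<bar>\<close> and let \<open>s\<close> tend to \<open>t\<close>, then the error to \<open>0\<close>.
\<close>

lemma derivative_along_curve_le:
  assumes P2: "\<And>s. c s \<in> P2" and v: "has_metric_derivative c v t"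
    and p: "((\<lambda>s. LINT \<theta>|c s. \<phi> \<theta>) has_real_derivative p) (at t)"
  shows "\<bar>p\<bar> \<le> sqrt (LINT \<theta>|c t. (norm (g \<theta>))\<^sup>2) * v"
proof -
  define a where "a = sqrt (LINT \<theta>|c t. (norm (g \<theta>))\<^sup>2)"
  define q where "q s = W2 (c s) (c t) / \<bar>s - t\<bar>" for s
  have q: "(q \<longlongrightarrow> v) (at t)" using v by (simp add: has_metric_derivative_def q_def[abs_def])
  have "((\<lambda>s. q s * \<bar>s - t\<bar>) \<longlongrightarrow> v * \<bar>t - t\<bar>) (at t)"
    by (intro tendsto_intros q)
  then have W2_0: "((\<lambda>s. q s * \<bar>s - t\<bar>) \<longlongrightarrow> 0) (at t)" by simp
  have le: "\<bar>p\<bar> \<le> (a + e) * v" if e: "e > 0" for e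
  proof -
    obtain \<delta> where \<delta>: "\<delta> > 0" and *: "\<And>\<nu>. \<nu> \<in> P2 \<Longrightarrow> W2 (c t) \<nu> < \<delta> \<Longrightarrow>
      \<bar>(LINT \<theta>|\<nu>. \<phi> \<theta>) - (LINT \<theta>|c t. \<phi> \<theta>)\<bar> \<le> (a + e) * W2 (c t) \<nu>"
      unfolding a_def using slope_estimate[OF P2 e] by metis
    have "((\<lambda>s. \<bar>((LINT \<theta>|c s. \<phi> \<theta>) - (LINT \<theta>|c t. \<phi> \<theta>)) / (s - t)\<bar>) \<longlongrightarrow> \<bar>p\<bar>) (at t)"
      using p by (intro tendsto_rabs) (simp add: has_field_derivative_iff)
    moreover have "((\<lambda>s. (a + e) * q s) \<longlongrightarrow> (a + e) * v) (at t)"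
      by (intro tendsto_intros q)
    moreover have "\<forall>\<^sub>F s in at t. \<bar>((LINT \<theta>|c s. \<phi> \<theta>) - (LINT \<theta>|c t. \<phi> \<theta>)) / (s - t)\<bar> \<le> (a + e) * q s"
      using order_tendstoD(2)[OF W2_0 \<delta>] eventually_neq_at_within[of t t UNIV]
    proof eventually_elim
      case (elim s)
      then have "W2 (c s) (c t) < \<delta>" by (simp add: q_def)
      then have "\<bar>(LINT \<theta>|c s. \<phi> \<theta>) - (LINT \<theta>|c t. \<phi> \<theta>)\<bar> \<le> (a + e) * W2 (c s) (c t)"
        using *[OF P2, of s] by (simp add: W2_commute)
      then show ?case
        by (simp add: q_def abs_divide divide_right_mono)
    qed
    ultimately show ?thesis by (intro tendsto_le[of "at t"]) auto
  qed
  have "\<bar>p\<bar> \<le> a * v"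
  proof (rule tendsto_lowerbound)
    show "((\<lambda>e. (a + e) * v) \<longlongrightarrow> a * v) (at_right 0)"
      by (auto intro!: tendsto_eq_intros)
    show "\<forall>\<^sub>F e in at_right 0. \<bar>p\<bar> \<le> (a + e) * v"
      by (intro eventually_at_right_less[THEN eventually_mono] le)
  qed simp
  then show ?thesis by (simp add: a_def)
qed

end

section \<open>The empirical loss of a network\<close>

lemma (in test_function) integral_bound:
  assumes \<mu>: "\<mu> \<in> P2"
  shows "\<bar>LINT \<theta>|\<mu>. \<phi> \<theta>\<bar> \<le> (\<bar>\<phi> 0\<bar> + k) * (1 + rms \<mu>)"
proof -
  interpret prob_space \<mu> by (rule P2D(1)[OF \<mu>])
  note [measurable_cong] = P2D(2)[OF \<mu>]
  note growth' = L2_linear_growth[OF \<mu> measurable growth]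
  have "\<bar>LINT \<theta>|\<mu>. \<phi> \<theta>\<bar> \<le> (LINT \<theta>|\<mu>. \<bar>\<phi> \<theta> * 1\<bar>)"
    by simp
  also have "\<dots> \<le> sqrt (LINT \<theta>|\<mu>. (\<phi> \<theta>)\<^sup>2) * sqrt (LINT \<theta>|\<mu>. 1\<^sup>2)"
    using growth'(1) k_nonneg by (intro L2_Cauchy_Schwarz(2)) auto
  also have "\<dots> \<le> (\<bar>\<phi> 0\<bar> + k) * (1 + rms \<mu>)"
    using growth'(2) k_nonneg by (simp add: prob_space)
  finally show ?thesis .
qed

lemma test_function_zero: "test_function (\<lambda>_. 0) (\<lambda>_. 0) 0"
  by unfold_locales (auto intro: GDERIV_const)

lemma test_function_cmult:
  assumes "test_function \<phi> g k"
  shows "test_function (\<lambda>\<theta>. r * \<phi> \<theta>) (\<lambda>\<theta>. r *\<^sub>R g \<theta>) (\<bar>r\<bar> * k)"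
proof -
  interpret test_function \<phi> g k by fact
  show ?thesis
  proof
    show "GDERIV (\<lambda>\<theta>. r * \<phi> \<theta>) \<theta> :> r *\<^sub>R g \<theta>" for \<theta>
      using GDERIV_mult[OF GDERIV_const deriv, of r \<theta>] by simp
    show "\<bar>r * \<phi> \<theta>' - r * \<phi> \<theta>\<bar> \<le> \<bar>r\<bar> * k * (1 + norm \<theta>) * dist \<theta> \<theta>'" for \<theta> \<theta>'
      using mult_left_mono[OF lipschitz[of \<theta>' \<theta>], of "\<bar>r\<bar>"]
      by (simp add: right_diff_distrib[symmetric] abs_mult ac_simps)
  qed (use k_nonneg in auto)
qed

lemma test_function_add:
  assumes "test_function \<phi> g k" "test_function \<phi>' g' k'"
  shows "test_function (\<lambda>\<theta>. \<phi> \<theta> + \<phi>' \<theta>) (\<lambda>\<theta>. g \<theta> + g' \<theta>) (k + k')"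
proof -
  interpret A: test_function \<phi> g k by fact
  interpret B: test_function \<phi>' g' k' by fact
  show ?thesis
  proof
    show "\<bar>(\<phi> \<theta>' + \<phi>' \<theta>') - (\<phi> \<theta> + \<phi>' \<theta>)\<bar> \<le> (k + k') * (1 + norm \<theta>) * dist \<theta> \<theta>'" for \<theta> \<theta>'
      using A.lipschitz[of \<theta>' \<theta>] B.lipschitz[of \<theta>' \<theta>] by (simp add: distrib_right)
  qed (use A.k_nonneg B.k_nonneg A.deriv B.deriv in \<open>auto intro: GDERIV_add\<close>)
qed

lemma test_function_sum:
  assumes "finite A" "\<And>i. i \<in> A \<Longrightarrow> test_function (\<phi> i) (g i) (k i)"
  shows "test_function (\<lambda>\<theta>. \<Sum>i\<in>A. \<phi> i \<theta>) (\<lambda>\<theta>. \<Sum>i\<in>A. g i \<theta>) (\<Sum>i\<in>A. k i)"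
  using assms
  by (induction rule: finite_induct) (auto intro: test_function_zero test_function_add)

locale network_loss =
  fixes \<sigma> loss :: "real \<Rightarrow> real"
    and M :: nat
    and x :: "nat \<Rightarrow> real ^ 'd::finite"
    and y :: "nat \<Rightarrow> real"
    and S0 \<beta> :: real
  assumes S0: "S0 \<ge> 0"
    and \<sigma>_lipschitz: "\<And>z z'. \<bar>\<sigma> z - \<sigma> z'\<bar> \<le> S0 * \<bar>z - z'\<bar>"
    and \<sigma>_bounded: "\<And>z. \<bar>\<sigma> z\<bar> \<le> S0"
    and \<sigma>_differentiable: "\<And>z. \<sigma> field_differentiable (at z)"
    and loss_differentiable: "\<And>r. loss field_differentiable (at r)"
    and \<beta>: "\<beta> > 0"
    and loss_deriv_lipschitz: "\<And>r s. \<bar>deriv loss r - deriv loss s\<bar> \<le> \<beta> * \<bar>r - s\<bar>"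
begin

abbreviation "L \<equiv> emp_loss \<sigma> loss M x y"
abbreviation "G \<equiv> upper_gradient \<sigma> loss M x y"

definition neuron :: "real ^ 'd \<Rightarrow> 'd param \<Rightarrow> real" where
  "neuron v = (\<lambda>(w, a, b). w * \<sigma> (a \<bullet> v + b))"

definition neuron_gradient :: "real ^ 'd \<Rightarrow> 'd param \<Rightarrow> 'd param" where
  "neuron_gradient v = (\<lambda>(w, a, b). let z = a \<bullet> v + b in
     (\<sigma> z, (w * deriv \<sigma> z) *\<^sub>R v, w * deriv \<sigma> z))"

lemma \<sigma>_deriv: "(\<sigma> has_real_derivative deriv \<sigma> z) (at z)"
  using \<sigma>_differentiable by (simp add: DERIV_deriv_iff_field_differentiable)

lemma loss_deriv: "(loss has_real_derivative deriv loss z) (at z)"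
  using loss_differentiable by (simp add: DERIV_deriv_iff_field_differentiable)

lemma measurable_\<sigma> [measurable]: "\<sigma> \<in> borel_measurable borel"
proof (rule borel_measurable_continuous_onI, rule continuous_at_imp_continuous_on, safe)
  show "isCont \<sigma> z" for z using \<sigma>_deriv by (rule DERIV_isCont)
qed

text \<open>
  The derivative is a pointwise limit of continuous difference quotients; it may be discontinuous.
\<close>

lemma measurable_deriv_\<sigma> [measurable]: "deriv \<sigma> \<in> borel_measurable borel"
proof (rule borel_measurable_LIMSEQ_real)
  fix z
  have "((\<lambda>h. (\<sigma> (z + h) - \<sigma> z) / h) \<longlongrightarrow> deriv \<sigma> z) (at 0)"
    using \<sigma>_deriv[of z] by (simp add: DERIV_def)
  moreover have "filterlim (\<lambda>n. inverse (real (Suc n))) (at 0) sequentially"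
    by (intro filterlim_atI LIMSEQ_inverse_real_of_nat) auto
  ultimately show "(\<lambda>n. (\<sigma> (z + inverse (real (Suc n))) - \<sigma> z) / inverse (real (Suc n))) \<longlonglongrightarrow> deriv \<sigma> z"
    by (rule filterlim_compose)
qed measurable

text \<open>
  Boundedness of \<open>\<sigma>\<close> controls the change of the outer weight and its Lipschitz constant that of the inner
  parameters:
  \<open>w' \<sigma>(z') - w \<sigma>(z) = (w' - w) \<sigma>(z') + w (\<sigma>(z') - \<sigma>(z))\<close>.
\<close>

lemma test_function_neuron: "test_function (neuron v) (neuron_gradient v) (S0 * (1 + norm v))"
proof
  fix \<theta> :: "'d param"
  define z where "z \<theta> = fst (snd \<theta>) \<bullet> v + snd (snd \<theta>)" for \<theta> :: "'d param"
  have neuron_eq: "neuron v = (\<lambda>\<theta>. fst \<theta> * \<sigma> (z \<theta>))"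
    by (auto simp: neuron_def z_def)
  have z: "(z has_derivative z) (at \<theta>)"
    unfolding z_def[abs_def] by (auto intro!: derivative_eq_intros)
  have "((\<lambda>\<theta>. \<sigma> (z \<theta>)) has_derivative (\<lambda>h. deriv \<sigma> (z \<theta>) * z h)) (at \<theta>)"
    using has_derivative_compose[OF z, of \<sigma> "(*) (deriv \<sigma> (z \<theta>))"] \<sigma>_deriv[of "z \<theta>"]
    by (simp add: has_field_derivative_def)
  then have "(neuron v has_derivative (\<lambda>h. fst \<theta> * (deriv \<sigma> (z \<theta>) * z h) + fst h * \<sigma> (z \<theta>))) (at \<theta>)"
    unfolding neuron_eq by (intro has_derivative_mult has_derivative_fst has_derivative_ident)
  moreover have "fst \<theta> * (deriv \<sigma> (z \<theta>) * z h) + fst h * \<sigma> (z \<theta>) = h \<bullet> neuron_gradient v \<theta>" for h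
    by (cases \<theta>; cases h) (simp add: neuron_gradient_def z_def Let_def inner_prod_def algebra_simps)
  ultimately show "GDERIV (neuron v) \<theta> :> neuron_gradient v \<theta>"
    by (simp add: gderiv_def)
  fix \<theta>' :: "'d param"
  obtain w a b where \<theta>: "\<theta> = (w, a, b)" by (cases \<theta>)
  obtain w' a' b' where \<theta>': "\<theta>' = (w', a', b')" by (cases \<theta>')
  have comp: "\<bar>w' - w\<bar> \<le> dist \<theta> \<theta>'" "norm (a' - a) \<le> dist \<theta> \<theta>'" "\<bar>b' - b\<bar> \<le> dist \<theta> \<theta>'" "\<bar>w\<bar> \<le> norm \<theta>"
  proof -
    have "dist w w' \<le> dist \<theta> \<theta>'"
      using dist_fst_le[of \<theta> \<theta>'] by (simp only: \<theta> \<theta>' fst_conv)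
    moreover have "dist a a' \<le> dist \<theta> \<theta>'"
      using order_trans[OF dist_fst_le[of "snd \<theta>" "snd \<theta>'"] dist_snd_le[of \<theta> \<theta>']]
      by (simp only: \<theta> \<theta>' fst_conv snd_conv)
    moreover have "dist b b' \<le> dist \<theta> \<theta>'"
      using order_trans[OF dist_snd_le[of "snd \<theta>" "snd \<theta>'"] dist_snd_le[of \<theta> \<theta>']]
      by (simp only: \<theta> \<theta>' snd_conv)
    ultimately show "\<bar>w' - w\<bar> \<le> dist \<theta> \<theta>'" "norm (a' - a) \<le> dist \<theta> \<theta>'" "\<bar>b' - b\<bar> \<le> dist \<theta> \<theta>'"
      by (metis dist_commute dist_real_def, metis dist_commute dist_norm, metis dist_commute dist_real_def)
    show "\<bar>w\<bar> \<le> norm \<theta>"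
      using dist_fst_le[of \<theta> 0] by (simp only: \<theta> fst_conv fst_zero dist_norm diff_0_right real_norm_def)
  qed
  have "neuron v \<theta>' - neuron v \<theta> = (w' - w) * \<sigma> (z \<theta>') + w * (\<sigma> (z \<theta>') - \<sigma> (z \<theta>))"
    by (simp add: neuron_eq \<theta> \<theta>' algebra_simps)
  also have "\<bar>\<dots>\<bar> \<le> \<bar>w' - w\<bar> * S0 + \<bar>w\<bar> * (S0 * \<bar>z \<theta>' - z \<theta>\<bar>)"
    by (intro order_trans[OF abs_triangle_ineq] add_mono)
      (auto simp: abs_mult intro!: mult_left_mono \<sigma>_bounded \<sigma>_lipschitz)
  also have "\<dots> \<le> dist \<theta> \<theta>' * S0 + norm \<theta> * (S0 * ((1 + norm v) * dist \<theta> \<theta>'))"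
  proof -
    have "z \<theta>' - z \<theta> = (a' - a) \<bullet> v + (b' - b)" by (simp add: z_def \<theta> \<theta>' inner_diff_left)
    also have "\<bar>\<dots>\<bar> \<le> norm (a' - a) * norm v + \<bar>b' - b\<bar>"
      by (intro order_trans[OF abs_triangle_ineq] add_mono Cauchy_Schwarz_ineq2) simp
    also have "\<dots> \<le> dist \<theta> \<theta>' * norm v + dist \<theta> \<theta>'"
      by (intro add_mono mult_right_mono comp) simp
    finally have "\<bar>z \<theta>' - z \<theta>\<bar> \<le> (1 + norm v) * dist \<theta> \<theta>'" by (simp add: algebra_simps)
    then show ?thesis using comp S0 by (intro add_mono mult_mono) auto
  qed
  also have "\<dots> \<le> S0 * (1 + norm v) * (1 + norm \<theta>) * dist \<theta> \<theta>'"
    using S0 by (simp add: algebra_simps)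
  finally show "\<bar>neuron v \<theta>' - neuron v \<theta>\<bar> \<le> S0 * (1 + norm v) * (1 + norm \<theta>) * dist \<theta> \<theta>'" .
next
  show "neuron_gradient v \<in> borel_measurable borel"
  proof -
    have [measurable]: "(\<lambda>\<theta>::'d param. fst \<theta>) \<in> borel_measurable borel"
      "(\<lambda>\<theta>::'d param. fst (snd \<theta>)) \<in> borel_measurable borel"
      "(\<lambda>\<theta>::'d param. snd (snd \<theta>)) \<in> borel_measurable borel"
      by (auto intro!: borel_measurable_continuous_onI continuous_intros)
    show ?thesis
      unfolding neuron_gradient_def Let_def case_prod_beta by measurable
  qed
qed (use S0 in auto)

lemma network_eq: "network \<sigma> \<mu> v = (LINT \<theta>|\<mu>. neuron v \<theta>)"
  by (simp add: network_def neuron_def)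

definition residual_weight :: "'d param measure \<Rightarrow> nat \<Rightarrow> real" where
  "residual_weight \<mu> k = deriv loss (network \<sigma> \<mu> (x k) - y k)"

lemma linear_derivative_eq:
  "linear_derivative \<sigma> loss M x y \<mu> = (\<lambda>\<theta>. (1 / real M) * (\<Sum>k=1..M. residual_weight \<mu> k * neuron (x k) \<theta>))"
  by (auto simp: linear_derivative_def neuron_def residual_weight_def)

definition linear_derivative_gradient :: "'d param measure \<Rightarrow> 'd param \<Rightarrow> 'd param" where
  "linear_derivative_gradient \<mu> \<theta> = (1 / real M) *\<^sub>R (\<Sum>k=1..M. residual_weight \<mu> k *\<^sub>R neuron_gradient (x k) \<theta>)"

lemma test_function_linear_derivative:
  "test_function (linear_derivative \<sigma> loss M x y \<mu>) (linear_derivative_gradient \<mu>)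
    (\<bar>1 / real M\<bar> * (\<Sum>k=1..M. \<bar>residual_weight \<mu> k\<bar> * (S0 * (1 + norm (x k)))))"
  unfolding linear_derivative_eq linear_derivative_gradient_def[abs_def]
  by (intro test_function_cmult test_function_sum test_function_neuron) simp

lemma upper_gradient_eq: "G \<mu> = sqrt (LINT \<theta>|\<mu>. (norm (linear_derivative_gradient \<mu> \<theta>))\<^sup>2)"
  unfolding upper_gradient_def test_function.gradient_eq[OF test_function_linear_derivative] ..

lemma upper_gradient_nonneg: "G \<mu> \<ge> 0"
  unfolding upper_gradient_def by (auto intro!: integral_nonneg_AE)

lemma network_bound:
  fixes \<mu> :: "'d param measure"
  assumes "\<mu> \<in> P2" "rms \<mu> \<le> \<rho>"
  shows "\<bar>network \<sigma> \<mu> v\<bar> \<le> S0 * (1 + norm v) * (1 + \<rho>)"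
proof -
  have "\<bar>network \<sigma> \<mu> v\<bar> \<le> S0 * (1 + norm v) * (1 + rms \<mu>)"
    using test_function.integral_bound[OF test_function_neuron assms(1), of v]
    by (simp add: network_eq neuron_def zero_prod_def)
  also have "\<dots> \<le> S0 * (1 + norm v) * (1 + \<rho>)"
    using assms(2) S0 by (intro mult_left_mono) auto
  finally show ?thesis .
qed

lemma deriv_loss_bound:
  assumes "\<bar>r\<bar> \<le> K"
  shows "\<bar>deriv loss r\<bar> \<le> \<bar>deriv loss 0\<bar> + \<beta> * K"
  using loss_deriv_lipschitz[of r 0] mult_left_mono[OF assms less_imp_le[OF \<beta>]] by simp

definition weight_bound :: "real \<Rightarrow> nat \<Rightarrow> real" where
  "weight_bound \<rho> k = \<bar>deriv loss 0\<bar> + \<beta> * (S0 * (1 + norm (x k)) * (1 + \<rho>) + \<bar>y k\<bar>)"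

text \<open>
  Bounded second moments bound the predictions, hence the weights \<open>loss'\<close> of the residuals, hence the growth constant of the
  linear derivative.
\<close>

lemma upper_gradient_bounded:
  "\<exists>B. \<forall>\<mu>\<in>P2. rms \<mu> \<le> \<rho> \<longrightarrow> G \<mu> \<le> B"
proof -
  define K where "K \<mu> = \<bar>1 / real M\<bar> * (\<Sum>k=1..M. \<bar>residual_weight \<mu> k\<bar> * (S0 * (1 + norm (x k))))" for \<mu>
  define B where "B = \<bar>1 / real M\<bar> * (\<Sum>k=1..M. weight_bound \<rho> k * (S0 * (1 + norm (x k))))"
  have "G \<mu> \<le> B * (1 + \<rho>)" if \<mu>: "\<mu> \<in> P2" "rms \<mu> \<le> \<rho>" for \<mu>
  proof -
    have "\<bar>residual_weight \<mu> k\<bar> \<le> weight_bound \<rho> k" for k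
      unfolding residual_weight_def weight_bound_def
      by (intro deriv_loss_bound order_trans[OF abs_triangle_ineq4] add_mono network_bound \<mu>) simp
    then have "K \<mu> \<le> B"
      unfolding K_def B_def using S0 by (intro mult_left_mono sum_mono mult_right_mono) auto
    moreover have "0 \<le> K \<mu>"
      unfolding K_def using S0 by (intro mult_nonneg_nonneg sum_nonneg) auto
    moreover have "G \<mu> \<le> K \<mu> * (1 + rms \<mu>)"
      unfolding upper_gradient_eq K_def
      by (rule test_function.norm_g_L2(2)[OF test_function_linear_derivative \<mu>(1)])
    ultimately show ?thesis
      using mult_mono[of "K \<mu>" B "1 + rms \<mu>" "1 + \<rho>"] \<mu>(2) rms_nonneg[of \<mu>] by linarith
  qed
  then show ?thesis by blast
qed

lemma loss_lipschitz_on_bounded: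
  assumes "\<bar>r\<bar> \<le> K" "\<bar>s\<bar> \<le> K"
  shows "\<bar>loss r - loss s\<bar> \<le> (\<bar>deriv loss 0\<bar> + \<beta> * K) * \<bar>r - s\<bar>"
proof -
  have "norm (loss r - loss s) \<le> (\<bar>deriv loss 0\<bar> + \<beta> * K) * norm (r - s)"
  proof (rule field_differentiable_bound[of "{-K..K}" loss "deriv loss"])
    show "(loss has_field_derivative deriv loss z) (at z within {- K..K})" for z
      by (rule has_field_derivative_at_within[OF loss_deriv])
  qed (use assms deriv_loss_bound in auto)
  then show ?thesis by simp
qed

end

text \<open>
  Second moments, and therefore predictions, are bounded along the curve, so that the loss function, whose
  derivative is unbounded in general, is Lipschitz on the values it takes.
\<close>

locale loss_along_curve = network_loss \<sigma> loss M x y S0 \<beta> + dominated_curve c m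
  for \<sigma> loss M and x :: "nat \<Rightarrow> real ^ 'd::finite" and y S0 \<beta>
    and c :: "real \<Rightarrow> 'd param measure" and m
begin

definition rms_bound :: real where "rms_bound = rms (c 0) + (LINT u|lborel. m u)"

lemma rms_le_bound: "rms (c t) \<le> rms_bound"
  using rms_le[OF P2[of 0] P2[of t]] W2_le_total[of 0 t] unfolding rms_bound_def by simp

definition prediction :: "nat \<Rightarrow> real \<Rightarrow> real" where
  "prediction k t = network \<sigma> (c t) (x k)"

definition prediction_const :: "nat \<Rightarrow> real" where "prediction_const k = S0 * (1 + norm (x k)) * (1 + rms_bound)"

lemma prediction_const_nonneg: "prediction_const k \<ge> 0"
  unfolding prediction_const_def using S0 rms_le_bound[of 0] rms_nonneg[of "c 0"] by (intro mult_nonneg_nonneg) auto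

lemma prediction_bound: "\<bar>prediction k t\<bar> \<le> prediction_const k"
  unfolding prediction_def prediction_const_def by (rule network_bound[OF P2 rms_le_bound])

lemma prediction_increment:
  assumes "s \<le> t"
  shows "\<bar>prediction k t - prediction k s\<bar> \<le> prediction_const k * (LINT u:{s..t}|lborel. m u)"
proof -
  have "\<bar>prediction k t - prediction k s\<bar> \<le> S0 * (1 + norm (x k)) * (1 + rms (c s)) * W2 (c s) (c t)"
    unfolding prediction_def network_eq
    by (rule test_function.integral_lipschitz[OF test_function_neuron P2 P2])
  also have "\<dots> \<le> prediction_const k * (LINT u:{s..t}|lborel. m u)"
    unfolding prediction_const_def using S0 rms_le_bound[of s] rms_nonneg[of "c s"]
    by (intro mult_mono W2_le[OF assms] W2_nonneg P2 mult_nonneg_nonneg) auto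
  finally show ?thesis .
qed

lemma prediction_differentiable:
  "AE t in lborel. \<forall>k. \<exists>p. (prediction k has_real_derivative p) (at t)"
proof -
  have "AE t in lborel. \<exists>p. (prediction k has_real_derivative p) (at t)" for k
  proof (rule dominated_increments_derivative[of "\<lambda>u. prediction_const k * m u" "prediction k"])
    show "\<bar>prediction k t - prediction k s\<bar> \<le> (LINT u:{s..t}|lborel. prediction_const k * m u)" if "s \<le> t" for s t
      using prediction_increment[OF that] by simp
    show "AE t in lborel. \<exists>p. (prediction k has_real_derivative p) (at t)"
      if "AE t in lborel. (prediction k has_real_derivative h t) (at t)" for h
      using that by (auto elim!: eventually_mono)
  qed (use m prediction_const_nonneg in auto)
  then show ?thesis by (simp add: AE_all_countable)
qed

definition loss_const :: real where
  "loss_const = (1 / real M) * (\<Sum>k=1..M. (\<bar>deriv loss 0\<bar> + \<beta> * (prediction_const k + \<bar>y k\<bar>)) * prediction_const k)"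

lemma loss_eq: "L (c t) = (1 / real M) * (\<Sum>k=1..M. loss (prediction k t - y k))"
  by (simp add: emp_loss_def prediction_def)

lemma loss_increment:
  assumes "s \<le> t"
  shows "\<bar>L (c t) - L (c s)\<bar> \<le> loss_const * (LINT u:{s..t}|lborel. m u)"
proof -
  let ?I = "LINT u:{s..t}|lborel. m u"
  have "\<bar>loss (prediction k t - y k) - loss (prediction k s - y k)\<bar>
      \<le> (\<bar>deriv loss 0\<bar> + \<beta> * (prediction_const k + \<bar>y k\<bar>)) * prediction_const k * ?I" for k
  proof -
    have b: "\<bar>prediction k r - y k\<bar> \<le> prediction_const k + \<bar>y k\<bar>" for r
      using prediction_bound[of k r] by linarith
    have "\<bar>loss (prediction k t - y k) - loss (prediction k s - y k)\<bar>
      \<le> (\<bar>deriv loss 0\<bar> + \<beta> * (prediction_const k + \<bar>y k\<bar>)) * \<bar>prediction k t - prediction k s\<bar>"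
      using loss_lipschitz_on_bounded[OF b b, of t s] by simp
    also have "\<dots> \<le> (\<bar>deriv loss 0\<bar> + \<beta> * (prediction_const k + \<bar>y k\<bar>)) * (prediction_const k * ?I)"
      using \<beta> prediction_const_nonneg[of k] by (intro mult_left_mono prediction_increment assms add_nonneg_nonneg mult_nonneg_nonneg) auto
    finally show ?thesis by (simp add: ac_simps)
  qed
  then have "\<bar>\<Sum>k=1..M. loss (prediction k t - y k) - loss (prediction k s - y k)\<bar>
    \<le> (\<Sum>k=1..M. (\<bar>deriv loss 0\<bar> + \<beta> * (prediction_const k + \<bar>y k\<bar>)) * prediction_const k * ?I)"
    by (intro order_trans[OF sum_abs] sum_mono)
  from mult_left_mono[OF this, of "1 / real M"] show ?thesis
    unfolding loss_eq loss_const_def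
    by (simp add: right_diff_distrib[symmetric] diff_divide_distrib[symmetric] sum_subtractf[symmetric] sum_distrib_right abs_mult)
qed

lemma loss_const_nonneg: "loss_const \<ge> 0"
  unfolding loss_const_def using \<beta> prediction_const_nonneg
  by (intro mult_nonneg_nonneg sum_nonneg add_nonneg_nonneg) (auto intro: mult_nonneg_nonneg add_nonneg_nonneg)

text \<open>
  At almost every \<open>t\<close>, differentiating \<open>L (c s)\<close> at \<open>s = t\<close> gives the same number as differentiating
  \<open>s \<mapsto> \<integral>\<phi> d(c s)\<close>, with \<open>\<phi>\<close> the linear derivative at \<open>c t\<close> kept fixed. To the latter the slope
  estimate applies, and \<open>G (c t)\<close> is by definition the \<open>L\<^sup>2\<close> norm of the gradient of \<open>\<phi>\<close>.
\<close>

lemma loss_derivative_bound: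
  obtains h where "integrable lborel h" "\<And>s t. s \<le> t \<Longrightarrow> L (c t) - L (c s) = (LINT u:{s..t}|lborel. h u)"
    "AE t in lborel. ((\<lambda>r. L (c r)) has_real_derivative h t) (at t)"
    "AE t in lborel. \<bar>h t\<bar> \<le> G (c t) * metric_derivative c t"
proof (rule dominated_increments_derivative[of "\<lambda>u. loss_const * m u" "\<lambda>r. L (c r)"])
  show "\<bar>L (c t) - L (c s)\<bar> \<le> (LINT u:{s..t}|lborel. loss_const * m u)" if "s \<le> t" for s t
    using loss_increment[OF that] by simp
next
  fix h
  assume h: "integrable lborel h" "\<And>s t. s \<le> t \<Longrightarrow> L (c t) - L (c s) = (LINT u:{s..t}|lborel. h u)"
    "AE t in lborel. ((\<lambda>r. L (c r)) has_real_derivative h t) (at t)"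
  from h(3) prediction_differentiable metric_derivative_exists
  have "AE t in lborel. \<bar>h t\<bar> \<le> G (c t) * metric_derivative c t"
  proof eventually_elim
    case (elim t)
    obtain p where p: "\<And>k. (prediction k has_real_derivative p k) (at t)" using elim(2) by metis
    define q where "q = (1 / real M) * (\<Sum>k=1..M. residual_weight (c t) k * p k)"
    have "((\<lambda>r. loss (prediction k r - y k)) has_real_derivative residual_weight (c t) k * p k) (at t)" for k
      unfolding residual_weight_def prediction_def[symmetric]
      by (rule DERIV_chain2[OF loss_deriv]) (auto intro!: derivative_eq_intros p)
    then have "((\<lambda>r. L (c r)) has_real_derivative q) (at t)"
      unfolding loss_eq q_def by (intro DERIV_cmult DERIV_sum)
    then have "h t = q" using elim(1) DERIV_unique by blast
    have "(LINT \<theta>|c s. linear_derivative \<sigma> loss M x y (c t) \<theta>)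
        = (1 / real M) * (\<Sum>k=1..M. residual_weight (c t) k * prediction k s)" for s
      unfolding linear_derivative_eq prediction_def network_eq
      using test_function.integrable[OF test_function_neuron P2] by simp
    moreover have "((\<lambda>s. (1 / real M) * (\<Sum>k=1..M. residual_weight (c t) k * prediction k s)) has_real_derivative q) (at t)"
      unfolding q_def by (intro DERIV_cmult DERIV_sum p)
    ultimately have "((\<lambda>s. LINT \<theta>|c s. linear_derivative \<sigma> loss M x y (c t) \<theta>) has_real_derivative q) (at t)"
      by simp
    from test_function.derivative_along_curve_le[OF test_function_linear_derivative P2 _ this] elim(3)
    show ?case unfolding \<open>h t = q\<close> upper_gradient_eq by blast
  qed
  with h that show thesis by blast
qed (use m loss_const_nonneg in auto)

end

section \<open>Following a curve, then a displacement interpolation\<close>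

text \<open>
  Displacement interpolation: each unit of mass moves at constant speed from its source to its target under \<open>\<pi>\<close>.
\<close>

definition displacement :: "('a::euclidean_space \<times> 'a) measure \<Rightarrow> real \<Rightarrow> 'a measure" where
  "displacement \<pi> s = distr \<pi> borel (\<lambda>p. (1 - s) *\<^sub>R fst p + s *\<^sub>R snd p)"

lemma displacement_endpoints:
  assumes "\<pi> \<in> couplings \<mu> \<nu>"
  shows "displacement \<pi> 0 = \<mu>" "displacement \<pi> 1 = \<nu>"
  using couplingsD[OF assms] by (simp_all add: displacement_def)

context
  fixes \<pi> :: "('a::euclidean_space \<times> 'a) measure" and \<mu> \<nu>
  assumes \<pi>: "\<pi> \<in> couplings \<mu> \<nu>" and \<mu>: "\<mu> \<in> P2" and \<nu>: "\<nu> \<in> P2"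
begin

private lemma interpolation_measurable:
  "(\<lambda>p. (1 - s) *\<^sub>R fst p + s *\<^sub>R snd p) \<in> \<pi> \<rightarrow>\<^sub>M borel"
  using coupling_measurable[OF \<pi>] by measurable

lemma displacement_P2: "displacement \<pi> s \<in> P2"
proof -
  note [measurable] = coupling_measurable[OF \<pi>]
  interpret \<pi>: prob_space \<pi> by (rule coupling_prob_space[OF \<pi> P2D(1)[OF \<mu>]])
  have "integrable \<pi> (\<lambda>p. (norm ((1 - s) *\<^sub>R fst p + s *\<^sub>R snd p))\<^sup>2)"
  proof (rule L2_norm_triangle(1))
    show "integrable \<pi> (\<lambda>p. (\<bar>1 - s\<bar> * norm (fst p))\<^sup>2)" "integrable \<pi> (\<lambda>p. (\<bar>s\<bar> * norm (snd p))\<^sup>2)"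
      using coupling_integral(3,4)[OF \<pi>, of "\<lambda>x. (norm x)\<^sup>2"] P2D(3)[OF \<mu>] P2D(3)[OF \<nu>]
      by (simp_all add: power_mult_distrib)
    show "AE p in \<pi>. \<bar>norm ((1 - s) *\<^sub>R fst p + s *\<^sub>R snd p)\<bar> \<le> \<bar>1 - s\<bar> * norm (fst p) + \<bar>s\<bar> * norm (snd p)"
      by (intro AE_I2 order_trans[OF eq_refl norm_triangle_le[OF eq_refl]]) auto
  qed measurable
  then show ?thesis
    using \<pi>.prob_space_distr[OF interpolation_measurable]
    by (simp add: P2_def displacement_def integrable_distr_eq[OF interpolation_measurable])
qed

text \<open>
  The positions at times \<open>s\<close> and \<open>t\<close> are coupled through the common pair of source and target.
\<close>

lemma W2_displacement: "W2 (displacement \<pi> s) (displacement \<pi> t) \<le> \<bar>t - s\<bar> * sqrt (transport_cost \<pi>)"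
proof -
  note [measurable] = coupling_measurable[OF \<pi>] interpolation_measurable
  define \<gamma> where "\<gamma> = distr \<pi> borel (\<lambda>p. ((1 - s) *\<^sub>R fst p + s *\<^sub>R snd p, (1 - t) *\<^sub>R fst p + t *\<^sub>R snd p))"
  have pair [measurable]: "(\<lambda>p. ((1 - s) *\<^sub>R fst p + s *\<^sub>R snd p, (1 - t) *\<^sub>R fst p + t *\<^sub>R snd p)) \<in> \<pi> \<rightarrow>\<^sub>M borel"
    unfolding borel_prod[symmetric] by measurable
  have "\<gamma> \<in> couplings (displacement \<pi> s) (displacement \<pi> t)"
    unfolding couplings_def \<gamma>_def displacement_def by (simp add: distr_distr comp_def)
  moreover have "transport_cost \<gamma> = (t - s)\<^sup>2 * transport_cost \<pi>"
  proof -
    have "dist ((1 - s) *\<^sub>R a + s *\<^sub>R b) ((1 - t) *\<^sub>R a + t *\<^sub>R b) = \<bar>t - s\<bar> * dist a b" for a b :: 'a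
    proof -
      have "((1 - s) *\<^sub>R a + s *\<^sub>R b) - ((1 - t) *\<^sub>R a + t *\<^sub>R b) = (t - s) *\<^sub>R (a - b)"
        by (simp add: algebra_simps)
      then show ?thesis by (simp add: dist_norm)
    qed
    then show ?thesis
      unfolding transport_cost_def \<gamma>_def by (simp add: integral_distr power_mult_distrib)
  qed
  ultimately show ?thesis using W2_le_cost[of \<gamma>] by (simp add: real_sqrt_mult)
qed

end

lemma has_metric_derivative_scale:
  assumes "has_metric_derivative c v (k * t)" "k > 0"
  shows "has_metric_derivative (\<lambda>s. c (k * s)) (k * v) t"
proof -
  have "filterlim (\<lambda>s. k * s) (at (k * t)) (at t)"
    using assms(2) by (intro filterlim_atI tendsto_intros) (auto simp: eventually_at_filter)
  from filterlim_compose[OF assms(1)[unfolded has_metric_derivative_def] this]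
  have "((\<lambda>s. k * (W2 (c (k * s)) (c (k * t)) / \<bar>k * s - k * t\<bar>)) \<longlongrightarrow> k * v) (at t)"
    by (intro tendsto_intros)
  also have "(\<lambda>s. k * (W2 (c (k * s)) (c (k * t)) / \<bar>k * s - k * t\<bar>)) = (\<lambda>s. W2 (c (k * s)) (c (k * t)) / \<bar>s - t\<bar>)"
    using assms(2) by (auto simp: right_diff_distrib[symmetric] abs_mult)
  finally show ?thesis unfolding has_metric_derivative_def .
qed

lemma set_integral_scale:
  fixes h :: "real \<Rightarrow> real"
  assumes "k > 0"
  shows "(LINT u:{a..b}|lborel. k * h (k * u)) = (LINT u:{k * a..k * b}|lborel. h u)"
proof -
  have "(LINT u:{k * a..k * b}|lborel. h u) = k * (LINT u|lborel. indicator {k * a..k * b} (k * u) * h (k * u))"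
    using lborel_integral_real_affine[of k "\<lambda>u. indicator {k * a..k * b} u * h u" 0] assms
    by (simp add: set_lebesgue_integral_def)
  also have "\<dots> = (LINT u:{a..b}|lborel. k * h (k * u))"
    unfolding set_lebesgue_integral_def integral_mult_right_zero[symmetric]
    using assms by (intro Bochner_Integration.integral_cong) (auto split: split_indicator)
  finally show ?thesis ..
qed

definition follow_then_interpolate ::
  "(real \<Rightarrow> 'a::euclidean_space measure) \<Rightarrow> real \<Rightarrow> ('a \<times> 'a) measure \<Rightarrow> real \<Rightarrow> 'a measure" where
  "follow_then_interpolate c T \<pi> t =
     (if t \<le> 1 / 2 then c (2 * T * t) else displacement \<pi> (2 * t - 1))"

text \<open>
  The sum of the speed bounds of the two pieces dominates both of them on all of \<open>[0, 1]\<close>. Increments across the junction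
  are split there by the triangle inequality.
\<close>

lemma follow_then_interpolate_AC2:
  assumes c: "AC2 {0..T} c" and T: "T > 0" and \<pi>: "\<pi> \<in> couplings (c T) \<nu>" and \<nu>: "\<nu> \<in> P2"
  shows "AC2 {0..1} (follow_then_interpolate c T \<pi>)"
proof -
  obtain m where "dominated_curve (\<lambda>t. c (clamp_real 0 T t)) m" and m2: "integrable lborel (\<lambda>u. (m u)\<^sup>2)"
    using AC2_extend[OF c] T by auto
  then interpret dominated_curve "\<lambda>t. c (clamp_real 0 T t)" m by simp
  have [measurable]: "m \<in> borel_measurable borel" using m(1) by auto
  define e where "e = follow_then_interpolate c T \<pi>"
  define \<kappa> where "\<kappa> = sqrt (transport_cost \<pi>)"
  have \<kappa>: "\<kappa> \<ge> 0" by (simp add: \<kappa>_def transport_cost_nonneg)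
  have cT: "c T \<in> P2" using P2[of T] T by simp
  note disp = displacement_P2[OF \<pi> cT \<nu>] W2_displacement[OF \<pi> cT \<nu>, folded \<kappa>_def]
  have e_P2: "e t \<in> P2" if "0 \<le> t" for t
  proof (cases "t \<le> 1 / 2")
    case True
    then have "clamp_real 0 T (2 * T * t) = 2 * T * t"
      using T that mult_left_mono[of "2 * t" 1 T] by (auto simp: max_def min_def)
    then show ?thesis using P2[of "2 * T * t"] True by (simp add: e_def follow_then_interpolate_def)
  qed (simp add: e_def follow_then_interpolate_def disp)
  define P where "P t = primitive m (2 * T * t) + 2 * \<kappa> * t" for t
  have prim_mono: "primitive m a \<le> primitive m b" if "a \<le> b" for a b
  proof -
    have "0 \<le> (LINT u:{a..b}|lborel. m u)"
      unfolding set_lebesgue_integral_def by (intro integral_nonneg_AE) (simp add: m(2))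
    then show ?thesis using primitive_diff[OF m(1) that] by simp
  qed
  have first: "W2 (e s) (e t) \<le> P t - P s" if "0 \<le> s" "s \<le> t" "t \<le> 1 / 2" for s t
  proof -
    have "clamp_real 0 T (2 * T * r) = 2 * T * r" if "0 \<le> r" "r \<le> 1 / 2" for r
      using T that mult_left_mono[of "2 * r" 1 T] by (auto simp: max_def min_def)
    then have "W2 (e s) (e t) \<le> \<bar>primitive m (2 * T * t) - primitive m (2 * T * s)\<bar>"
      using W2_le_primitive[of "2 * T * s" "2 * T * t"] that by (simp add: e_def follow_then_interpolate_def)
    also have "\<dots> = primitive m (2 * T * t) - primitive m (2 * T * s)"
      using prim_mono[of "2 * T * s" "2 * T * t"] that T by simp
    also have "\<dots> \<le> P t - P s"
      using mult_left_mono[OF that(2), of "2 * \<kappa>"] \<kappa> by (simp add: P_def)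
    finally show ?thesis .
  qed
  have half: "e (1 / 2) = displacement \<pi> 0"
    using displacement_endpoints[OF \<pi>] by (simp add: e_def follow_then_interpolate_def)
  have second: "W2 (e s) (e t) \<le> P t - P s" if "1 / 2 \<le> s" "s \<le> t" for s t
  proof -
    have e_disp: "e r = displacement \<pi> (2 * r - 1)" if "1 / 2 \<le> r" for r
    proof (cases "r = 1 / 2")
      case True
      show ?thesis unfolding True using half by simp
    qed (use that in \<open>simp add: e_def follow_then_interpolate_def\<close>)
    have "W2 (e s) (e t) \<le> \<bar>(2 * t - 1) - (2 * s - 1)\<bar> * \<kappa>"
      using that by (simp only: e_disp disp(2) order_trans[OF that])
    also have "\<dots> \<le> P t - P s"
      using prim_mono[of "2 * T * s" "2 * T * t"] that T by (simp add: P_def algebra_simps)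
    finally show ?thesis .
  qed
  have P: "W2 (e s) (e t) \<le> P t - P s" if "0 \<le> s" "s \<le> t" for s t
  proof -
    consider "t \<le> 1 / 2" | "1 / 2 \<le> s" | "s \<le> 1 / 2" "1 / 2 \<le> t" by linarith
    then show ?thesis
    proof cases
      case 3
      then show ?thesis
        using W2_triangle[OF e_P2 e_P2 e_P2, of s "1 / 2" t] first[of s "1 / 2"] second[of "1 / 2" t] that
        by simp
    qed (use that first second in auto)
  qed
  define n where "n u = 2 * T * m (2 * T * u) + 2 * \<kappa>" for u
  have n_int: "set_integrable lborel {s..t} (\<lambda>u. 2 * T * m (2 * T * u))" "set_integrable lborel {s..t} (\<lambda>u. 2 * \<kappa>)" for s t
  proof -
    have "integrable lborel (\<lambda>u. 2 * T * m (2 * T * u))"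
      using lborel_integrable_real_affine[OF m(1), of "2 * T" 0] T by simp
    then show "set_integrable lborel {s..t} (\<lambda>u. 2 * T * m (2 * T * u))" by (rule integrable_set_borel) simp
    show "set_integrable lborel {s..t} (\<lambda>u. 2 * \<kappa>)"
      by (rule borel_integrable_atLeastAtMost') simp
  qed
  have n: "(LINT u:{s..t}|lborel. n u) = P t - P s" if "s \<le> t" for s t
  proof -
    have "(LINT u:{s..t}|lborel. n u) = (LINT u:{s..t}|lborel. 2 * T * m (2 * T * u)) + (LINT u:{s..t}|lborel. 2 * \<kappa>)"
      unfolding n_def using n_int by (rule set_integral_add)
    also have "(LINT u:{s..t}|lborel. 2 * T * m (2 * T * u)) = primitive m (2 * T * t) - primitive m (2 * T * s)"
      using set_integral_scale[of "2 * T" s t m] primitive_diff[OF m(1), of "2 * T * s" "2 * T * t"] T that by simp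
    also have "(LINT u:{s..t}|lborel. 2 * \<kappa>) = 2 * \<kappa> * (t - s)"
      using that by (simp add: set_lebesgue_integral_def)
    finally show ?thesis by (simp add: P_def algebra_simps)
  qed
  have n2: "set_integrable lborel {0..1} (\<lambda>u. (n u)\<^sup>2)"
  proof -
    have "integrable lborel (\<lambda>u. (indicator {0..1} u * n u)\<^sup>2)"
    proof (rule L2_norm_triangle(1))
      show "integrable lborel (\<lambda>u. (2 * T * m (2 * T * u))\<^sup>2)"
        using lborel_integrable_real_affine[OF m2, of "2 * T" 0] T by (simp add: power_mult_distrib)
      have sq: "(\<lambda>u::real. (indicator {0..1} u * (2 * \<kappa>))\<^sup>2) = (\<lambda>u. indicator {0..1} u * (2 * \<kappa>)\<^sup>2)"
        by (auto split: split_indicator)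
      show "integrable lborel (\<lambda>u::real. (indicator {0..1} u * (2 * \<kappa>))\<^sup>2)"
        unfolding sq by (intro integrable_mult_left integrable_real_indicator) auto
      show "AE u in lborel. \<bar>indicator {0..1} u * n u\<bar> \<le> 2 * T * m (2 * T * u) + indicator {0..1} u * (2 * \<kappa>)"
        using m(2) \<kappa> T by (auto simp: n_def split: split_indicator)
    qed (simp add: n_def)
    moreover have "(\<lambda>u. (indicator {0..1} u * n u)\<^sup>2) = (\<lambda>u. indicator {0..1} u *\<^sub>R (n u)\<^sup>2)"
      by (auto split: split_indicator)
    ultimately show ?thesis unfolding set_integrable_def by (simp only:)
  qed
  show ?thesis
    unfolding AC2_def e_def[symmetric]
  proof (intro conjI exI[of _ n] ballI impI)
    show "set_borel_measurable lborel {0..1} n" unfolding n_def set_borel_measurable_def by simp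
    show "W2 (e s) (e t) \<le> (LINT u:{s..t}|lborel. n u)" if "s \<in> {0..1}" "t \<in> {0..1}" "s \<le> t" for s t
      using P[of s t] n[of s t] that by simp
  qed (use e_P2 n2 in auto)
qed

section \<open>Bounds on the Finsler distance\<close>

context network_loss
begin

lemma loss_along_AC2:
  assumes c: "AC2 {a..b} c" and ab: "a \<le> b"
  obtains h where "integrable lborel h"
    "\<And>s t. a \<le> s \<Longrightarrow> s \<le> t \<Longrightarrow> t \<le> b \<Longrightarrow> L (c t) - L (c s) = (LINT u:{s..t}|lborel. h u)"
    "AE t in lborel. a < t \<and> t < b \<longrightarrow> ((\<lambda>r. L (c r)) has_real_derivative h t) (at t) \<and>
      has_metric_derivative c (metric_derivative c t) t \<and> 0 \<le> metric_derivative c t \<and>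
      \<bar>h t\<bar> \<le> metric_derivative c t * G (c t)"
proof -
  obtain m where "dominated_curve (\<lambda>t. c (clamp_real a b t)) m"
    using AC2_extend[OF c ab] by blast
  then interpret dominated_curve "\<lambda>t. c (clamp_real a b t)" m .
  interpret loss_along_curve \<sigma> loss M x y S0 \<beta> "\<lambda>t. c (clamp_real a b t)" m ..
  show thesis
  proof (rule loss_derivative_bound)
    fix h
    assume h: "integrable lborel h"
      "\<And>s t. s \<le> t \<Longrightarrow> L (c (clamp_real a b t)) - L (c (clamp_real a b s)) = (LINT u:{s..t}|lborel. h u)"
      "AE t in lborel. ((\<lambda>r. L (c (clamp_real a b r))) has_real_derivative h t) (at t)"
      "AE t in lborel. \<bar>h t\<bar> \<le> G (c (clamp_real a b t)) * metric_derivative (\<lambda>t. c (clamp_real a b t)) t"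
    show thesis
    proof (rule that[OF h(1)])
      show "L (c t) - L (c s) = (LINT u:{s..t}|lborel. h u)" if "a \<le> s" "s \<le> t" "t \<le> b" for s t
        using h(2)[OF that(2)] that by simp
      show "AE t in lborel. a < t \<and> t < b \<longrightarrow> ((\<lambda>r. L (c r)) has_real_derivative h t) (at t) \<and>
        has_metric_derivative c (metric_derivative c t) t \<and> 0 \<le> metric_derivative c t \<and>
        \<bar>h t\<bar> \<le> metric_derivative c t * G (c t)"
        using h(3,4) metric_derivative_exists
      proof (eventually_elim, intro impI, elim conjE)
        fix t assume t: "a < t" "t < b"
          and 1: "((\<lambda>r. L (c (clamp_real a b r))) has_real_derivative h t) (at t)"
          and 2: "\<bar>h t\<bar> \<le> G (c (clamp_real a b t)) * metric_derivative (\<lambda>t. c (clamp_real a b t)) t"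
          and 3: "has_metric_derivative (\<lambda>t. c (clamp_real a b t)) (metric_derivative (\<lambda>t. c (clamp_real a b t)) t) t"
            "0 \<le> metric_derivative (\<lambda>t. c (clamp_real a b t)) t"
        have md: "has_metric_derivative c (metric_derivative (\<lambda>t. c (clamp_real a b t)) t) t"
          using 3(1) by (simp only: has_metric_derivative_clamp[OF t])
        have "((\<lambda>r. L (c r)) has_real_derivative h t) (at t)"
          using 1 by (rule has_field_derivative_transform_within_open[of _ _ _ "{a<..<b}"]) (use t in auto)
        with md 2 3(2) t has_metric_derivative_unique[OF md]
        show "((\<lambda>r. L (c r)) has_real_derivative h t) (at t) \<and>
          has_metric_derivative c (metric_derivative c t) t \<and> 0 \<le> metric_derivative c t \<and>
          \<bar>h t\<bar> \<le> metric_derivative c t * G (c t)"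
          by (simp add: mult.commute)
      qed
    qed
  qed
qed

text \<open>
  A curve cannot lose more than \<open>\<integral>\<bar>(L \<circ> c)'\<bar>\<close>. Comparing integrands with the measurable function
  \<open>\<bar>(L \<circ> c)'\<bar>\<close> almost everywhere bounds the integral from below without discussing the measurability of
  \<open>t \<mapsto> G (c t)\<close>.
\<close>

lemma loss_drop_le_finsler_dist: "ennreal (L \<mu> - L \<nu>) \<le> finsler_dist G \<mu> \<nu>"
  unfolding finsler_dist_def
proof (rule INF_greatest, clarify)
  fix c :: "real \<Rightarrow> 'd param measure"
  assume c: "AC2 {0..1} c"
  obtain h where h: "integrable lborel h"
    "\<And>s t. 0 \<le> s \<Longrightarrow> s \<le> t \<Longrightarrow> t \<le> 1 \<Longrightarrow> L (c t) - L (c s) = (LINT u:{s..t}|lborel. h u)"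
    "AE t in lborel. 0 < t \<and> t < 1 \<longrightarrow> ((\<lambda>r. L (c r)) has_real_derivative h t) (at t) \<and>
      has_metric_derivative c (metric_derivative c t) t \<and> 0 \<le> metric_derivative c t \<and>
      \<bar>h t\<bar> \<le> metric_derivative c t * G (c t)"
    using loss_along_AC2[OF c] by auto
  have int: "integrable lborel (\<lambda>u. indicator {0..1} u * h u)"
    using integrable_set_borel[OF h(1), of "{0..1}"] by (simp add: set_integrable_def)
  have "L (c 0) - L (c 1) = - (LINT u|lborel. indicator {0..1} u * h u)"
    using h(2)[of 0 1] by (simp add: set_lebesgue_integral_def)
  also have "\<dots> \<le> (LINT u|lborel. \<bar>indicator {0..1} u * h u\<bar>)"
    using integral_abs_bound[of lborel "\<lambda>u. indicator {0..1} u * h u"] by linarith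
  finally have "ennreal (L (c 0) - L (c 1)) \<le> ennreal (LINT u|lborel. \<bar>indicator {0..1} u * h u\<bar>)"
    by (rule ennreal_leI)
  also have "\<dots> = (\<integral>\<^sup>+u. ennreal \<bar>indicator {0..1} u * h u\<bar> \<partial>lborel)"
    by (rule nn_integral_eq_integral[symmetric]) (use int in auto)
  also have "\<dots> \<le> (\<integral>\<^sup>+t. ennreal (metric_derivative c t * G (c t)) * indicator {0..1} t \<partial>lborel)"
  proof (rule nn_integral_mono_AE)
    show "AE u in lborel. ennreal \<bar>indicator {0..1} u * h u\<bar> \<le> ennreal (metric_derivative c u * G (c u)) * indicator {0..1} u"
      using h(3) AE_lborel_singleton[of 0] AE_lborel_singleton[of 1]
      by eventually_elim (auto split: split_indicator intro!: ennreal_leI)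
  qed
  finally show "ennreal (L (c 0) - L (c 1)) \<le> (\<integral>\<^sup>+t\<in>{0..1}. ennreal (metric_derivative c t * G (c t)) \<partial>lborel)" .
qed

text \<open>
  On the first half, the flow equations say that the integrand of the \<open>G\<close>-length equals \<open>-(L \<circ> e)'\<close>, so
  this half costs exactly the loss drop \<open>L (c 0) - L (c T)\<close>. On the second half the speed is at most \<open>2 \<kappa>\<close> and
  \<open>G \<le> B\<close>; the estimate spends \<open>2 \<kappa> B\<close>, as if this held during the whole unit of time.
\<close>

lemma finsler_dist_flow_le:
  assumes c: "AC2 {0..T} c" and T: "T > 0" and \<nu>: "\<nu> \<in> P2"
    and flow: "AE t in lborel. t > 0 \<longrightarrow> (\<exists>v. has_metric_derivative c v t \<and>
       ((\<lambda>r. L (c r)) has_real_derivative - (v\<^sup>2)) (at t) \<and> v\<^sup>2 = (G (c t))\<^sup>2)"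
    and \<pi>: "\<pi> \<in> couplings (c T) \<nu>" and \<kappa>: "sqrt (transport_cost \<pi>) \<le> \<kappa>"
    and B: "\<And>\<rho>. \<rho> \<in> P2 \<Longrightarrow> rms \<rho> \<le> rms \<nu> + \<kappa> \<Longrightarrow> G \<rho> \<le> B"
  shows "finsler_dist G (c 0) \<nu> \<le> ennreal (L (c 0) - L (c T) + 2 * \<kappa> * B)"
proof -
  define e where "e = follow_then_interpolate c T \<pi>"
  have cT: "c T \<in> P2" using c T by (auto simp: AC2_def)
  note disp = displacement_P2[OF \<pi> cT \<nu>] W2_displacement[OF \<pi> cT \<nu>] displacement_endpoints[OF \<pi>]
  have e: "AC2 {0..1} e"
    unfolding e_def by (rule follow_then_interpolate_AC2[OF c T \<pi> \<nu>])
  have e_ends: "e 0 = c 0" "e (1 / 2) = c T" "e 1 = \<nu>"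
    using disp by (simp_all add: e_def follow_then_interpolate_def)
  have \<kappa>0: "\<kappa> \<ge> 0" using \<kappa> real_sqrt_ge_zero[OF transport_cost_nonneg[of \<pi>]] by linarith
  have B0: "B \<ge> 0"
    using B[OF \<nu>] \<kappa>0 upper_gradient_nonneg[of \<nu>] by simp
  obtain h where h: "integrable lborel h"
    "\<And>s t. 0 \<le> s \<Longrightarrow> s \<le> t \<Longrightarrow> t \<le> 1 \<Longrightarrow> L (e t) - L (e s) = (LINT u:{s..t}|lborel. h u)"
    "AE t in lborel. 0 < t \<and> t < 1 \<longrightarrow> ((\<lambda>r. L (e r)) has_real_derivative h t) (at t) \<and>
      has_metric_derivative e (metric_derivative e t) t \<and> 0 \<le> metric_derivative e t \<and>
      \<bar>h t\<bar> \<le> metric_derivative e t * G (e t)"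
    using loss_along_AC2[OF e] by auto
  have flow_part: "metric_derivative e t * G (e t) = - h t"
    if t: "0 < t" "t < 1 / 2" and v: "has_metric_derivative c v (2 * T * t)"
      "((\<lambda>r. L (c r)) has_real_derivative - (v\<^sup>2)) (at (2 * T * t))" "v\<^sup>2 = (G (c (2 * T * t)))\<^sup>2"
      and ht: "((\<lambda>r. L (e r)) has_real_derivative h t) (at t)" and md: "0 \<le> metric_derivative e t"
    for t v
  proof -
    have T2: "2 * T > 0" using T by simp
    have near: "e s = c (2 * T * s)" if "s \<in> {..<1 / 2}" for s
      using that by (simp add: e_def follow_then_interpolate_def)
    have "has_metric_derivative e (2 * T * v) t"
      using has_metric_derivative_scale[OF v(1) T2] has_metric_derivative_cong[of "{..<1 / 2}" t e "\<lambda>s. c (2 * T * s)"] near t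
      by simp
    then have md_eq: "metric_derivative e t = 2 * T * v" by (rule has_metric_derivative_unique)
    then have "v \<ge> 0" using md T2 by (simp add: zero_le_mult_iff)
    then have G: "G (e t) = v"
      using v(3) upper_gradient_nonneg near[of t] t by (simp add: power2_eq_iff_nonneg)
    have "((\<lambda>r. L (c (2 * T * r))) has_real_derivative - (v\<^sup>2) * (2 * T)) (at t)"
      using v(2) by (rule DERIV_chain2) (auto intro!: derivative_eq_intros)
    then have "((\<lambda>r. L (e r)) has_real_derivative - (v\<^sup>2) * (2 * T)) (at t)"
      by (rule has_field_derivative_transform_within_open[of _ _ _ "{..<1 / 2}"]) (use t near in auto)
    then have "h t = - (v\<^sup>2) * (2 * T)" by (rule DERIV_unique[OF ht])
    then show ?thesis by (simp add: md_eq G power2_eq_square)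
  qed
  have interpolation_part: "metric_derivative e t * G (e t) \<le> 2 * \<kappa> * B"
    if t: "1 / 2 < t" "t < 1" and md: "has_metric_derivative e (metric_derivative e t) t" for t
  proof -
    have near: "e s = displacement \<pi> (2 * s - 1)" if "s \<in> {1 / 2<..}" for s
      using that by (simp add: e_def follow_then_interpolate_def)
    have "\<forall>\<^sub>F s in at t. s \<in> {1 / 2<..}"
      by (rule eventually_at_in_open') (use t in auto)
    then have "\<forall>\<^sub>F s in at t. W2 (e s) (e t) / \<bar>s - t\<bar> \<le> 2 * \<kappa>"
      using eventually_neq_at_within[of t t UNIV]
    proof eventually_elim
      case (elim s)
      have "W2 (e s) (e t) \<le> \<bar>(2 * t - 1) - (2 * s - 1)\<bar> * sqrt (transport_cost \<pi>)"
        using disp(2)[of "2 * s - 1" "2 * t - 1"] near[of s] near[of t] elim t by simp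
      also have "\<dots> \<le> \<bar>(2 * t - 1) - (2 * s - 1)\<bar> * \<kappa>"
        using \<kappa> by (intro mult_left_mono) auto
      also have "\<dots> = 2 * \<kappa> * \<bar>s - t\<bar>"
      proof -
        have "\<bar>(2 * t - 1) - (2 * s - 1)\<bar> = 2 * \<bar>s - t\<bar>" by (auto simp: abs_if)
        then show ?thesis by simp
      qed
      finally show ?case using elim by (simp add: pos_divide_le_eq)
    qed
    then have "metric_derivative e t \<le> 2 * \<kappa>"
      by (intro tendsto_upperbound[OF md[unfolded has_metric_derivative_def]]) auto
    moreover have "G (e t) \<le> B"
    proof (rule B)
      show "e t \<in> P2" using near[of t] t disp(1) by simp
      have "W2 \<nu> (e t) \<le> \<bar>(2 * t - 1) - 1\<bar> * sqrt (transport_cost \<pi>)"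
        using disp(2)[of 1 "2 * t - 1"] near[of t] t by (simp add: disp)
      also have "\<dots> \<le> 1 * \<kappa>"
        using t \<kappa> transport_cost_nonneg[of \<pi>] by (intro mult_mono) auto
      finally show "rms (e t) \<le> rms \<nu> + \<kappa>"
        using rms_le[OF \<nu> \<open>e t \<in> P2\<close>] by simp
    qed
    ultimately show ?thesis
      using \<kappa>0 B0 upper_gradient_nonneg[of "e t"] by (intro mult_mono) auto
  qed
  define b where "b t = indicator {0..1 / 2} t * (- h t) + indicator {0..1} t * (2 * \<kappa> * B)" for t
  have half: "integrable lborel (\<lambda>t. indicator {0..1 / 2} t * (- h t))"
    using integrable_set_borel[OF h(1), of "{0..1 / 2}"] by (simp add: set_integrable_def)
  have one: "integrable lborel (\<lambda>t::real. indicator {0..1} t * (2 * \<kappa> * B))"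
    by simp
  have bound: "AE t in lborel. ennreal (metric_derivative e t * G (e t)) * indicator {0..1} t \<le> ennreal (b t) \<and> 0 \<le> b t"
  proof -
    have "AE t in lborel. 2 * T * t > 0 \<longrightarrow> (\<exists>v. has_metric_derivative c v (2 * T * t) \<and>
       ((\<lambda>r. L (c r)) has_real_derivative - (v\<^sup>2)) (at (2 * T * t)) \<and> v\<^sup>2 = (G (c (2 * T * t)))\<^sup>2)"
      using AE_lborel_affine[OF flow, of "2 * T" 0] T by simp
    with h(3) AE_lborel_singleton[of 0] AE_lborel_singleton[of "1 / 2"] AE_lborel_singleton[of 1]
    show ?thesis
    proof eventually_elim
      case (elim t)
      have \<kappa>B: "0 \<le> 2 * \<kappa> * B" using \<kappa>0 B0 by simp
      consider "0 < t" "t < 1 / 2" | "1 / 2 < t" "t < 1" | "t < 0 \<or> 1 < t"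
        using elim by linarith
      then show ?case
      proof cases
        case 1
        then have "2 * T * t > 0" using T by simp
        then obtain v where "has_metric_derivative c v (2 * T * t)"
          "((\<lambda>r. L (c r)) has_real_derivative - (v\<^sup>2)) (at (2 * T * t))" "v\<^sup>2 = (G (c (2 * T * t)))\<^sup>2"
          using elim(5) by blast
        then have eq: "metric_derivative e t * G (e t) = - h t"
          using flow_part[OF 1] elim(1) 1 by simp
        moreover have "0 \<le> metric_derivative e t * G (e t)"
          using elim(1) 1 upper_gradient_nonneg[of "e t"] by simp
        moreover have "b t = - h t + 2 * \<kappa> * B" using 1 by (simp add: b_def)
        ultimately have "metric_derivative e t * G (e t) \<le> b t" "0 \<le> b t"
          using \<kappa>B by linarith+
        then show ?thesis using 1 ennreal_leI[of "metric_derivative e t * G (e t)" "b t"] by simp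
      next
        case 2
        then have "b t = 2 * \<kappa> * B" by (simp add: b_def)
        moreover have "metric_derivative e t * G (e t) \<le> 2 * \<kappa> * B"
          using interpolation_part[OF 2] elim(1) 2 by simp
        ultimately show ?thesis
          using 2 \<kappa>B ennreal_leI[of "metric_derivative e t * G (e t)" "b t"] by simp
      qed (auto simp: b_def)
    qed
  qed
  have "finsler_dist G (c 0) \<nu> \<le> (\<integral>\<^sup>+t\<in>{0..1}. ennreal (metric_derivative e t * G (e t)) \<partial>lborel)"
    unfolding finsler_dist_def by (rule INF_lower) (use e e_ends in auto)
  also have "\<dots> \<le> (\<integral>\<^sup>+t. ennreal (b t) \<partial>lborel)"
    using bound by (intro nn_integral_mono_AE) (auto elim!: eventually_mono)
  also have "\<dots> = ennreal (LINT t|lborel. b t)"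
    using bound half one unfolding b_def
    by (intro nn_integral_eq_integral Bochner_Integration.integrable_add) (auto elim!: eventually_mono)
  also have "(LINT t|lborel. b t) = - (LINT t:{0..1 / 2}|lborel. h t) + 2 * \<kappa> * B"
    unfolding b_def Bochner_Integration.integral_add[OF half one] by (simp add: set_lebesgue_integral_def)
  also have "- (LINT t:{0..1 / 2}|lborel. h t) = L (c 0) - L (c T)"
    using h(2)[of 0 "1 / 2"] by (simp add: e_ends)
  finally show ?thesis .
qed

text \<open>
  Choose \<open>T\<close> so large that the interpolation to the limit costs at most \<open>\<epsilon>\<close>. The bound \<open>B\<close> on \<open>G\<close> near the limit is chosen first, as it
  does not depend on \<open>T\<close>.
\<close>

lemma finsler_dist_flow_limit_le:
  assumes loss_nonneg: "\<And>r. loss r \<ge> 0"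
    and \<nu>: "\<nu> \<in> P2" and flow: "gradient_flow L G \<mu> c" and lim: "((\<lambda>T. W2 (c T) \<nu>) \<longlongrightarrow> 0) at_top"
  shows "finsler_dist G \<mu> \<nu> \<le> ennreal (L \<mu>)"
proof (rule ennreal_le_epsilon)
  fix \<epsilon> :: real assume \<epsilon>: "0 < \<epsilon>"
  have L_nonneg: "L \<rho> \<ge> 0" for \<rho>
    unfolding emp_loss_def by (intro mult_nonneg_nonneg sum_nonneg loss_nonneg) simp
  obtain B' where B': "\<And>\<rho>. \<rho> \<in> P2 \<Longrightarrow> rms \<rho> \<le> rms \<nu> + 1 \<Longrightarrow> G \<rho> \<le> B'"
    using upper_gradient_bounded by meson
  define B where "B = max B' 1"
  define \<kappa> where "\<kappa> = min 1 (\<epsilon> / (2 * B))"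
  have B1: "B \<ge> 1" and B: "\<And>\<rho>. \<rho> \<in> P2 \<Longrightarrow> rms \<rho> \<le> rms \<nu> + 1 \<Longrightarrow> G \<rho> \<le> B"
    using B' by (auto simp: B_def le_max_iff_disj)
  have \<kappa>: "0 < \<kappa>" "\<kappa> \<le> 1" "2 * \<kappa> * B \<le> \<epsilon>"
    using \<epsilon> B1 by (auto simp: \<kappa>_def min_def field_simps)
  have "\<forall>\<^sub>F T in at_top. W2 (c T) \<nu> < \<kappa> \<and> T > 0"
    using order_tendstoD(2)[OF lim \<kappa>(1)] eventually_gt_at_top[of 0] by eventually_elim simp
  then obtain T where T: "W2 (c T) \<nu> < \<kappa>" "T > 0"
    using eventually_happens'[OF trivial_limit_at_top_linorder] by blast
  have c: "AC2 {0..T} c" using flow T(2) by (auto simp: gradient_flow_def AC2_loc_def)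
  then have cT: "c T \<in> P2" using T(2) by (auto simp: AC2_def)
  obtain \<pi> where \<pi>: "\<pi> \<in> couplings (c T) \<nu>" "sqrt (transport_cost \<pi>) < \<kappa>"
    using near_optimal_coupling[OF cT \<nu> T(1)] .
  have "finsler_dist G (c 0) \<nu> \<le> ennreal (L (c 0) - L (c T) + 2 * \<kappa> * B)"
  proof (rule finsler_dist_flow_le[OF c T(2) \<nu> _ \<pi>(1)])
    show "AE t in lborel. t > 0 \<longrightarrow> (\<exists>v. has_metric_derivative c v t \<and>
       ((\<lambda>r. L (c r)) has_real_derivative - (v\<^sup>2)) (at t) \<and> v\<^sup>2 = (G (c t))\<^sup>2)"
      using flow by (simp add: gradient_flow_def)
    show "G \<rho> \<le> B" if "\<rho> \<in> P2" "rms \<rho> \<le> rms \<nu> + \<kappa>" for \<rho>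
      using B[OF that(1)] that(2) \<kappa>(2) by simp
  qed (use \<pi> in simp)
  also have "\<dots> \<le> ennreal (L (c 0) + \<epsilon>)"
    using L_nonneg[of "c T"] \<kappa>(3) by (intro ennreal_leI) simp
  also have "\<dots> = ennreal (L \<mu>) + ennreal \<epsilon>"
    using L_nonneg[of \<mu>] \<epsilon> flow by (simp add: gradient_flow_def ennreal_plus)
  finally show "finsler_dist G \<mu> \<nu> \<le> ennreal (L \<mu>) + ennreal \<epsilon>"
    using flow by (simp add: gradient_flow_def)
qed

end

theorem theorem4p8:
  fixes \<sigma> loss :: "real \<Rightarrow> real"
    and M :: nat
    and x :: "nat \<Rightarrow> real ^ 'd::finite"
    and y :: "nat \<Rightarrow> real"
    and S0 R \<beta> :: real
    and \<mu> \<mu>_lim :: "'d param measure"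
    and c :: "real \<Rightarrow> 'd param measure"
  assumes M: "M \<ge> 1"
    and min_L: "\<exists>\<nu>. is_arg_min (emp_loss \<sigma> loss M x y) (\<lambda>\<nu>. \<nu> \<in> P2) \<nu> \<and> emp_loss \<sigma> loss M x y \<nu> = 0"
    and S0: "S0 \<ge> 0"
    and \<sigma>_lipschitz: "\<And>z z'. \<bar>\<sigma> z - \<sigma> z'\<bar> \<le> S0 * \<bar>z - z'\<bar>"
    and \<sigma>_bounded: "\<And>z. \<bar>\<sigma> z\<bar> \<le> S0"
    and \<sigma>_differentiable: "\<And>z. \<sigma> field_differentiable (at z)"
    and \<sigma>_deriv_bounded: "\<And>z. \<bar>deriv \<sigma> z\<bar> \<le> S0"
    and R: "R = Max ((\<lambda>k. norm (x k)) ` {1..M})"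
    and loss_nonneg: "\<And>r. loss r \<ge> 0"
    and loss_C1: "loss C1_differentiable_on UNIV"
    and loss_convex: "convex_on UNIV loss"
    and \<beta>: "\<beta> > 0"
    and loss_deriv_lipschitz: "\<And>r s. \<bar>deriv loss r - deriv loss s\<bar> \<le> \<beta> * \<bar>r - s\<bar>"
    and min_loss: "\<exists>r. is_arg_min loss (\<lambda>_. True) r \<and> loss r = 0"
    and \<mu>: "\<mu> \<in> P2"
    and flow: "gradient_flow (emp_loss \<sigma> loss M x y) (upper_gradient \<sigma> loss M x y) \<mu> c"
    and limit: "((\<lambda>T. W2 (c T) \<mu>_lim) \<longlongrightarrow> 0) at_top"
    and limit_min: "is_arg_min (emp_loss \<sigma> loss M x y) (\<lambda>\<nu>. \<nu> \<in> P2) \<mu>_lim"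
  shows "is_arg_min (finsler_dist (upper_gradient \<sigma> loss M x y) \<mu>)
           (\<lambda>\<nu>. is_arg_min (emp_loss \<sigma> loss M x y) (\<lambda>\<rho>. \<rho> \<in> P2) \<nu>) \<mu>_lim"
proof -
  interpret network_loss \<sigma> loss M x y S0 \<beta>
  proof
    show "loss field_differentiable (at r)" for r
      using loss_C1
      by (auto simp: C1_differentiable_on_def field_differentiable_def has_real_derivative_iff_has_vector_derivative)
  qed (use S0 \<sigma>_lipschitz \<sigma>_bounded \<sigma>_differentiable \<beta> loss_deriv_lipschitz in auto)
  have L_nonneg: "L \<nu> \<ge> 0" for \<nu>
    unfolding emp_loss_def by (intro mult_nonneg_nonneg sum_nonneg loss_nonneg) simp
  have minimal: "L \<nu> = 0" if "is_arg_min L (\<lambda>\<rho>. \<rho> \<in> P2) \<nu>" for \<nu>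
    using that min_L L_nonneg[of \<nu>] unfolding is_arg_min_def by force
  have \<mu>_lim: "\<mu>_lim \<in> P2" using limit_min by (simp add: is_arg_min_def)
  have upper: "finsler_dist G \<mu> \<mu>_lim \<le> ennreal (L \<mu>)"
    by (rule finsler_dist_flow_limit_le[OF loss_nonneg \<mu>_lim flow limit])
  have "\<not> finsler_dist G \<mu> \<nu> < finsler_dist G \<mu> \<mu>_lim" if "is_arg_min L (\<lambda>\<rho>. \<rho> \<in> P2) \<nu>" for \<nu>
    using order_trans[OF upper] loss_drop_le_finsler_dist[of \<mu> \<nu>] minimal[OF that] by (simp add: not_less)
  then show ?thesis
    using limit_min by (auto simp: is_arg_min_def[of "finsler_dist G \<mu>"])
qed

end
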